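(* Assume: (1) $(x_i)$ is an i.i.d. sequence; (2) $\Theta\subset\mathbb{R}^{N_\theta}$ is compact and $\theta^*\in\mathrm{int}(\Theta)$ is the unique solution of $E[g(x_i,\theta)]=0$; (3) $g(x_i,\theta)$ is continuous in $\theta$ at each $\theta\in\Theta$ with probability one; (4) $E[\sup_{\theta\in\Theta}\|g_i\|^{2+\delta}]<\infty$ for some $\delta>0$ and $E[\sup_{\theta\in\mathcal{N}}\|G_i\|]<\infty$; (5) $\Omega^*=E[g(x_i,\theta^* )g(x_i,\theta^* )']$ is finite and nonsingular and $G^*=E[\partial g(x_i,\theta^* )/\partial\theta']$ has rank $N_\theta$; (6) $g(x_i,\theta)$ is continuously differentiable in $\theta$ on a neighborhood $\mathcal{N}$ of $\theta^*$. Suppose in addition that $E[\sup_{\theta\in\mathcal{N}}\|g_i\|^4]<\infty$, $E[\sup_{\theta\in\mathcal{N}}\|G_i\|^2]<\infty$, and that for $\theta\in\mathcal{N}$, $G(x_i,\theta)$ is Lipschitz in $\theta$ with prefactor $b(x_i)$ satisfying $E[b(x_i)]<\infty$. Then $\hat\theta_{\mathrm{ETEL}}-\hat\theta_{\mathrm{EL}}=O_p(n^{-3/2})$.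
   Context: $g_i=g(x_i,\theta)\in\mathbb{R}^{N_g}$, $G_i=G(x_i,\theta)=\partial g(x_i,\theta)/\partial\theta'$. ETEL estimator: $\hat\theta_{\mathrm{ETEL}}=\arg\max_\theta n^{-1}\sum_i\ln(n\hat w_i(\theta))$ with $\hat w_i(\theta)=\exp(\hat\lambda(\theta)'g_i)/\sum_j\exp(\hat\lambda(\theta)'g_j)$ and $\hat\lambda(\theta)$ solving $n^{-1}\sum_i\exp(\hat\lambda'g_i)g_i=0$. EL estimator: $\hat\theta_{\mathrm{EL}}=\arg\min_\theta n^{-1}\sum_i\ln(1-\tilde\lambda(\theta)'g_i)$ with $\tilde\lambda(\theta)=\arg\max_\lambda n^{-1}\sum_i\ln(1-\lambda'g_i)$; equivalently $\hat\theta_{\mathrm{EL}}$ maximizes $n^{-1}\sum_i\ln(nw_i(\theta))$ where $w_i(\theta)$ maximize $\sum_i\ln(nw_i)$ subject to $\sum_iw_ig_i=0$, $\sum_iw_i=1$. *)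

theory Defs
  imports "HOL-Probability.Probability"
begin

text \<open>ETEL profile objective n^-1 sum ln(n w_i(theta)), with
  w_i = exp(l'g_i)/sum_j exp(l'g_j), l solving sum_i exp(l'g_i) g_i = 0.
  If no such l exists the objective is -infinity.  (Any two solutions give
  the same weights, so the choice via SOME is immaterial.)\<close>
definition etel_obj :: "('b \<Rightarrow> real^'p \<Rightarrow> real^'g) \<Rightarrow> (nat \<Rightarrow> 'b) \<Rightarrow> nat \<Rightarrow> real^'p \<Rightarrow> ereal" where
  "etel_obj g x n \<theta> =
     (if \<exists>l. (\<Sum>i<n. exp (l \<bullet> g (x i) \<theta>) *\<^sub>R g (x i) \<theta>) = 0
      then (let l = (SOME l. (\<Sum>i<n. exp (l \<bullet> g (x i) \<theta>) *\<^sub>R g (x i) \<theta>) = 0);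
                w = (\<lambda>i. exp (l \<bullet> g (x i) \<theta>) / (\<Sum>j<n. exp (l \<bullet> g (x j) \<theta>)))
            in ereal ((1 / real n) * (\<Sum>i<n. ln (real n * w i))))
      else -\<infinity>)"

text \<open>EL profile objective: max of n^-1 sum ln(n w_i) subject to w_i > 0,
  sum w_i = 1, sum w_i g_i = 0 (-infinity if infeasible).\<close>
definition el_obj :: "('b \<Rightarrow> real^'p \<Rightarrow> real^'g) \<Rightarrow> (nat \<Rightarrow> 'b) \<Rightarrow> nat \<Rightarrow> real^'p \<Rightarrow> ereal" where
  "el_obj g x n \<theta> =
     Sup {ereal ((1 / real n) * (\<Sum>i<n. ln (real n * w i))) | w.
            (\<forall>i<n. w i > 0) \<and> (\<Sum>i<n. w i) = 1 \<and> (\<Sum>i<n. w i *\<^sub>R g (x i) \<theta>) = 0}"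

definition is_maximizer :: "('c \<Rightarrow> ereal) \<Rightarrow> 'c set \<Rightarrow> 'c \<Rightarrow> bool" where
  "is_maximizer f A t \<longleftrightarrow> t \<in> A \<and> (\<forall>s\<in>A. f s \<le> f t)"

definition bigOp :: "'a measure \<Rightarrow> (nat \<Rightarrow> 'a \<Rightarrow> real) \<Rightarrow> (nat \<Rightarrow> real) \<Rightarrow> bool" where
  "bigOp M Y r \<longleftrightarrow> (\<forall>\<epsilon>>0. \<exists>C N. \<forall>n\<ge>N.
      measure M {\<omega>\<in>space M. \<bar>Y n \<omega>\<bar> > C * r n} < \<epsilon>)"

definition outer :: "real^'g \<Rightarrow> real^'g^'g" where
  "outer v = (\<chi> i j. v $ i * v $ j)"

end

theory Submission
  imports Defs
begin

text \<open>
  The exponentially tilted weights are feasible for the EL problem, so the ETEL objective lies below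
  the EL objective, which by weak duality lies below \<open>- n\<^sup>-\<^sup>1 \<Sum> ln (1 - l \<bullet> g\<^sub>i)\<close> for every
  admissible \<open>l\<close>.  At \<open>\<theta>0\<close> the ETEL objective is at least \<open>- C / n\<close>; a short step
  of \<open>l\<close> against the sample mean then forces that mean to be \<open>O(n\<^sup>-\<^sup>1\<^sup>/\<^sup>2)\<close> at both
  estimators, and identification turns this into the \<open>n\<^sup>-\<^sup>1\<^sup>/\<^sup>2\<close> rate for both.
  Near \<open>\<theta>0\<close> both estimators satisfy first-order conditions.  The ETEL multiplier is not a critical
  point of the ETEL objective, so its derivative is removed by an adjoint vector \<open>\<mu>\<close>.  With \<open>l\<close> the ETEL
  and \<open>m\<close> the EL multiplier at the same \<open>\<theta>\<close>, the corrections \<open>m - l\<close> and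
  \<open>\<mu> + l\<close> are both \<open>O(n\<^sup>-\<^sup>1)\<close> and cancel up to \<open>O(n\<^sup>-\<^sup>3\<^sup>/\<^sup>2)\<close>; hence the EL score at
  the ETEL estimator is \<open>O(n\<^sup>-\<^sup>3\<^sup>/\<^sup>2)\<close>.  The EL score is strongly monotone near \<open>\<theta>0\<close> and
  vanishes at the EL estimator, which gives the claim.
\<close>

section \<open>Elementary inequalities and sample averages\<close>

text \<open>The argument is separated into a deterministic and a probabilistic half. For one sample
  everything follows from averages bounded by a constant \<open>K\<close>, with n^(-1/2) as the
  small parameter, so stochastic orders become plain inequalities; probability enters only to show
  that most samples are good. The Jacobian is Lipschitz but need not be differentiable, so the score
  cannot be expanded once more; monotonicity of the EL score in the direction joining the two
  estimators replaces a Taylor expansion. The cancellation is a matter of second-order terms. Let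
  \<Omega> be the sample Gram matrix and a = l . g_i. The functions 1/(1 - x) and exp x agree to
  first order and differ by x^2/2 at second order, so \<Omega>(m - l) is about -avg(a^2 g)/2. The
  equation for \<mu> + l has the source 1 + a exp a - exp a, about a^2/2, so \<Omega>(\<mu> + l) is
  about +avg(a^2 g)/2. Multipliers of order n^(-1/2) are admissible because the fourth moment keeps
  the largest |g_i| near \<theta>0 of order n^(1/4).\<close>

lemma exp_ge_quadratic:
  fixes x :: real
  assumes "-2 \<le> x"
  shows "1 + x + x\<^sup>2/4 \<le> exp x"
proof -
  have "(1 + x/2)\<^sup>2 \<le> (exp (x/2))\<^sup>2"
    using assms by (intro power_mono exp_ge_add_one_self) auto
  moreover have "(exp (x/2))\<^sup>2 = exp x"
    by (simp add: power2_eq_square flip: exp_add)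
  ultimately show ?thesis by (simp add: power2_eq_square field_simps)
qed

text \<open>The value at 0 stays written as \<open>exp 0\<close>, so that this is literally the
  growth condition \<open>\<Phi> 0 + x + x\<^sup>2/8 \<le> \<Phi> x\<close> of
  \<open>multiplier_exists\<close> for \<open>\<Phi> = exp\<close>.\<close>

lemma exp_ge_quadratic_8:
  fixes x :: real
  assumes "\<bar>x\<bar> \<le> 1/2"
  shows "exp 0 + x + x\<^sup>2/8 \<le> exp x"
proof -
  have "0 \<le> x\<^sup>2" by simp
  then show ?thesis using exp_ge_quadratic[of x] assms unfolding exp_zero by linarith
qed

lemma exp_linear_approx:
  fixes x :: real
  assumes "\<bar>x\<bar> \<le> 1/2"
  shows "\<bar>exp x - 1 - x\<bar> \<le> x\<^sup>2"
proof -
  have "exp x \<le> 1 + x + x\<^sup>2"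
  proof (cases "x \<ge> 0")
    case True
    then show ?thesis using exp_bound[of x] assms by auto
  next
    case False
    have "exp (-x) \<ge> 1 - x" using exp_ge_add_one_self[of "-x"] by simp
    then have "exp x \<le> 1 / (1 - x)" using False
      by (simp add: exp_minus field_simps)
    also have "\<dots> \<le> 1 + x + x\<^sup>2"
    proof -
      have "(1 + x + x\<^sup>2) * (1 - x) = 1 - x ^ 3" by (simp add: power2_eq_square power3_eq_cube algebra_simps)
      moreover have "x ^ 3 \<le> 0" using False by (simp add: power3_eq_cube mult_nonneg_nonpos mult_nonpos_nonpos)
      ultimately have "1 \<le> (1 + x + x\<^sup>2) * (1 - x)" by linarith
      then show ?thesis using False by (simp add: divide_le_eq)
    qed
    finally show ?thesis .
  qed
  moreover have "exp x \<ge> 1 + x" by (rule exp_ge_add_one_self)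
  ultimately show ?thesis unfolding abs_le_iff by linarith
qed

lemma exp_const_approx:
  fixes x :: real
  assumes "\<bar>x\<bar> \<le> 1/2"
  shows "\<bar>exp x - 1\<bar> \<le> 2 * \<bar>x\<bar>"
proof -
  have "x\<^sup>2 \<le> \<bar>x\<bar>" using assms mult_mono[of "\<bar>x\<bar>" "\<bar>x\<bar>" "\<bar>x\<bar>" 1] by (simp add: power2_eq_square)
  then show ?thesis using exp_linear_approx[OF assms] by linarith
qed

lemma exp_half_bounds:
  fixes x :: real
  assumes "\<bar>x\<bar> \<le> 1/2"
  shows "1/2 \<le> exp x" "exp x \<le> 2"
  using exp_const_approx[OF assms] exp_ge_add_one_self[of x] assms by linarith+

text \<open>The constant 1/8 is shared with \<open>recip_strong_mono\<close>, so that the ETEL and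
  the EL multiplier both fit the monotonicity hypothesis of \<open>multiplier_calm\<close>.\<close>

lemma exp_strong_mono:
  fixes a b :: real
  assumes "\<bar>a\<bar> \<le> 1/2" "\<bar>b\<bar> \<le> 1/2"
  shows "(a - b)\<^sup>2 / 8 \<le> (exp a - exp b) * (a - b)"
proof -
  have *: "(a - b)\<^sup>2 / 8 \<le> (exp a - exp b) * (a - b)" if "b \<le> a" "\<bar>b\<bar> \<le> 1/2" for a b :: real
  proof -
    have "exp a - exp b = exp b * (exp (a - b) - 1)" by (simp add: exp_diff field_simps)
    also have "\<dots> \<ge> (1/2) * (a - b)"
    proof (intro mult_mono)
      show "a - b \<le> exp (a - b) - 1" using exp_ge_add_one_self[of "a - b"] by linarith
    qed (use that exp_half_bounds[of b] in auto)
    finally have "(1/2) * (a - b) * (a - b) \<le> (exp a - exp b) * (a - b)"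
      using that by (intro mult_right_mono) auto
    moreover have "0 \<le> (a - b) * (a - b)" by simp
    ultimately show ?thesis by (simp only: power2_eq_square)
  qed
  show ?thesis
  proof (cases "b \<le> a")
    case True then show ?thesis using * assms by auto
  next
    case False
    then have "(b - a)\<^sup>2 / 8 \<le> (exp b - exp a) * (b - a)" using * assms by auto
    then show ?thesis by (simp add: power2_eq_square algebra_simps)
  qed
qed

text \<open>Exponentiated, the claim is 1 - x <= exp y with y = -x - x^2/8. Now
  \<open>exp_ge_quadratic\<close> bounds exp y below by 1 + y + y^2/4, and y^2/4 = x^2 (1 + x/8)^2 /
  4 makes up for the x^2/8 lost in y. The term \<open>ln (1 - 0)\<close> again matches
  \<open>\<Phi> 0\<close>.\<close>

lemma neg_ln_ge_quadratic:
  fixes x :: real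
  assumes "\<bar>x\<bar> \<le> 1/2"
  shows "- ln (1 - 0) + x + x\<^sup>2/8 \<le> - ln (1 - x)"
proof -
  have x2: "x\<^sup>2 \<le> 1/4" using power_mono[of "\<bar>x\<bar>" "1/2" 2] assms by (simp add: power2_eq_square)
  have "(7/8)\<^sup>2 \<le> (1 + x/8)\<^sup>2" using assms by (intro power_mono) auto
  then have "1/2 \<le> (1 + x/8)\<^sup>2" by (simp add: power2_eq_square)
  then have "x\<^sup>2 * (1/2) \<le> x\<^sup>2 * (1 + x/8)\<^sup>2" by (intro mult_left_mono) auto
  then have *: "x\<^sup>2 / 8 \<le> (- x - x\<^sup>2/8)\<^sup>2 / 4" by (simp add: power2_eq_square algebra_simps)
  have "1 + (- x - x\<^sup>2/8) + (- x - x\<^sup>2/8)\<^sup>2/4 \<le> exp (- x - x\<^sup>2/8)"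
    using assms x2 by (intro exp_ge_quadratic) auto
  then have "1 - x \<le> exp (- x - x\<^sup>2/8)" using * by linarith
  then have "ln (1 - x) \<le> ln (exp (- x - x\<^sup>2/8))" using assms by (subst ln_le_cancel_iff) auto
  then show ?thesis by simp
qed

lemma neg_ln_le_quadratic:
  fixes x :: real
  assumes "\<bar>x\<bar> \<le> 1/2"
  shows "- ln (1 - x) \<le> x + 2 * x\<^sup>2"
  using abs_ln_one_plus_x_minus_x_bound[of "-x"] assms by (auto simp: abs_le_iff)

lemma DERIV_neg_ln:
  fixes x :: real
  assumes "\<bar>x\<bar> \<le> 1/2"
  shows "((\<lambda>x. - ln (1 - x)) has_real_derivative 1 / (1 - x)) (at x)"
  using assms by (auto intro!: derivative_eq_intros)

lemma DERIV_recip: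
  fixes x :: real
  assumes "\<bar>x\<bar> \<le> 1/2"
  shows "((\<lambda>x. 1 / (1 - x)) has_real_derivative 1 / (1 - x)\<^sup>2) (at x)"
  using assms by (auto intro!: derivative_eq_intros simp: power2_eq_square)

lemma recip_half_bounds:
  fixes x :: real
  assumes "\<bar>x\<bar> \<le> 1/2"
  shows "4/9 \<le> 1 / (1 - x)" "1 / (1 - x) \<le> 2"
  using assms by (auto simp: field_simps)

lemma recip_approx:
  fixes x :: real
  assumes "\<bar>x\<bar> \<le> 1/2"
  shows "\<bar>1 / (1 - x) - 1\<bar> \<le> 2 * \<bar>x\<bar>"
    and "\<bar>1 / (1 - x) - 1 - x\<bar> \<le> 2 * x\<^sup>2"
    and "\<bar>1 / (1 - x) - 1 - x - x\<^sup>2\<bar> \<le> 2 * \<bar>x\<bar> ^ 3"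
proof -
  have nz: "1 - x \<noteq> 0" using assms by auto
  have *: "\<bar>y / (1 - x)\<bar> \<le> 2 * \<bar>y\<bar>" for y
  proof -
    have "\<bar>y / (1 - x)\<bar> = \<bar>y\<bar> * (1 / (1 - x))" using assms by (auto simp: abs_divide)
    also have "\<dots> \<le> \<bar>y\<bar> * 2" using recip_half_bounds[OF assms] by (intro mult_left_mono) auto
    finally show ?thesis by simp
  qed
  have "1 / (1 - x) - 1 = x / (1 - x)" using nz by (simp add: field_simps)
  then show "\<bar>1 / (1 - x) - 1\<bar> \<le> 2 * \<bar>x\<bar>" using *[of x] by simp
  have "1 / (1 - x) - 1 - x = x\<^sup>2 / (1 - x)" using nz by (simp add: field_simps power2_eq_square)
  then show "\<bar>1 / (1 - x) - 1 - x\<bar> \<le> 2 * x\<^sup>2" using *[of "x\<^sup>2"] by simp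
  have "1 / (1 - x) - 1 - x - x\<^sup>2 = x ^ 3 / (1 - x)"
    using nz by (simp add: field_simps power2_eq_square power3_eq_cube)
  then show "\<bar>1 / (1 - x) - 1 - x - x\<^sup>2\<bar> \<le> 2 * \<bar>x\<bar> ^ 3" using *[of "x ^ 3"] by (simp add: power_abs)
qed

lemma recip_diff:
  fixes a b :: real
  assumes "a \<noteq> 1" "b \<noteq> 1"
  shows "1 / (1 - a) - 1 / (1 - b) = (1 / (1 - a)) * (1 / (1 - b)) * (a - b)"
  using assms by (simp add: field_simps)

lemma recip_strong_mono:
  fixes a b :: real
  assumes "\<bar>a\<bar> \<le> 1/2" "\<bar>b\<bar> \<le> 1/2"
  shows "(a - b)\<^sup>2 / 8 \<le> (1 / (1 - a) - 1 / (1 - b)) * (a - b)"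
proof -
  have "(4/9) * (4/9) \<le> (1 / (1 - a)) * (1 / (1 - b))"
    using recip_half_bounds[OF assms(1)] recip_half_bounds[OF assms(2)] assms
    by (intro mult_mono) (auto simp: abs_le_iff)
  then have "1/8 * (a - b)\<^sup>2 \<le> (1 / (1 - a)) * (1 / (1 - b)) * (a - b)\<^sup>2" by (intro mult_right_mono) auto
  then show ?thesis using assms
    by (subst recip_diff) (auto simp: power2_eq_square)
qed

section \<open>Sample averages of reals, vectors and matrices\<close>

definition avg :: "nat \<Rightarrow> (nat \<Rightarrow> 'v::real_vector) \<Rightarrow> 'v" where
  "avg n f = (1 / real n) *\<^sub>R (\<Sum>i<n. f i)"

lemma avg_real: "avg n (f :: nat \<Rightarrow> real) = (1 / real n) * (\<Sum>i<n. f i)"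
  by (simp add: avg_def)

lemma avg_cong: "(\<And>i. i < n \<Longrightarrow> f i = h i) \<Longrightarrow> avg n f = avg n h"
  by (simp add: avg_def)

lemma avg_add: "avg n (\<lambda>i. f i + h i) = avg n f + avg n h"
  by (simp add: avg_def sum.distrib scaleR_add_right)

lemma avg_diff: "avg n (\<lambda>i. f i - h i) = avg n f - avg n h"
  by (simp add: avg_def sum_subtractf scaleR_diff_right)

lemma avg_minus: "avg n (\<lambda>i. - f i) = - avg n f"
  by (simp add: avg_def sum_negf)

lemma avg_const: "0 < n \<Longrightarrow> avg n (\<lambda>i. c) = c"
  by (simp add: avg_def sum_constant_scaleR)

lemma avg_scaleR: "avg n (\<lambda>i. c *\<^sub>R f i) = c *\<^sub>R avg n f"
  by (simp add: avg_def scaleR_sum_right)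

lemma avg_mult_left: "avg n (\<lambda>i. c * f i) = c * avg n f" for c :: real
  by (simp add: avg_def sum_distrib_left)

lemma avg_mult_right: "avg n (\<lambda>i. f i * c) = avg n f * c" for c :: real
  by (simp add: avg_def sum_distrib_right)

lemma avg_inner_right: "v \<bullet> avg n f = avg n (\<lambda>i. v \<bullet> f i)" for v :: "'v::real_inner"
  by (simp add: avg_def inner_sum_right)

lemma avg_mono: "(\<And>i. i < n \<Longrightarrow> f i \<le> h i) \<Longrightarrow> avg n f \<le> avg n h" for f :: "nat \<Rightarrow> real"
  unfolding avg_real by (intro mult_left_mono sum_mono) auto

lemma avg_nonneg: "(\<And>i. i < n \<Longrightarrow> 0 \<le> f i) \<Longrightarrow> 0 \<le> avg n f" for f :: "nat \<Rightarrow> real"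
  unfolding avg_real by (intro mult_nonneg_nonneg sum_nonneg) auto

lemma norm_avg_le: "norm (avg n f) \<le> avg n (\<lambda>i. norm (f i))" for f :: "nat \<Rightarrow> 'v::real_normed_vector"
  unfolding avg_def by (simp add: divide_right_mono norm_sum)

lemma norm_avg_bound:
  fixes f :: "nat \<Rightarrow> 'v::real_normed_vector"
  assumes "\<And>i. i < n \<Longrightarrow> norm (f i) \<le> c * e i" "avg n e \<le> K" "0 \<le> c"
  shows "norm (avg n f) \<le> c * K"
proof -
  have "norm (avg n f) \<le> avg n (\<lambda>i. c * e i)"
    using norm_avg_le[of n f] avg_mono[of n "\<lambda>i. norm (f i)" "\<lambda>i. c * e i"] assms(1) by fastforce
  also have "\<dots> \<le> c * K" unfolding avg_mult_left using assms by (intro mult_left_mono)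
  finally show ?thesis .
qed

lemma avg_eq_0_iff: "0 < n \<Longrightarrow> avg n f = 0 \<longleftrightarrow> (\<Sum>i<n. f i) = 0"
  by (simp add: avg_def)

text \<open>A crude passage from a mean to a maximum: applied to fourth powers or squares it bounds
  the largest observation by order n^(1/4) or n^(1/2).\<close>

lemma member_le_avg:
  fixes f :: "nat \<Rightarrow> real"
  assumes "\<And>i. i < n \<Longrightarrow> 0 \<le> f i" "i < n"
  shows "f i \<le> real n * avg n f"
proof -
  have "f i \<le> (\<Sum>i<n. f i)" using assms by (intro member_le_sum) auto
  then show ?thesis using assms by (simp add: avg_def)
qed

section \<open>Profile objectives and multipliers\<close>

text \<open>Weak duality: use ln y <= y - 1 at y = n w_i (1 - l . g_i). After summation the two
  constraints on \<open>w\<close> make the right side zero.\<close>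

lemma el_obj_le_dual:
  fixes g :: "'b \<Rightarrow> real^'p \<Rightarrow> real^'g"
  assumes n: "0 < n" and lt: "\<And>i. i < n \<Longrightarrow> l \<bullet> g (x i) \<theta> < 1"
  shows "el_obj g x n \<theta> \<le> ereal (- avg n (\<lambda>i. ln (1 - l \<bullet> g (x i) \<theta>)))"
  unfolding el_obj_def
proof (rule Sup_least, clarify)
  fix w :: "nat \<Rightarrow> real"
  assume w: "\<forall>i<n. 0 < w i" "(\<Sum>i<n. w i) = 1" "(\<Sum>i<n. w i *\<^sub>R g (x i) \<theta>) = 0"
  have "(\<Sum>i<n. ln (real n * w i) + ln (1 - l \<bullet> g (x i) \<theta>)) \<le> (\<Sum>i<n. real n * (w i * (1 - l \<bullet> g (x i) \<theta>)) - 1)"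
  proof (rule sum_mono)
    fix i assume "i \<in> {..<n}"
    then have i: "i < n" by simp
    have pos: "0 < real n * w i" "0 < 1 - l \<bullet> g (x i) \<theta>" using n w(1) lt[OF i] i by auto
    have "ln (real n * w i) + ln (1 - l \<bullet> g (x i) \<theta>) = ln (real n * w i * (1 - l \<bullet> g (x i) \<theta>))"
      using pos by (simp add: ln_mult_pos)
    also have "\<dots> \<le> real n * w i * (1 - l \<bullet> g (x i) \<theta>) - 1"
      using mult_pos_pos[OF pos] by (rule ln_le_minus_one)
    finally show "ln (real n * w i) + ln (1 - l \<bullet> g (x i) \<theta>) \<le> real n * (w i * (1 - l \<bullet> g (x i) \<theta>)) - 1"
      by (simp add: mult.assoc)
  qed
  also have "\<dots> = real n * ((\<Sum>i<n. w i) - l \<bullet> (\<Sum>i<n. w i *\<^sub>R g (x i) \<theta>)) - real n"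
    by (simp add: sum_subtractf inner_sum_right right_diff_distrib sum_distrib_left)
  also have "\<dots> = 0" using w by simp
  finally have "(\<Sum>i<n. ln (real n * w i)) \<le> - (\<Sum>i<n. ln (1 - l \<bullet> g (x i) \<theta>))"
    by (simp add: sum.distrib)
  then have "1 / real n * (\<Sum>i<n. ln (real n * w i)) \<le> 1 / real n * - (\<Sum>i<n. ln (1 - l \<bullet> g (x i) \<theta>))"
    by (intro mult_left_mono) auto
  then show "ereal (1 / real n * (\<Sum>i<n. ln (real n * w i))) \<le> ereal (- avg n (\<lambda>i. ln (1 - l \<bullet> g (x i) \<theta>)))"
    by (simp add: avg_real)
qed

lemma el_obj_eq_dual:
  fixes g :: "'b \<Rightarrow> real^'p \<Rightarrow> real^'g"
  assumes n: "0 < n" and lt: "\<And>i. i < n \<Longrightarrow> l \<bullet> g (x i) \<theta> < 1"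
    and foc: "avg n (\<lambda>i. (1 / (1 - l \<bullet> g (x i) \<theta>)) *\<^sub>R g (x i) \<theta>) = 0"
  shows "el_obj g x n \<theta> = ereal (- avg n (\<lambda>i. ln (1 - l \<bullet> g (x i) \<theta>)))"
proof (rule antisym[OF el_obj_le_dual[where g = g, OF n lt]])
  define w where "w i = (1 / real n) * (1 / (1 - l \<bullet> g (x i) \<theta>))" for i
  have wg: "(\<Sum>i<n. w i *\<^sub>R g (x i) \<theta>) = 0"
    using foc by (simp add: w_def avg_def scaleR_sum_right)
  \<comment> \<open>The normalisation of the weights is a consequence of \<open>foc\<close>, because
    w_i (1 - l . g_i) = 1/n for every i.\<close>
  have "(\<Sum>i<n. w i) - l \<bullet> (\<Sum>i<n. w i *\<^sub>R g (x i) \<theta>) = (\<Sum>i<n. w i * (1 - l \<bullet> g (x i) \<theta>))"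
    by (simp add: inner_sum_right sum_subtractf algebra_simps)
  also have "\<dots> = (\<Sum>i<n. 1 / real n)"
    using lt by (intro sum.cong) (force simp: w_def)+
  also have "\<dots> = 1" using n by simp
  finally have w1: "(\<Sum>i<n. w i) = 1" using wg by simp
  have pos: "\<forall>i<n. 0 < w i" using n lt by (simp add: w_def)
  have "ln (real n * w i) = - ln (1 - l \<bullet> g (x i) \<theta>)" if "i < n" for i
    using n lt[OF that] by (simp add: w_def ln_div)
  then have "- avg n (\<lambda>i. ln (1 - l \<bullet> g (x i) \<theta>)) = 1 / real n * (\<Sum>i<n. ln (real n * w i))"
    by (simp add: avg_real sum_negf)
  then show "ereal (- avg n (\<lambda>i. ln (1 - l \<bullet> g (x i) \<theta>))) \<le> el_obj g x n \<theta>"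
    unfolding el_obj_def using pos w1 wg by (intro Sup_upper) auto
qed

lemma etel_obj_le_el_obj:
  fixes g :: "'b \<Rightarrow> real^'p \<Rightarrow> real^'g"
  assumes n: "0 < n"
  shows "etel_obj g x n \<theta> \<le> el_obj g x n \<theta>"
proof (cases "\<exists>l. (\<Sum>i<n. exp (l \<bullet> g (x i) \<theta>) *\<^sub>R g (x i) \<theta>) = 0")
  case True
  define l where "l = (SOME l. (\<Sum>i<n. exp (l \<bullet> g (x i) \<theta>) *\<^sub>R g (x i) \<theta>) = 0)"
  have l: "(\<Sum>i<n. exp (l \<bullet> g (x i) \<theta>) *\<^sub>R g (x i) \<theta>) = 0"
    unfolding l_def using someI_ex[OF True] .
  define F where "F = (\<Sum>j<n. exp (l \<bullet> g (x j) \<theta>))"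
  have F: "0 < F" unfolding F_def using n by (intro sum_pos) auto
  define w where "w i = exp (l \<bullet> g (x i) \<theta>) / F" for i
  have "(\<Sum>i<n. w i *\<^sub>R g (x i) \<theta>) = (1 / F) *\<^sub>R (\<Sum>i<n. exp (l \<bullet> g (x i) \<theta>) *\<^sub>R g (x i) \<theta>)"
    by (simp add: w_def scaleR_sum_right)
  then have "(\<Sum>i<n. w i *\<^sub>R g (x i) \<theta>) = 0" using l by simp
  moreover have "(\<Sum>i<n. w i) = 1"
    using F unfolding w_def by (simp add: F_def flip: sum_divide_distrib)
  moreover have "\<forall>i<n. 0 < w i" using F by (simp add: w_def)
  moreover have "etel_obj g x n \<theta> = ereal ((1 / real n) * (\<Sum>i<n. ln (real n * w i)))"
    using True unfolding etel_obj_def Let_def w_def F_def l_def by simp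
  ultimately show ?thesis unfolding el_obj_def by (intro Sup_upper) auto
next
  case False
  then show ?thesis unfolding etel_obj_def by simp
qed

text \<open>Pairing the difference of the two equations with l - m gives a sum of products (exp a -
  exp b)(a - b). Each is nonnegative since exp is increasing, so each is zero. The vectors
  \<open>v i\<close> need not span, hence \<open>l\<close> itself may be ambiguous; the weights
  depend only on the products \<open>l \<bullet> v i\<close>.\<close>

lemma exp_tilt_unique:
  fixes v :: "nat \<Rightarrow> 'v::real_inner"
  assumes l: "(\<Sum>i<n. exp (l \<bullet> v i) *\<^sub>R v i) = 0" and m: "(\<Sum>i<n. exp (m \<bullet> v i) *\<^sub>R v i) = 0" and "i < n"
  shows "l \<bullet> v i = m \<bullet> v i"
proof -
  let ?t = "\<lambda>i. (exp (l \<bullet> v i) - exp (m \<bullet> v i)) * (l \<bullet> v i - m \<bullet> v i)"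
  have "(\<Sum>i<n. ?t i) = (l - m) \<bullet> ((\<Sum>i<n. exp (l \<bullet> v i) *\<^sub>R v i) - (\<Sum>i<n. exp (m \<bullet> v i) *\<^sub>R v i))"
    unfolding sum_subtractf[symmetric] inner_sum_right
    by (intro sum.cong) (simp_all add: algebra_simps)
  then have "(\<Sum>i<n. ?t i) = 0" using l m by simp
  moreover have "0 \<le> ?t i" for i
    by (cases "l \<bullet> v i \<le> m \<bullet> v i") (auto intro: mult_nonpos_nonpos mult_nonneg_nonneg)
  ultimately have "?t i = 0" using \<open>i < n\<close> by (simp add: sum_nonneg_eq_0_iff)
  then show ?thesis by auto
qed

text \<open>Frees the objective from the \<open>SOME\<close> in its definition: by
  \<open>exp_tilt_unique\<close> a solution constructed elsewhere gives the same weights.\<close>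

lemma etel_obj_eq:
  fixes g :: "'b \<Rightarrow> real^'p \<Rightarrow> real^'g"
  assumes n: "0 < n" and foc: "avg n (\<lambda>i. exp (l \<bullet> g (x i) \<theta>) *\<^sub>R g (x i) \<theta>) = 0"
  shows "etel_obj g x n \<theta> = ereal (l \<bullet> avg n (\<lambda>i. g (x i) \<theta>) - ln (avg n (\<lambda>i. exp (l \<bullet> g (x i) \<theta>))))"
proof -
  have foc': "(\<Sum>i<n. exp (l \<bullet> g (x i) \<theta>) *\<^sub>R g (x i) \<theta>) = 0" using foc n by (simp add: avg_eq_0_iff)
  define m where "m = (SOME l. (\<Sum>i<n. exp (l \<bullet> g (x i) \<theta>) *\<^sub>R g (x i) \<theta>) = 0)"
  have m: "(\<Sum>i<n. exp (m \<bullet> g (x i) \<theta>) *\<^sub>R g (x i) \<theta>) = 0"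
    unfolding m_def by (rule someI[of _ l]) (rule foc')
  have ml: "m \<bullet> g (x i) \<theta> = l \<bullet> g (x i) \<theta>" if "i < n" for i
    using exp_tilt_unique[OF m foc' that] .
  define F where "F = (\<Sum>j<n. exp (l \<bullet> g (x j) \<theta>))"
  have F: "0 < F" unfolding F_def using n by (intro sum_pos) auto
  have "etel_obj g x n \<theta> = ereal ((1 / real n) * (\<Sum>i<n. ln (real n * (exp (m \<bullet> g (x i) \<theta>) / (\<Sum>j<n. exp (m \<bullet> g (x j) \<theta>))))))"
    using m unfolding etel_obj_def Let_def m_def by auto
  also have "\<dots> = ereal ((1 / real n) * (\<Sum>i<n. ln (real n * (exp (l \<bullet> g (x i) \<theta>) / F))))"
    using ml unfolding F_def by simp
  also have "(\<Sum>i<n. ln (real n * (exp (l \<bullet> g (x i) \<theta>) / F))) = (\<Sum>i<n. l \<bullet> g (x i) \<theta> - ln (F / real n))"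
    using F n by (intro sum.cong) (simp_all add: ln_mult_pos ln_div)
  also have "(1 / real n) * \<dots> = l \<bullet> avg n (\<lambda>i. g (x i) \<theta>) - ln (F / real n)"
    using n by (simp add: sum_subtractf avg_def inner_sum_right right_diff_distrib)
  finally show ?thesis by (simp add: F_def avg_real)
qed

text \<open>With a = l . v_i, the multiplier equation allows exp a to be replaced by exp a (1 - a)
  inside the average, and exp a (1 - a) <= 1. So the average of exp a is at most 1 and the
  subtracted logarithm is nonpositive.\<close>

lemma etel_dual_ge:
  fixes v :: "nat \<Rightarrow> 'v::real_inner"
  assumes n: "0 < n" and foc: "avg n (\<lambda>i. exp (l \<bullet> v i) *\<^sub>R v i) = 0"
  shows "l \<bullet> avg n v \<le> l \<bullet> avg n v - ln (avg n (\<lambda>i. exp (l \<bullet> v i)))"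
proof -
  have "avg n (\<lambda>i. exp (l \<bullet> v i)) - l \<bullet> avg n (\<lambda>i. exp (l \<bullet> v i) *\<^sub>R v i) = avg n (\<lambda>i. exp (l \<bullet> v i) * (1 - l \<bullet> v i))"
    by (simp add: avg_inner_right flip: avg_diff) (simp add: algebra_simps)
  also have "\<dots> \<le> avg n (\<lambda>i. 1)"
  proof (rule avg_mono)
    fix i
    have "1 - l \<bullet> v i \<le> exp (- (l \<bullet> v i))" using exp_ge_add_one_self[of "- (l \<bullet> v i)"] by linarith
    then have "exp (l \<bullet> v i) * (1 - l \<bullet> v i) \<le> exp (l \<bullet> v i) * exp (- (l \<bullet> v i))" by (intro mult_left_mono) auto
    then show "exp (l \<bullet> v i) * (1 - l \<bullet> v i) \<le> 1" by (simp flip: exp_add)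
  qed
  finally have "avg n (\<lambda>i. exp (l \<bullet> v i)) \<le> 1" using n foc by (simp add: avg_const)
  moreover have "0 < avg n (\<lambda>i. exp (l \<bullet> v i))" unfolding avg_real using n
    by (intro mult_pos_pos sum_pos) auto
  ultimately show ?thesis by (simp add: ln_le_zero_iff)
qed

section \<open>Existence and stability of multipliers\<close>

lemma inner_small:
  fixes u w :: "'v::real_inner"
  assumes "\<rho> * norm w \<le> 1/2" "norm u \<le> \<rho>"
  shows "\<bar>u \<bullet> w\<bar> \<le> 1/2"
proof -
  have "\<bar>u \<bullet> w\<bar> \<le> norm u * norm w" by (rule Cauchy_Schwarz_ineq2)
  also have "\<dots> \<le> \<rho> * norm w" using assms by (intro mult_right_mono) auto
  finally show ?thesis using assms by simp
qed

text \<open>Variational: the average of \<Phi>(l . v_i) is minimised over the closed ball of radius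
  \<rho>. On the sphere the quadratic growth is at least \<kappa> \<rho>^2 / 8, which beats the
  linear term because the mean is below \<kappa> \<rho> / 8; so the minimiser is interior and its
  gradient vanishes. \<open>\<Phi> = exp\<close> gives the ETEL multiplier, \<Phi>(x) = -ln(1 - x)
  the EL one.\<close>

lemma multiplier_exists:
  fixes v :: "nat \<Rightarrow> 'v::euclidean_space" and \<Phi> \<phi> :: "real \<Rightarrow> real"
  assumes n: "0 < n" and \<rho>: "0 < \<rho>"
    and curv: "\<And>u. \<kappa> * (norm u)\<^sup>2 \<le> avg n (\<lambda>i. (u \<bullet> v i)\<^sup>2)"
    and small: "\<And>i. i < n \<Longrightarrow> \<rho> * norm (v i) \<le> 1/2"
    and mean: "norm (avg n v) < \<kappa> * \<rho> / 8"
    and deriv: "\<And>x. \<bar>x\<bar> \<le> 1/2 \<Longrightarrow> (\<Phi> has_real_derivative \<phi> x) (at x)"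
    and quad: "\<And>x. \<bar>x\<bar> \<le> 1/2 \<Longrightarrow> \<Phi> 0 + x + x\<^sup>2/8 \<le> \<Phi> x"
  obtains l where "norm l < \<rho>" "avg n (\<lambda>i. \<phi> (l \<bullet> v i) *\<^sub>R v i) = 0"
proof -
  define F where "F l = avg n (\<lambda>i. \<Phi> (l \<bullet> v i))" for l
  have F_deriv: "(F has_derivative (\<lambda>h. avg n (\<lambda>i. \<phi> (l \<bullet> v i) * (h \<bullet> v i)))) (at l)" if "norm l \<le> \<rho>" for l
    unfolding F_def avg_def
  proof (intro has_derivative_scaleR_right has_derivative_sum)
    fix i assume "i \<in> {..<n}"
    then have "\<bar>l \<bullet> v i\<bar> \<le> 1/2" using inner_small[OF small that] by auto
    then have "(\<Phi> has_derivative (*) (\<phi> (l \<bullet> v i))) (at (l \<bullet> v i))"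
      using deriv by (simp add: has_field_derivative_def)
    moreover have "((\<lambda>l. l \<bullet> v i) has_derivative (\<lambda>h. h \<bullet> v i)) (at l)"
      by (rule has_derivative_inner_left) (rule has_derivative_ident)
    ultimately show "((\<lambda>l. \<Phi> (l \<bullet> v i)) has_derivative (\<lambda>h. \<phi> (l \<bullet> v i) * (h \<bullet> v i))) (at l)"
      using has_derivative_compose by blast
  qed
  have "continuous_on (cball 0 \<rho>) F"
    by (intro has_derivative_continuous_on) (use F_deriv has_derivative_at_withinI in fastforce)
  then obtain l where l: "l \<in> cball 0 \<rho>" "\<And>m. m \<in> cball 0 \<rho> \<Longrightarrow> F l \<le> F m"
    using continuous_attains_inf[of "cball 0 \<rho>" F] \<rho> by auto
  have F0: "F l \<le> \<Phi> 0" using l(2)[of 0] \<rho> n by (simp add: F_def avg_const)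
  have "norm l \<noteq> \<rho>"
  proof
    assume eq: "norm l = \<rho>"
    have "\<Phi> 0 + l \<bullet> avg n v + avg n (\<lambda>i. (l \<bullet> v i)\<^sup>2) / 8 = avg n (\<lambda>i. \<Phi> 0 + l \<bullet> v i + (l \<bullet> v i)\<^sup>2 / 8)"
      using n avg_mult_right[of n "\<lambda>i. (l \<bullet> v i)\<^sup>2" "1/8"] by (simp add: avg_add avg_const avg_inner_right)
    also have "\<dots> \<le> F l" unfolding F_def
      using inner_small[OF small] eq by (intro avg_mono quad) auto
    finally have 1: "l \<bullet> avg n v + avg n (\<lambda>i. (l \<bullet> v i)\<^sup>2) / 8 \<le> 0" using F0 by linarith
    have "\<bar>l \<bullet> avg n v\<bar> \<le> \<rho> * norm (avg n v)" using Cauchy_Schwarz_ineq2[of l "avg n v"] eq by simp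
    also have "\<dots> < \<rho> * (\<kappa> * \<rho> / 8)" using mean \<rho> by (intro mult_strict_left_mono)
    finally show False using 1 curv[of l] eq by (simp add: power2_eq_square field_simps)
  qed
  then have nl: "norm l < \<rho>" using l(1) by simp
  have "(\<lambda>h. avg n (\<lambda>i. \<phi> (l \<bullet> v i) * (h \<bullet> v i))) = (\<lambda>h. 0)"
    using F_deriv[of l] nl l(2)
    by (intro differential_zero_maxmin[of l "ball 0 \<rho>" F]) auto
  then have "avg n (\<lambda>i. \<phi> (l \<bullet> v i) * (h \<bullet> v i)) = 0" for h by (rule fun_cong)
  then have "h \<bullet> avg n (\<lambda>i. \<phi> (l \<bullet> v i) *\<^sub>R v i) = 0" for h by (simp add: avg_inner_right)
  then have "avg n (\<lambda>i. \<phi> (l \<bullet> v i) *\<^sub>R v i) = 0" using inner_eq_zero_iff by blast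
  then show ?thesis using nl that by blast
qed

text \<open>Strong monotonicity of the map from a multiplier to its residual: pairing the residuals
  at \<open>l\<close> and \<open>m\<close> with l - m dominates the Gram form of l - m. Thus an
  approximate solution \<open>m\<close> lies within its own residual of the exact one, up to the
  factor 8/\<kappa>.\<close>

lemma multiplier_calm:
  fixes v :: "nat \<Rightarrow> 'v::real_inner"
  assumes curv: "\<And>u. \<kappa> * (norm u)\<^sup>2 \<le> avg n (\<lambda>i. (u \<bullet> v i)\<^sup>2)"
    and small: "\<And>i. i < n \<Longrightarrow> \<rho> * norm (v i) \<le> 1/2"
    and mono: "\<And>a b. \<bar>a\<bar> \<le> 1/2 \<Longrightarrow> \<bar>b\<bar> \<le> 1/2 \<Longrightarrow> (a - b)\<^sup>2 / 8 \<le> (\<phi> a - \<phi> b) * (a - b)"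
    and l: "norm l \<le> \<rho>" "avg n (\<lambda>i. \<phi> (l \<bullet> v i) *\<^sub>R v i) = 0" and m: "norm m \<le> \<rho>"
  shows "\<kappa> * norm (l - m) \<le> 8 * norm (avg n (\<lambda>i. \<phi> (m \<bullet> v i) *\<^sub>R v i))"
proof (cases "l = m")
  case False
  let ?r = "avg n (\<lambda>i. \<phi> (m \<bullet> v i) *\<^sub>R v i)"
  have "\<kappa> * (norm (l - m))\<^sup>2 \<le> avg n (\<lambda>i. ((l - m) \<bullet> v i)\<^sup>2)" by (rule curv)
  also have "\<dots> \<le> avg n (\<lambda>i. 8 * ((\<phi> (l \<bullet> v i) - \<phi> (m \<bullet> v i)) * ((l - m) \<bullet> v i)))"
  proof (rule avg_mono)
    fix i assume i: "i < n"
    show "((l - m) \<bullet> v i)\<^sup>2 \<le> 8 * ((\<phi> (l \<bullet> v i) - \<phi> (m \<bullet> v i)) * ((l - m) \<bullet> v i))"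
      using mono[OF inner_small[OF small[OF i] l(1)] inner_small[OF small[OF i] m]]
      by (simp add: inner_diff_left)
  qed
  also have "\<dots> = 8 * ((l - m) \<bullet> (avg n (\<lambda>i. \<phi> (l \<bullet> v i) *\<^sub>R v i) - ?r))"
    unfolding avg_mult_left by (simp add: avg_inner_right flip: avg_diff) (simp add: algebra_simps)
  also have "\<dots> \<le> 8 * (norm (l - m) * norm ?r)"
    using norm_cauchy_schwarz[of "l - m" "- ?r"] l(2) by simp
  finally have "(\<kappa> * norm (l - m)) * norm (l - m) \<le> (8 * norm ?r) * norm (l - m)"
    by (simp add: power2_eq_square algebra_simps)
  then show ?thesis using False by (simp add: mult_le_cancel_right)
qed simp

section \<open>Comparison and monotonicity of the scores\<close>

lemma abs_mult_bound: "\<bar>x * y\<bar> \<le> a * c" if "\<bar>x\<bar> \<le> a" "\<bar>y\<bar> \<le> c" for x y a c :: real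
  using that by (simp add: abs_mult mult_mono')

lemma abs_inner_bound: "\<bar>u \<bullet> x\<bar> \<le> a * c" if "norm u \<le> a" "norm x \<le> c" for u x :: "'v::real_inner"
  using Cauchy_Schwarz_ineq2[of u x] mult_mono'[OF that] by simp

lemma norm_scaleR_bound: "norm (r *\<^sub>R x) \<le> a * c" if "\<bar>r\<bar> \<le> a" "norm x \<le> c" for x :: "'v::real_normed_vector"
  using that by (simp add: mult_mono')

text \<open>Pairing the equation with \<open>u\<close> gives a form that is at least \<beta>
  \<kappa> |u|^2. In effect this bounds the inverse of a weighted Gram matrix by 1/(\<beta>
  \<kappa>).\<close>

lemma weighted_gram_bound:
  fixes v :: "nat \<Rightarrow> 'v::real_inner"
  assumes curv: "\<And>u. \<kappa> * (norm u)\<^sup>2 \<le> avg n (\<lambda>i. (u \<bullet> v i)\<^sup>2)"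
    and \<omega>: "\<And>i. i < n \<Longrightarrow> \<beta> \<le> \<omega> i" "0 \<le> \<beta>"
    and eq: "avg n (\<lambda>i. (\<omega> i * (u \<bullet> v i)) *\<^sub>R v i) = r" and r: "norm r \<le> C"
  shows "\<beta> * \<kappa> * norm u \<le> C"
proof (cases "u = 0")
  case True
  then show ?thesis using order_trans[OF norm_ge_zero r] by simp
next
  case False
  have "\<beta> * (\<kappa> * (norm u)\<^sup>2) \<le> avg n (\<lambda>i. \<beta> * (u \<bullet> v i)\<^sup>2)"
    unfolding avg_mult_left using curv \<omega> by (intro mult_left_mono)
  also have "\<dots> \<le> avg n (\<lambda>i. \<omega> i * (u \<bullet> v i)\<^sup>2)" using \<omega> by (intro avg_mono mult_right_mono) auto
  also have "\<dots> = u \<bullet> r" by (simp add: avg_inner_right power2_eq_square mult.assoc flip: eq)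
  also have "\<dots> \<le> norm u * C" using norm_cauchy_schwarz[of u r] r mult_left_mono[OF r, of "norm u"] by simp
  finally have "(\<beta> * \<kappa> * norm u) * norm u \<le> C * norm u" by (simp add: power2_eq_square algebra_simps)
  then show ?thesis using False by (simp add: mult_le_cancel_right)
qed

text \<open>The single envelope \<open>e\<close> dominates every monomial in \<open>q\<close>, \<open>p\<close>, \<open>b\<close> that occurs in
  the expansions below.\<close>

locale sample_envelope =
  fixes n :: nat and q p b e :: "nat \<Rightarrow> real" and K :: real
  assumes n: "0 < n" and K: "avg n e \<le> K"
    and q0: "\<And>i. i < n \<Longrightarrow> 0 \<le> q i" and p0: "\<And>i. i < n \<Longrightarrow> 0 \<le> p i"
    and b0: "\<And>i. i < n \<Longrightarrow> 0 \<le> b i"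
    and e1: "\<And>i. i < n \<Longrightarrow> 1 + q i ^ 4 + (p i)\<^sup>2 + b i \<le> e i"
begin

lemma e_ge_1: "i < n \<Longrightarrow> 1 \<le> e i"
proof -
  assume "i < n"
  moreover have "0 \<le> q i ^ 4" "0 \<le> (p i)\<^sup>2" by auto
  ultimately show ?thesis using e1[of i] b0[of i] by linarith
qed

lemma K_ge_1: "1 \<le> K"
  using avg_mono[of n "\<lambda>i. 1" e] e_ge_1 n K by (simp add: avg_const)

text \<open>Mixed products are split by x y <= x^2/2 + y^2/2. The extreme case
  \<open>p i * (q i)\<^sup>2\<close> consumes exactly a square of \<open>p\<close> and a fourth
  power of \<open>q\<close>; this is where second moments of the Jacobian and fourth moments of the
  moment function come in.\<close>

lemma monomials:
  assumes "i < n"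
  shows "q i \<le> e i" "(q i)\<^sup>2 \<le> e i" "q i ^ 3 \<le> e i" "q i ^ 4 \<le> e i" "p i \<le> e i" "p i * q i \<le> e i"
    "p i * (q i)\<^sup>2 \<le> e i" "(p i)\<^sup>2 \<le> e i" "b i \<le> e i"
proof -
  note e = e1[OF assms]
  have bi: "0 \<le> b i" using b0 assms by auto
  have q4: "((q i)\<^sup>2)\<^sup>2 = q i ^ 4" by (simp flip: power_mult)
  have q40: "0 \<le> q i ^ 4" by simp
  have p20: "0 \<le> (p i)\<^sup>2" by simp
  have sq: "x \<le> 1 + x\<^sup>2" for x :: real
    using zero_le_power2[of "x - 1/2"] unfolding power2_diff by (simp add: power2_eq_square)
  have pr: "x * y \<le> x\<^sup>2 / 2 + y\<^sup>2 / 2" for x y :: real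
    using zero_le_power2[of "x - y"] unfolding power2_diff by simp
  have q2: "(q i)\<^sup>2 \<le> 1 / 2 + q i ^ 4 / 2" using pr[of 1 "(q i)\<^sup>2"] by simp
  have q1: "q i \<le> 3/4 + q i ^ 4 / 4" using pr[of 1 "q i"] q2 by simp
  have q3: "q i ^ 3 \<le> 1/4 + q i ^ 4 * (3/4)"
    using pr[of "q i" "(q i)\<^sup>2"] q2 by (simp add: power2_eq_square power3_eq_cube power4_eq_xxxx mult.assoc)
  show "q i \<le> e i" "(q i)\<^sup>2 \<le> e i" "q i ^ 3 \<le> e i" "q i ^ 4 \<le> e i" "(p i)\<^sup>2 \<le> e i" "p i \<le> e i" "b i \<le> e i"
    using q1 q2 q3 e q40 p20 bi sq[of "p i"] by linarith+
  show "p i * q i \<le> e i" using pr[of "p i" "q i"] q2 e q40 p20 bi by linarith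
  show "p i * (q i)\<^sup>2 \<le> e i" using pr[of "p i" "(q i)\<^sup>2"] e q40 p20 bi q4 by linarith
qed

lemma norm_avg_e:
  fixes f :: "nat \<Rightarrow> 'v::real_normed_vector"
  assumes "\<And>i. i < n \<Longrightarrow> norm (f i) \<le> c * e i" "0 \<le> c"
  shows "norm (avg n f) \<le> c * K"
  using norm_avg_bound[OF assms(1) K assms(2)] .

text \<open>\<open>B\<close> is the ETEL first-order condition, and the conclusion bounds the EL score.\<close>

lemma score_gap:
  fixes v w :: "nat \<Rightarrow> 'v::real_inner"
  assumes \<kappa>: "0 < \<kappa>" and curv: "\<And>u. \<kappa> * (norm u)\<^sup>2 \<le> avg n (\<lambda>i. (u \<bullet> v i)\<^sup>2)"
    and \<rho>: "0 \<le> \<rho>" "\<And>i. i < n \<Longrightarrow> \<rho> * q i \<le> 1/2" and H: "0 \<le> H"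
    and v: "\<And>i. i < n \<Longrightarrow> norm (v i) \<le> q i" and w: "\<And>i. i < n \<Longrightarrow> norm (w i) \<le> p i * H"
    and l: "norm l \<le> \<rho>" "avg n (\<lambda>i. exp (l \<bullet> v i) *\<^sub>R v i) = 0"
    and m: "norm m \<le> \<rho>" "avg n (\<lambda>i. (1 / (1 - m \<bullet> v i)) *\<^sub>R v i) = 0"
    and \<mu>: "avg n (\<lambda>i. (exp (l \<bullet> v i) * (\<mu> \<bullet> v i)) *\<^sub>R v i) = avg n v"
    and B: "l \<bullet> avg n w - avg n (\<lambda>i. exp (l \<bullet> v i) * (l \<bullet> w i)) / avg n (\<lambda>i. exp (l \<bullet> v i))
            - avg n (\<lambda>i. exp (l \<bullet> v i) * ((l \<bullet> w i) * (\<mu> \<bullet> v i) + \<mu> \<bullet> w i)) = 0"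
    and D: "D = 6 * K / \<kappa>"
  shows "\<bar>avg n (\<lambda>i. (m \<bullet> w i) / (1 - m \<bullet> v i))\<bar> \<le> (4 + 7 * D + 12 * K + (3 + 4 * D) * K / \<kappa>) * K * \<rho> ^ 3 * H"
proof -
  \<comment> \<open>The two corrections of second order: EL against ETEL multiplier, and adjoint
    vector against its leading term -l.\<close>
  define d \<nu> where "d = m - l" and "\<nu> = \<mu> + l"
  define a where "a i = l \<bullet> v i" for i
  define c where "c i = m \<bullet> v i" for i
  define F where "F = avg n (\<lambda>i. exp (a i))"
  have K0: "0 \<le> K" using K_ge_1 by simp
  have D0: "0 \<le> D" using K0 \<kappa> D by simp
  have a: "\<bar>a i\<bar> \<le> \<rho> * q i" "\<bar>a i\<bar> \<le> 1/2" if "i < n" for i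
    using abs_inner_bound[OF l(1) v[OF that]] \<rho>(2)[OF that] by (auto simp: a_def)
  have b: "\<bar>c i\<bar> \<le> \<rho> * q i" "\<bar>c i\<bar> \<le> 1/2" if "i < n" for i
    using abs_inner_bound[OF m(1) v[OF that]] \<rho>(2)[OF that] by (auto simp: c_def)
  have ba: "c i = a i + d \<bullet> v i" for i by (simp add: a_def c_def d_def inner_diff_left)
  have \<mu>a: "\<mu> \<bullet> v i = \<nu> \<bullet> v i - a i" for i by (simp add: a_def \<nu>_def inner_add_left)
  have a2: "(a i)\<^sup>2 \<le> \<rho>\<^sup>2 * (q i)\<^sup>2" and b2: "(c i)\<^sup>2 \<le> \<rho>\<^sup>2 * (q i)\<^sup>2" if "i < n" for i
    using power_mono[OF a(1)[OF that], of 2] power_mono[OF b(1)[OF that], of 2] by (simp_all add: power_mult_distrib)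
  have a3: "\<bar>a i\<bar> ^ 3 \<le> \<rho> ^ 3 * q i ^ 3" and b3: "\<bar>c i\<bar> ^ 3 \<le> \<rho> ^ 3 * q i ^ 3" if "i < n" for i
    using power_mono[OF a(1)[OF that], of 3] power_mono[OF b(1)[OF that], of 3] by (simp_all add: power_mult_distrib)
  \<comment> \<open>This expression is about a^2/2. It serves twice: as the source in the equation
    for \<open>\<nu>\<close>, and, averaged, as the deviation of the normaliser \<open>F\<close>
    from 1.\<close>
  have sub_exp: "\<bar>1 + a i * exp (a i) - exp (a i)\<bar> \<le> 3 * (\<rho>\<^sup>2 * (q i)\<^sup>2)" if "i < n" for i
  proof -
    have "1 + a i * exp (a i) - exp (a i) = - (exp (a i) - 1 - a i) + a i * (exp (a i) - 1)" by (simp add: algebra_simps)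
    moreover have "\<bar>a i * (exp (a i) - 1)\<bar> \<le> \<bar>a i\<bar> * (2 * \<bar>a i\<bar>)"
      by (rule abs_mult_bound) (use exp_const_approx a(2)[OF that] in auto)
    moreover have "\<bar>a i\<bar> * (2 * \<bar>a i\<bar>) = 2 * (a i)\<^sup>2" by (simp add: power2_eq_square)
    ultimately show ?thesis using exp_linear_approx[OF a(2)[OF that]] a2[OF that] by linarith
  qed
  have r2: "norm (s *\<^sub>R v i) \<le> (3 * \<rho>\<^sup>2) * e i" if "i < n" "\<bar>s\<bar> \<le> 3 * (\<rho>\<^sup>2 * (q i)\<^sup>2)" for i s
  proof -
    have "norm (s *\<^sub>R v i) \<le> 3 * (\<rho>\<^sup>2 * (q i)\<^sup>2) * q i" using that v by (intro norm_scaleR_bound) auto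
    also have "\<dots> = (3 * \<rho>\<^sup>2) * q i ^ 3" by (simp add: power2_eq_square power3_eq_cube)
    also have "\<dots> \<le> (3 * \<rho>\<^sup>2) * e i" using monomials[OF that(1)] by (intro mult_left_mono) auto
    finally show ?thesis .
  qed
  have d: "norm d \<le> D * \<rho>\<^sup>2"
  proof -
    \<comment> \<open>Both multiplier equations have value zero, so the difference of the two
      weights may be subtracted under the average at no cost. What remains is of second
      order.\<close>
    let ?s = "\<lambda>i. d \<bullet> v i - (1 / (1 - c i) - exp (a i))"
    have "1 * \<kappa> * norm d \<le> (3 * \<rho>\<^sup>2) * K"
    proof (rule weighted_gram_bound[OF curv])
      show "avg n (\<lambda>i. (1 * (d \<bullet> v i)) *\<^sub>R v i) = avg n (\<lambda>i. ?s i *\<^sub>R v i)"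
        using l(2) m(2) by (simp add: scaleR_diff_left avg_diff a_def c_def)
      show "norm (avg n (\<lambda>i. ?s i *\<^sub>R v i)) \<le> (3 * \<rho>\<^sup>2) * K"
      proof (intro norm_avg_e r2)
        fix i assume i: "i < n"
        have "?s i = - (1 / (1 - c i) - 1 - c i) + (exp (a i) - 1 - a i)" by (simp add: ba)
        then show "\<bar>?s i\<bar> \<le> 3 * (\<rho>\<^sup>2 * (q i)\<^sup>2)"
          using recip_approx(2)[OF b(2)[OF i]] exp_linear_approx[OF a(2)[OF i]] a2[OF i] b2[OF i] by linarith
      qed auto
    qed auto
    then have "norm d \<le> 3 * K / \<kappa> * \<rho>\<^sup>2" using \<kappa> by (simp add: field_simps)
    also have "\<dots> \<le> D * \<rho>\<^sup>2" unfolding D using \<kappa> K0 by (intro mult_right_mono divide_right_mono) auto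
    finally show ?thesis .
  qed
  have \<nu>: "norm \<nu> \<le> D * \<rho>\<^sup>2"
  proof -
    let ?s = "\<lambda>i. 1 + a i * exp (a i) - exp (a i)"
    \<comment> \<open>Here the Gram weights are exp a >= 1/2; dividing by 1/2 turns 3 into the 6 in
      \<open>D\<close>.\<close>
    have "1/2 * \<kappa> * norm \<nu> \<le> (3 * \<rho>\<^sup>2) * K"
    proof (rule weighted_gram_bound[OF curv])
      have "avg n (\<lambda>i. (exp (a i) * (\<nu> \<bullet> v i)) *\<^sub>R v i) = avg n (\<lambda>i. (exp (a i) * (\<mu> \<bullet> v i)) *\<^sub>R v i + (a i * exp (a i)) *\<^sub>R v i)"
        by (rule avg_cong) (simp add: \<mu>a algebra_simps)
      also have "\<dots> = avg n v + avg n (\<lambda>i. (a i * exp (a i)) *\<^sub>R v i) - avg n (\<lambda>i. exp (a i) *\<^sub>R v i)"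
        using \<mu> l(2) by (simp add: avg_add a_def)
      also have "\<dots> = avg n (\<lambda>i. ?s i *\<^sub>R v i)"
        by (simp add: scaleR_diff_left scaleR_add_left avg_add avg_diff)
      finally show "avg n (\<lambda>i. (exp (a i) * (\<nu> \<bullet> v i)) *\<^sub>R v i) = avg n (\<lambda>i. ?s i *\<^sub>R v i)" .
      show "norm (avg n (\<lambda>i. ?s i *\<^sub>R v i)) \<le> (3 * \<rho>\<^sup>2) * K"
        by (intro norm_avg_e r2 sub_exp) auto
    qed (use exp_half_bounds a(2) in auto)
    then show ?thesis unfolding D using \<kappa> by (simp add: field_simps)
  qed
  have dv: "\<bar>d \<bullet> v i\<bar> \<le> D * \<rho>\<^sup>2 * q i" and \<nu>v: "\<bar>\<nu> \<bullet> v i\<bar> \<le> D * \<rho>\<^sup>2 * q i" if "i < n" for i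
    using abs_inner_bound[OF d v[OF that]] abs_inner_bound[OF \<nu> v[OF that]] by auto
  have d\<nu>: "norm (d + \<nu>) \<le> (3 + 4 * D) * K / \<kappa> * \<rho> ^ 3"
  proof -
    let ?s = "\<lambda>i. (d + \<nu>) \<bullet> v i - 1 / (1 - c i) + 1 - exp (a i) * (\<mu> \<bullet> v i)"
    have "1 * \<kappa> * norm (d + \<nu>) \<le> ((3 + 4 * D) * \<rho> ^ 3) * K"
    proof (rule weighted_gram_bound[OF curv])
      show "avg n (\<lambda>i. (1 * ((d + \<nu>) \<bullet> v i)) *\<^sub>R v i) = avg n (\<lambda>i. ?s i *\<^sub>R v i)"
        using \<mu> m(2) by (simp add: scaleR_diff_left scaleR_add_left avg_add avg_diff a_def c_def)
      show "norm (avg n (\<lambda>i. ?s i *\<^sub>R v i)) \<le> ((3 + 4 * D) * \<rho> ^ 3) * K"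
      proof (rule norm_avg_e)
        fix i assume i: "i < n"
        \<comment> \<open>All second-order terms are gone: the difference of the squares of
          \<open>c i\<close> and \<open>a i\<close> equals
          \<open>(d \<bullet> v i) * (a i + c i)\<close>, which is cubic because \<open>d\<close> is
          already quadratic. Each of the four summands has order \<rho>^3.\<close>
        have eq: "?s i = - (1 / (1 - c i) - 1 - c i - (c i)\<^sup>2) - (d \<bullet> v i) * (a i + c i)
            + a i * (exp (a i) - 1 - a i) - (exp (a i) - 1) * (\<nu> \<bullet> v i)"
          by (simp add: \<mu>a ba inner_add_left algebra_simps power2_eq_square)
        have t2: "\<bar>(d \<bullet> v i) * (a i + c i)\<bar> \<le> D * \<rho>\<^sup>2 * q i * (2 * (\<rho> * q i))"
          using a(1)[OF i] b(1)[OF i] by (intro abs_mult_bound dv i) auto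
        have t3: "\<bar>a i * (exp (a i) - 1 - a i)\<bar> \<le> \<rho> ^ 3 * q i ^ 3"
        proof -
          have "\<bar>a i * (exp (a i) - 1 - a i)\<bar> \<le> \<bar>a i\<bar> * (a i)\<^sup>2"
            using exp_linear_approx[OF a(2)[OF i]] by (intro abs_mult_bound) auto
          also have "\<dots> = \<bar>a i\<bar> ^ 3" by (simp add: power3_eq_cube power2_eq_square abs_mult[symmetric])
          finally show ?thesis using a3[OF i] by linarith
        qed
        have t4: "\<bar>(exp (a i) - 1) * (\<nu> \<bullet> v i)\<bar> \<le> 2 * (\<rho> * q i) * (D * \<rho>\<^sup>2 * q i)"
          using exp_const_approx[OF a(2)[OF i]] a(1)[OF i] by (intro abs_mult_bound \<nu>v i) auto
        have "\<bar>?s i\<bar> \<le> 2 * (\<rho> ^ 3 * q i ^ 3) + D * \<rho>\<^sup>2 * q i * (2 * (\<rho> * q i)) + \<rho> ^ 3 * q i ^ 3 + 2 * (\<rho> * q i) * (D * \<rho>\<^sup>2 * q i)"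
          unfolding eq using recip_approx(3)[OF b(2)[OF i]] b3[OF i] t2 t3 t4 by linarith
        also have "\<dots> = \<rho> ^ 3 * (3 * q i ^ 3 + 4 * D * (q i)\<^sup>2)" by (simp add: algebra_simps power2_eq_square power3_eq_cube)
        finally have "norm (?s i *\<^sub>R v i) \<le> \<rho> ^ 3 * (3 * q i ^ 3 + 4 * D * (q i)\<^sup>2) * q i"
          using v[OF i] by (intro norm_scaleR_bound)
        also have "\<dots> = \<rho> ^ 3 * (3 * q i ^ 4 + 4 * D * q i ^ 3)"
          by (simp add: algebra_simps power2_eq_square power3_eq_cube power4_eq_xxxx)
        also have "\<dots> \<le> \<rho> ^ 3 * (3 * e i + 4 * D * e i)"
          using \<rho> D0 monomials[OF i] by (intro mult_left_mono add_mono) auto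
        finally show "norm (?s i *\<^sub>R v i) \<le> (3 + 4 * D) * \<rho> ^ 3 * e i" by (simp add: algebra_simps)
      qed (use \<rho> D0 in auto)
    qed auto
    then show ?thesis using \<kappa> by (simp add: field_simps)
  qed
  have F: "1/2 \<le> F" "\<bar>1 / F - 1\<bar> \<le> 6 * K * \<rho>\<^sup>2"
  proof -
    show F: "1/2 \<le> F" unfolding F_def
      using avg_mono[of n "\<lambda>i. 1/2" "\<lambda>i. exp (a i)"] exp_half_bounds a(2) n by (simp add: avg_const)
    \<comment> \<open>This is the multiplier equation paired with \<open>l\<close>; it identifies 1
      - F with the average of the expression bounded in \<open>sub_exp\<close>.\<close>
    have ae: "avg n (\<lambda>i. a i * exp (a i)) = 0"
      using arg_cong[OF l(2), of "\<lambda>z. l \<bullet> z"] by (simp add: avg_inner_right a_def mult.commute)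
    have "avg n (\<lambda>i. 1 + a i * exp (a i) - exp (a i)) = 1 - F"
      using n by (simp add: avg_add avg_diff avg_const ae F_def)
    moreover have "norm (avg n (\<lambda>i. 1 + a i * exp (a i) - exp (a i))) \<le> (3 * \<rho>\<^sup>2) * K"
    proof (rule norm_avg_e)
      fix i assume i: "i < n"
      show "norm (1 + a i * exp (a i) - exp (a i)) \<le> 3 * \<rho>\<^sup>2 * e i"
        using sub_exp[OF i] mult_left_mono[OF monomials(2)[OF i], of "3 * \<rho>\<^sup>2"] by simp
    qed auto
    ultimately have F1: "\<bar>1 - F\<bar> \<le> 3 * \<rho>\<^sup>2 * K" by simp
    have "\<bar>1 / F - 1\<bar> = \<bar>1 - F\<bar> * (1 / F)" using F by (simp add: abs_if field_simps)
    also have "\<dots> \<le> (3 * \<rho>\<^sup>2 * K) * 2" using F F1 by (intro mult_mono) (auto simp: field_simps)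
    finally show "\<bar>1 / F - 1\<bar> \<le> 6 * K * \<rho>\<^sup>2" by (simp add: mult_ac)
  qed
  define E where "E = (3 + 4 * D) * K / \<kappa>"
  have E0: "0 \<le> E" using D0 K0 \<kappa> by (simp add: E_def)
  \<comment> \<open>The ETEL condition \<open>B\<close>, which is zero, is subtracted from the EL
    score. \<open>T i\<close> is the resulting coefficient of \<open>l \<bullet> w i\<close>; its
    first-order parts c and -a cancel up to d . v_i, so it has order \<rho>^2. The other terms
    contain d + \<nu>, or d or \<nu> times a first-order factor, so all are cubic.\<close>
  define T where "T i = (1 / (1 - c i) - 1 - c i) + d \<bullet> v i - a i * (exp (a i) - 1) + exp (a i) * (1 / F - 1) + exp (a i) * (\<nu> \<bullet> v i)" for i
  let ?s = "\<lambda>i. (l \<bullet> w i) * T i + (d + \<nu>) \<bullet> w i + (d \<bullet> w i) * (1 / (1 - c i) - 1) + (\<nu> \<bullet> w i) * (exp (a i) - 1)"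
  have "avg n (\<lambda>i. (m \<bullet> w i) / (1 - m \<bullet> v i)) = avg n (\<lambda>i. (m \<bullet> w i) / (1 - c i))
      - (avg n (\<lambda>i. l \<bullet> w i) - avg n (\<lambda>i. exp (a i) * (l \<bullet> w i) * (1 / F))
            - avg n (\<lambda>i. exp (a i) * ((l \<bullet> w i) * (\<mu> \<bullet> v i) + \<mu> \<bullet> w i)))"
    using B by (simp only: avg_mult_right) (simp add: a_def c_def F_def avg_inner_right)
  also have "\<dots> = avg n (\<lambda>i. (m \<bullet> w i) / (1 - c i) - (l \<bullet> w i - exp (a i) * (l \<bullet> w i) * (1 / F)
            - exp (a i) * ((l \<bullet> w i) * (\<mu> \<bullet> v i) + \<mu> \<bullet> w i)))" by (simp only: avg_diff)
  also have "\<dots> = avg n ?s"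
  proof (rule avg_cong)
    fix i assume i: "i < n"
    have m': "m = l + d" and \<mu>': "\<mu> = \<nu> - l" by (auto simp: d_def \<nu>_def)
    have "(m \<bullet> w i) / (1 - c i) = (l \<bullet> w i + d \<bullet> w i) * (1 / (1 - c i))" by (simp add: m' inner_add_left)
    moreover have "exp (a i) * ((l \<bullet> w i) * (\<mu> \<bullet> v i) + \<mu> \<bullet> w i) = exp (a i) * ((l \<bullet> w i) * (\<nu> \<bullet> v i - a i) + (\<nu> \<bullet> w i - l \<bullet> w i))"
      unfolding \<mu>a by (simp add: \<mu>' inner_diff_left)
    ultimately show "(m \<bullet> w i) / (1 - c i) - (l \<bullet> w i - exp (a i) * (l \<bullet> w i) * (1 / F)
            - exp (a i) * ((l \<bullet> w i) * (\<mu> \<bullet> v i) + \<mu> \<bullet> w i)) = ?s i"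
      unfolding T_def by (simp only: inner_add_left ba) (simp only: algebra_simps)
  qed
  finally have eq: "avg n (\<lambda>i. (m \<bullet> w i) / (1 - m \<bullet> v i)) = avg n ?s" .
  have "norm (avg n ?s) \<le> ((4 + 7 * D + 12 * K + E) * (\<rho> ^ 3 * H)) * K"
  proof (rule norm_avg_e)
    fix i assume i: "i < n"
    have "\<bar>T i\<bar> \<le> 2 * (\<rho>\<^sup>2 * (q i)\<^sup>2) + D * \<rho>\<^sup>2 * q i + \<rho> * q i * (2 * (\<rho> * q i)) + 2 * (6 * K * \<rho>\<^sup>2) + 2 * (D * \<rho>\<^sup>2 * q i)"
    proof -
      have "\<bar>a i * (exp (a i) - 1)\<bar> \<le> \<rho> * q i * (2 * (\<rho> * q i))"
        using a(1)[OF i] exp_const_approx[OF a(2)[OF i]] by (intro abs_mult_bound) auto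
      moreover have "\<bar>exp (a i) * (1 / F - 1)\<bar> \<le> 2 * (6 * K * \<rho>\<^sup>2)"
        using exp_half_bounds(2)[OF a(2)[OF i]] by (intro abs_mult_bound F) auto
      moreover have "\<bar>exp (a i) * (\<nu> \<bullet> v i)\<bar> \<le> 2 * (D * \<rho>\<^sup>2 * q i)"
        using exp_half_bounds(2)[OF a(2)[OF i]] by (intro abs_mult_bound \<nu>v i) auto
      ultimately show ?thesis unfolding T_def
        using recip_approx(2)[OF b(2)[OF i]] b2[OF i] dv[OF i] by linarith
    qed
    also have "\<dots> = \<rho>\<^sup>2 * (4 * (q i)\<^sup>2 + 3 * D * q i + 12 * K)" by (simp add: algebra_simps power2_eq_square)
    finally have "\<bar>(l \<bullet> w i) * T i\<bar> \<le> (\<rho> * (p i * H)) * (\<rho>\<^sup>2 * (4 * (q i)\<^sup>2 + 3 * D * q i + 12 * K))"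
      by (intro abs_mult_bound abs_inner_bound l w i)
    also have "\<dots> = (\<rho> ^ 3 * H) * (4 * (p i * (q i)\<^sup>2) + 3 * D * (p i * q i) + 12 * K * p i)"
      by (simp add: algebra_simps power2_eq_square power3_eq_cube)
    also have "\<dots> \<le> (\<rho> ^ 3 * H) * (4 * e i + 3 * D * e i + 12 * K * e i)"
      using \<rho> H D0 K0 monomials[OF i] by (intro mult_left_mono add_mono) auto
    finally have s1: "\<bar>(l \<bullet> w i) * T i\<bar> \<le> (\<rho> ^ 3 * H) * ((4 + 3 * D + 12 * K) * e i)" by (simp add: algebra_simps)
    have "\<bar>(d + \<nu>) \<bullet> w i\<bar> \<le> (E * \<rho> ^ 3) * (p i * H)"
      unfolding E_def by (intro abs_inner_bound d\<nu> w i)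
    also have "\<dots> = (\<rho> ^ 3 * H) * (E * p i)" by simp
    also have "\<dots> \<le> (\<rho> ^ 3 * H) * (E * e i)" using \<rho> H E0 monomials[OF i] by (intro mult_left_mono) auto
    finally have s2: "\<bar>(d + \<nu>) \<bullet> w i\<bar> \<le> (\<rho> ^ 3 * H) * (E * e i)" .
    have step: "(D * \<rho>\<^sup>2 * (p i * H)) * (2 * (\<rho> * q i)) \<le> (\<rho> ^ 3 * H) * (2 * D * e i)"
    proof -
      have "(D * \<rho>\<^sup>2 * (p i * H)) * (2 * (\<rho> * q i)) = (\<rho> ^ 3 * H) * (2 * D * (p i * q i))"
        by (simp add: power2_eq_square power3_eq_cube)
      also have "\<dots> \<le> (\<rho> ^ 3 * H) * (2 * D * e i)" using \<rho> H D0 monomials[OF i] by (intro mult_left_mono) auto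
      finally show ?thesis .
    qed
    have s3: "\<bar>(d \<bullet> w i) * (1 / (1 - c i) - 1)\<bar> \<le> (D * \<rho>\<^sup>2 * (p i * H)) * (2 * (\<rho> * q i))"
      using recip_approx(1)[OF b(2)[OF i]] b(1)[OF i] by (intro abs_mult_bound abs_inner_bound d w i) auto
    have s4: "\<bar>(\<nu> \<bullet> w i) * (exp (a i) - 1)\<bar> \<le> (D * \<rho>\<^sup>2 * (p i * H)) * (2 * (\<rho> * q i))"
      using exp_const_approx[OF a(2)[OF i]] a(1)[OF i] by (intro abs_mult_bound abs_inner_bound \<nu> w i) auto
    have "\<bar>?s i\<bar> \<le> (\<rho> ^ 3 * H) * ((4 + 3 * D + 12 * K) * e i) + (\<rho> ^ 3 * H) * (E * e i)
       + (\<rho> ^ 3 * H) * (2 * D * e i) + (\<rho> ^ 3 * H) * (2 * D * e i)"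
      using s1 s2 s3 s4 step by linarith
    then show "norm (?s i) \<le> (4 + 7 * D + 12 * K + E) * (\<rho> ^ 3 * H) * e i" by (simp add: algebra_simps)
  qed (use D0 K0 E0 \<rho> H in auto)
  then show ?thesis unfolding eq E_def by (simp add: mult_ac)
qed

text \<open>Strong concavity of the EL profile objective, in the form of a monotone gradient.
  Subtracting the two multiplier equations expresses the increment of g through the change
  \<open>d\<close> of the multiplier; pairing with \<open>d\<close> shows that the score decreases
  by a positive Gram form in \<open>d\<close>. The rank condition makes |d| at least of order
  \<open>H\<close>, hence the form at least c_0 H^2, while the errors are of order (\<rho> + H) H^2.
  The constant is c_0 = (1/8) \<kappa> (\<gamma>/(8K))^2.\<close>

lemma score_strong_mono:
  fixes v v' w w' :: "nat \<Rightarrow> 'v::real_inner"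
  assumes \<kappa>: "0 < \<kappa>" and curv: "\<And>u. \<kappa> * (norm u)\<^sup>2 \<le> avg n (\<lambda>i. (u \<bullet> v' i)\<^sup>2)"
    and \<rho>: "0 \<le> \<rho>" "\<rho> \<le> 1" "\<And>i. i < n \<Longrightarrow> \<rho> * q i \<le> 1/2" and H: "0 \<le> H"
    and v: "\<And>i. i < n \<Longrightarrow> norm (v i) \<le> q i" "\<And>i. i < n \<Longrightarrow> norm (v' i) \<le> q i"
    and w: "\<And>i. i < n \<Longrightarrow> norm (w i) \<le> p i * H" "\<And>i. i < n \<Longrightarrow> norm (w' i) \<le> p i * H"
    and vv: "\<And>i. i < n \<Longrightarrow> norm (v i - v' i) \<le> p i * H"
    and vw: "\<And>i. i < n \<Longrightarrow> norm (w i - (v i - v' i)) \<le> b i * H\<^sup>2"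
    and ww: "\<And>i. i < n \<Longrightarrow> norm (w i - w' i) \<le> b i * H\<^sup>2"
    and l: "norm l \<le> \<rho>" "avg n (\<lambda>i. (1 / (1 - l \<bullet> v i)) *\<^sub>R v i) = 0"
    and l': "norm l' \<le> \<rho>" "avg n (\<lambda>i. (1 / (1 - l' \<bullet> v' i)) *\<^sub>R v' i) = 0"
    and \<gamma>: "0 < \<gamma>" "\<gamma> * H \<le> norm (avg n (\<lambda>i. v i - v' i))"
    and D: "D = 48 * K / \<kappa>" and c0: "c\<^sub>0 = \<kappa> * \<gamma>\<^sup>2 / (512 * K\<^sup>2)"
    and small1: "12 * K * \<rho> \<le> \<gamma>" and small2: "(6 + 8 * D) * K * \<rho> + 2 * D * K * H \<le> c\<^sub>0 / 2"
  shows "c\<^sub>0 / 2 * H\<^sup>2 \<le> avg n (\<lambda>i. (l' \<bullet> w' i) / (1 - l' \<bullet> v' i)) - avg n (\<lambda>i. (l \<bullet> w i) / (1 - l \<bullet> v i))"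
proof -
  define d z where "d = l - l'" and "z i = v i - v' i" for i
  define f where "f i = 1 / (1 - l \<bullet> v i)" for i
  define f' where "f' i = 1 / (1 - l' \<bullet> v' i)" for i
  have K1: "1 \<le> K" by (rule K_ge_1)
  have D0: "0 \<le> D" using K1 \<kappa> D by simp
  have a: "\<bar>l \<bullet> v i\<bar> \<le> \<rho> * q i" "\<bar>l \<bullet> v i\<bar> \<le> 1/2" if "i < n" for i
    using abs_inner_bound[OF l(1) v(1)[OF that]] \<rho>(3)[OF that] by auto
  have a': "\<bar>l' \<bullet> v' i\<bar> \<le> 1/2" if "i < n" for i
    using abs_inner_bound[OF l'(1) v(2)[OF that]] \<rho>(3)[OF that] by auto
  have f: "4/9 \<le> f i" "f i \<le> 2" "\<bar>f i\<bar> \<le> 2" "\<bar>f i - 1\<bar> \<le> 2 * (\<rho> * q i)" if "i < n" for i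
    using recip_half_bounds[OF a(2)[OF that]] recip_approx(1)[OF a(2)[OF that]] a(1)[OF that]
    unfolding f_def by linarith+
  have f': "4/9 \<le> f' i" "f' i \<le> 2" "\<bar>f' i\<bar> \<le> 2" if "i < n" for i
    using recip_half_bounds[OF a'[OF that]] unfolding f'_def by linarith+
  have ff: "1/8 \<le> f i * f' i" "\<bar>f i * f' i\<bar> \<le> 4" if "i < n" for i
    using mult_mono[OF f(1)[OF that] f'(1)[OF that]] abs_mult_bound[OF f(3)[OF that] f'(3)[OF that]] f(1)[OF that] by auto
  have fdiff: "f i - f' i = f i * f' i * (d \<bullet> v' i + l \<bullet> z i)" if "i < n" for i
  proof -
    have "l \<bullet> v i \<noteq> 1" "l' \<bullet> v' i \<noteq> 1" using a(2)[OF that] a'[OF that] by auto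
    from recip_diff[OF this] show ?thesis
      by (simp add: f_def f'_def d_def z_def inner_diff_left inner_diff_right)
  qed
  have lz: "\<bar>l \<bullet> z i\<bar> \<le> \<rho> * (p i * H)" if "i < n" for i
    unfolding z_def by (intro abs_inner_bound l vv that)
  have r1: "norm (avg n (\<lambda>i. (f i * f' i * (l \<bullet> z i)) *\<^sub>R v' i)) \<le> 4 * \<rho> * H * K"
  proof (rule norm_avg_e)
    fix i assume i: "i < n"
    have "norm ((f i * f' i * (l \<bullet> z i)) *\<^sub>R v' i) \<le> 4 * (\<rho> * (p i * H)) * q i"
      by (intro norm_scaleR_bound abs_mult_bound ff lz v i)
    also have "\<dots> = 4 * \<rho> * H * (p i * q i)" by simp
    also have "\<dots> \<le> 4 * \<rho> * H * e i" using \<rho> H monomials[OF i] by (intro mult_left_mono) auto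
    finally show "norm ((f i * f' i * (l \<bullet> z i)) *\<^sub>R v' i) \<le> 4 * \<rho> * H * e i" .
  qed (use \<rho> H in auto)
  \<comment> \<open>The difference of the two multiplier equations, sorted into the increment
    \<open>z\<close> of g and the change of the weights; the latter contains a weighted Gram matrix
    applied to \<open>d\<close>.\<close>
  have "0 = avg n (\<lambda>i. f i *\<^sub>R v i - f' i *\<^sub>R v' i)" using l(2) l'(2) by (simp add: avg_diff f_def f'_def)
  also have "\<dots> = avg n (\<lambda>i. f i *\<^sub>R z i + (f i * f' i * (d \<bullet> v' i)) *\<^sub>R v' i + (f i * f' i * (l \<bullet> z i)) *\<^sub>R v' i)"
  proof (rule avg_cong)
    fix i assume i: "i < n"
    have "f i *\<^sub>R v i - f' i *\<^sub>R v' i = f i *\<^sub>R z i + (f i - f' i) *\<^sub>R v' i" by (simp add: z_def algebra_simps)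
    then show "f i *\<^sub>R v i - f' i *\<^sub>R v' i = f i *\<^sub>R z i + (f i * f' i * (d \<bullet> v' i)) *\<^sub>R v' i + (f i * f' i * (l \<bullet> z i)) *\<^sub>R v' i"
      unfolding fdiff[OF i] by (simp add: algebra_simps)
  qed
  finally have Q: "avg n (\<lambda>i. (f i * f' i * (d \<bullet> v' i)) *\<^sub>R v' i)
      = - (avg n (\<lambda>i. f i *\<^sub>R z i) + avg n (\<lambda>i. (f i * f' i * (l \<bullet> z i)) *\<^sub>R v' i))"
    unfolding avg_add by (simp only: eq_neg_iff_add_eq_0 add_ac)
  have d: "norm d \<le> D * H"
  proof -
    have "norm (avg n (\<lambda>i. f i *\<^sub>R z i)) \<le> 2 * H * K"
    proof (rule norm_avg_e)
      fix i assume i: "i < n"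
      have "norm (f i *\<^sub>R z i) \<le> 2 * (p i * H)" unfolding z_def by (intro norm_scaleR_bound f vv i)
      also have "\<dots> \<le> 2 * H * e i" using mult_left_mono[OF monomials(5)[OF i] H] by (simp add: mult_ac)
      finally show "norm (f i *\<^sub>R z i) \<le> 2 * H * e i" .
    qed (use H in auto)
    then have "norm (- (avg n (\<lambda>i. f i *\<^sub>R z i) + avg n (\<lambda>i. (f i * f' i * (l \<bullet> z i)) *\<^sub>R v' i))) \<le> 2 * H * K + 4 * \<rho> * H * K"
      unfolding norm_minus_cancel by (intro norm_triangle_le add_mono r1)
    also have "\<dots> \<le> 6 * H * K" using mult_right_mono[OF \<rho>(2), of "4 * H * K"] H K1 by simp
    \<comment> \<open>The weights \<open>f i * f' i\<close> are at least 1/8, so 6 becomes the 48 in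
      \<open>D\<close>.\<close>
    finally have "1/8 * \<kappa> * norm d \<le> 6 * H * K" using ff
      by (intro weighted_gram_bound[OF curv _ _ Q]) auto
    then show ?thesis unfolding D using \<kappa> by (simp add: field_simps)
  qed
  \<comment> \<open>The same equation read the other way: a small \<open>d\<close> would force a
    small mean increment, against the rank bound \<open>\<gamma>(2)\<close>. The error terms take 6
    K \<rho> H, at most half of \<gamma> H by \<open>small1\<close>.\<close>
  have dlow: "\<gamma> * H / (8 * K) \<le> norm d"
  proof -
    have 1: "norm (avg n (\<lambda>i. (f i - 1) *\<^sub>R z i)) \<le> 2 * \<rho> * H * K"
    proof (rule norm_avg_e)
      fix i assume i: "i < n"
      have "norm ((f i - 1) *\<^sub>R z i) \<le> 2 * (\<rho> * q i) * (p i * H)" unfolding z_def by (intro norm_scaleR_bound f vv i)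
      also have "\<dots> = 2 * \<rho> * H * (p i * q i)" by simp
      also have "\<dots> \<le> 2 * \<rho> * H * e i" using \<rho> H monomials[OF i] by (intro mult_left_mono) auto
      finally show "norm ((f i - 1) *\<^sub>R z i) \<le> 2 * \<rho> * H * e i" .
    qed (use H \<rho> in auto)
    have 2: "norm (avg n (\<lambda>i. (f i * f' i * (d \<bullet> v' i)) *\<^sub>R v' i)) \<le> 4 * norm d * K"
    proof (rule norm_avg_e)
      fix i assume i: "i < n"
      have "norm ((f i * f' i * (d \<bullet> v' i)) *\<^sub>R v' i) \<le> 4 * (norm d * q i) * q i"
        by (intro norm_scaleR_bound abs_mult_bound abs_inner_bound ff v i) auto
      also have "\<dots> = 4 * norm d * (q i)\<^sup>2" by (simp add: power2_eq_square)
      also have "\<dots> \<le> 4 * norm d * e i" using monomials[OF i] by (intro mult_left_mono) auto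
      finally show "norm ((f i * f' i * (d \<bullet> v' i)) *\<^sub>R v' i) \<le> 4 * norm d * e i" .
    qed auto
    have "avg n z = - avg n (\<lambda>i. (f i * f' i * (d \<bullet> v' i)) *\<^sub>R v' i) - avg n (\<lambda>i. (f i - 1) *\<^sub>R z i)
        - avg n (\<lambda>i. (f i * f' i * (l \<bullet> z i)) *\<^sub>R v' i)"
      unfolding Q by (simp add: scaleR_diff_left avg_diff)
    then have "norm (avg n z) \<le> 4 * norm d * K + 2 * \<rho> * H * K + 4 * \<rho> * H * K"
      by (simp only:) (intro order_trans[OF norm_triangle_ineq4] add_mono 1 r1, use 2 in simp)
    moreover have "\<gamma> * H \<le> norm (avg n z)" using \<gamma>(2) by (simp add: z_def[abs_def])
    moreover have "(12 * K * \<rho>) * H \<le> \<gamma> * H" using small1 H by (rule mult_right_mono)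
    ultimately have "\<gamma> * H \<le> 8 * K * norm d" by (simp add: algebra_simps)
    then show ?thesis using K1 by (simp add: field_simps)
  qed
  have low: "c\<^sub>0 * H\<^sup>2 \<le> avg n (\<lambda>i. f i * f' i * (d \<bullet> v' i)\<^sup>2)"
  proof -
    have "c\<^sub>0 * H\<^sup>2 = 1/8 * (\<kappa> * (\<gamma> * H / (8 * K))\<^sup>2)" using K1 unfolding c0 by (simp add: power2_eq_square field_simps)
    also have "\<dots> \<le> 1/8 * (\<kappa> * (norm d)\<^sup>2)"
      using \<kappa> \<gamma> H K1 by (intro mult_left_mono power_mono dlow) auto
    also have "\<dots> \<le> avg n (\<lambda>i. 1/8 * (d \<bullet> v' i)\<^sup>2)" unfolding avg_mult_left using curv by (intro mult_left_mono) auto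
    also have "\<dots> \<le> avg n (\<lambda>i. f i * f' i * (d \<bullet> v' i)\<^sup>2)" using ff by (intro avg_mono mult_right_mono) auto
    finally show ?thesis .
  qed
  \<comment> \<open>Pairing \<open>Q\<close> with \<open>d\<close> trades the term linear in
    \<open>z\<close>, which has no sign, for minus the positive form bounded in
    \<open>low\<close>.\<close>
  have dfz: "avg n (\<lambda>i. f i * (d \<bullet> z i)) = - avg n (\<lambda>i. f i * f' i * (d \<bullet> v' i)\<^sup>2) - avg n (\<lambda>i. f i * f' i * (l \<bullet> z i) * (d \<bullet> v' i))"
  proof -
    have "d \<bullet> avg n (\<lambda>i. f i *\<^sub>R z i) = - (d \<bullet> avg n (\<lambda>i. (f i * f' i * (d \<bullet> v' i)) *\<^sub>R v' i)) - d \<bullet> avg n (\<lambda>i. (f i * f' i * (l \<bullet> z i)) *\<^sub>R v' i)"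
      unfolding Q by (simp add: inner_add_right inner_diff_right)
    then show ?thesis by (simp add: avg_inner_right power2_eq_square mult.assoc)
  qed
  \<comment> \<open>Four kinds of error: linearising g, replacing \<open>v\<close> by
    \<open>v'\<close> in the multiplier equation, replacing \<open>w\<close> by \<open>w'\<close>,
    and the change of the EL weights.\<close>
  let ?s = "\<lambda>i. f i * (d \<bullet> (w i - z i)) - f i * f' i * (l \<bullet> z i) * (d \<bullet> v' i) + f i * (l' \<bullet> (w i - w' i)) + (f i - f' i) * (l' \<bullet> w' i)"
  have eq: "avg n (\<lambda>i. (l \<bullet> w i) / (1 - l \<bullet> v i)) - avg n (\<lambda>i. (l' \<bullet> w' i) / (1 - l' \<bullet> v' i)) = - avg n (\<lambda>i. f i * f' i * (d \<bullet> v' i)\<^sup>2) + avg n ?s"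
  proof -
    have "avg n (\<lambda>i. (l \<bullet> w i) / (1 - l \<bullet> v i)) - avg n (\<lambda>i. (l' \<bullet> w' i) / (1 - l' \<bullet> v' i)) = avg n (\<lambda>i. f i * (l \<bullet> w i) - f' i * (l' \<bullet> w' i))"
      by (simp add: avg_diff f_def f'_def)
    also have "\<dots> = avg n (\<lambda>i. f i * (d \<bullet> z i) + f i * f' i * (l \<bullet> z i) * (d \<bullet> v' i) + ?s i)"
      by (rule avg_cong) (simp add: d_def inner_diff_left inner_diff_right algebra_simps)
    also have "\<dots> = - avg n (\<lambda>i. f i * f' i * (d \<bullet> v' i)\<^sup>2) + avg n ?s"
      unfolding avg_add[of n _ ?s] avg_add[of n "\<lambda>i. f i * (d \<bullet> z i)"] dfz by simp
    finally show ?thesis .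
  qed
  have "norm (avg n ?s) \<le> ((2 * D * H + (6 + 8 * D) * \<rho>) * H\<^sup>2) * K"
  proof (rule norm_avg_e)
    fix i assume i: "i < n"
    have dv: "\<bar>d \<bullet> v' i\<bar> \<le> D * H * q i" by (intro abs_inner_bound d v i)
    have "\<bar>f i * (d \<bullet> (w i - z i))\<bar> \<le> 2 * (D * H * (b i * H\<^sup>2))"
      unfolding z_def by (intro abs_mult_bound abs_inner_bound f d vw i)
    also have "\<dots> = 2 * D * H * H\<^sup>2 * b i" by simp
    also have "\<dots> \<le> 2 * D * H * H\<^sup>2 * e i" using D0 H monomials[OF i] by (intro mult_left_mono) auto
    finally have s1: "\<bar>f i * (d \<bullet> (w i - z i))\<bar> \<le> 2 * D * H * H\<^sup>2 * e i" .
    have "\<bar>f i * f' i * (l \<bullet> z i) * (d \<bullet> v' i)\<bar> \<le> 4 * (\<rho> * (p i * H)) * (D * H * q i)"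
      by (intro abs_mult_bound ff lz dv i)
    also have "\<dots> = 4 * D * \<rho> * H\<^sup>2 * (p i * q i)" by (simp add: power2_eq_square)
    also have "\<dots> \<le> 4 * D * \<rho> * H\<^sup>2 * e i" using D0 H \<rho> monomials[OF i] by (intro mult_left_mono) auto
    finally have s2: "\<bar>f i * f' i * (l \<bullet> z i) * (d \<bullet> v' i)\<bar> \<le> 4 * D * \<rho> * H\<^sup>2 * e i" .
    have "\<bar>f i * (l' \<bullet> (w i - w' i))\<bar> \<le> 2 * (\<rho> * (b i * H\<^sup>2))"
      by (intro abs_mult_bound abs_inner_bound f l' ww i)
    also have "\<dots> = 2 * \<rho> * H\<^sup>2 * b i" by simp
    also have "\<dots> \<le> 2 * \<rho> * H\<^sup>2 * e i" using \<rho> H monomials[OF i] by (intro mult_left_mono) auto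
    finally have s3: "\<bar>f i * (l' \<bullet> (w i - w' i))\<bar> \<le> 2 * \<rho> * H\<^sup>2 * e i" .
    have "\<bar>(f i - f' i) * (l' \<bullet> w' i)\<bar> \<le> (4 * (D * H * q i + \<rho> * (p i * H))) * (\<rho> * (p i * H))"
      unfolding fdiff[OF i]
      by (intro abs_mult_bound abs_inner_bound ff l' w i order_trans[OF abs_triangle_ineq] add_mono dv lz)
    also have "\<dots> = 4 * D * \<rho> * H\<^sup>2 * (p i * q i) + 4 * \<rho> * H\<^sup>2 * (p i)\<^sup>2 * \<rho>" by (simp add: power2_eq_square algebra_simps)
    also have "\<dots> \<le> 4 * D * \<rho> * H\<^sup>2 * e i + 4 * \<rho> * H\<^sup>2 * e i * 1"
      using D0 H \<rho> monomials[OF i] e_ge_1[OF i] by (intro mult_mono mult_left_mono add_mono) auto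
    finally have s4: "\<bar>(f i - f' i) * (l' \<bullet> w' i)\<bar> \<le> 4 * D * \<rho> * H\<^sup>2 * e i + 4 * \<rho> * H\<^sup>2 * e i" by simp
    have "norm (?s i) \<le> 2 * D * H * H\<^sup>2 * e i + 4 * D * \<rho> * H\<^sup>2 * e i + 2 * \<rho> * H\<^sup>2 * e i + (4 * D * \<rho> * H\<^sup>2 * e i + 4 * \<rho> * H\<^sup>2 * e i)"
      using s1 s2 s3 s4 unfolding real_norm_def by linarith
    then show "norm (?s i) \<le> (2 * D * H + (6 + 8 * D) * \<rho>) * H\<^sup>2 * e i" by (simp add: algebra_simps)
  qed (use D0 \<rho> H in auto)
  moreover have "((2 * D * H + (6 + 8 * D) * \<rho>) * H\<^sup>2) * K = ((6 + 8 * D) * K * \<rho> + 2 * D * K * H) * H\<^sup>2" by (simp add: algebra_simps)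
  moreover have "\<dots> \<le> c\<^sub>0 / 2 * H\<^sup>2" using small2 by (intro mult_right_mono) auto
  ultimately have "avg n ?s \<le> c\<^sub>0 / 2 * H\<^sup>2" by simp
  then show ?thesis using eq low by simp
qed

end

section \<open>First-order conditions\<close>

lemma has_derivative_at_calm:
  fixes f :: "'p::real_normed_vector \<Rightarrow> 'v::real_normed_vector"
  assumes "(f has_derivative f') (at t)"
  obtains C r where "0 \<le> C" "0 < r" "\<And>\<theta>. norm (\<theta> - t) < r \<Longrightarrow> norm (f \<theta> - f t) \<le> C * norm (\<theta> - t)"
proof -
  from assms have bl: "bounded_linear f'" and
    e: "\<And>e. e > 0 \<Longrightarrow> \<exists>d>0. \<forall>y. norm (y - t) < d \<longrightarrow> norm (f y - f t - f' (y - t)) \<le> e * norm (y - t)"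
    unfolding has_derivative_at_alt by auto
  obtain B where B: "0 < B" "\<And>x. norm (f' x) \<le> norm x * B"
    using bounded_linear.pos_bounded[OF bl] by blast
  obtain d where d: "d > 0" "\<And>y. norm (y - t) < d \<Longrightarrow> norm (f y - f t - f' (y - t)) \<le> 1 * norm (y - t)"
    using e[of 1] by auto
  have "norm (f \<theta> - f t) \<le> (1 + B) * norm (\<theta> - t)" if "norm (\<theta> - t) < d" for \<theta>
  proof -
    have "norm (f \<theta> - f t) \<le> norm (f \<theta> - f t - f' (\<theta> - t)) + norm (f' (\<theta> - t))"
      using norm_triangle_ineq[of "f \<theta> - f t - f' (\<theta> - t)" "f' (\<theta> - t)"] by simp
    also have "\<dots> \<le> 1 * norm (\<theta> - t) + norm (\<theta> - t) * B" by (intro add_mono d(2) B(2) that)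
    finally show ?thesis by (simp add: algebra_simps)
  qed
  then show ?thesis using that[of "1 + B" d] d(1) B(1) by auto
qed

text \<open>Envelope theorem for a path \<open>l\<close> of multipliers that is only calm at \<open>t\<close>.\<close>

lemma profile_maximum_derivative_zero:
  fixes H :: "'l::euclidean_space \<times> 'p::euclidean_space \<Rightarrow> real"
  assumes H: "(H has_derivative D) (at (l t, t))" and D: "\<And>u. D (u, 0) = 0"
    and U: "open U" "t \<in> U"
    and calm: "\<And>\<theta>. \<theta> \<in> U \<Longrightarrow> norm (l \<theta> - l t) \<le> C * norm (\<theta> - t)"
    and max: "\<And>\<theta>. \<theta> \<in> U \<Longrightarrow> H (l \<theta>, \<theta>) \<le> H (l t, t)"
  shows "D (0, h) = 0"
proof -
  define C' where "C' = \<bar>C\<bar> + 1"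
  have C': "0 < C'" by (simp add: C'_def)
  from H have bl: "bounded_linear D" and
    e: "\<And>e. e > 0 \<Longrightarrow> \<exists>d>0. \<forall>y. norm (y - (l t, t)) < d \<longrightarrow> norm (H y - H (l t, t) - D (y - (l t, t))) \<le> e * norm (y - (l t, t))"
    unfolding has_derivative_at_alt by auto
  obtain r where r: "0 < r" "ball t r \<subseteq> U" using U openE by blast
  \<comment> \<open>Differentiability of \<open>l\<close> is not at hand, so the chain rule does not
    apply. Calmness bounds the joint displacement by \<open>C' * norm (y - t)\<close>, so the
    remainder of \<open>H\<close> is still of smaller order in y - t, and \<open>D\<close>
    annihilates the displacement of the multiplier.\<close>
  have "((\<lambda>\<theta>. H (l \<theta>, \<theta>)) has_derivative (\<lambda>h. D (0, h))) (at t)"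
    unfolding has_derivative_at_alt
  proof (intro conjI allI impI)
    show "bounded_linear (\<lambda>h. D (0, h))"
      using bounded_linear_compose[OF bl bounded_linear_Pair[OF bounded_linear_zero bounded_linear_ident]] by simp
    fix \<epsilon> :: real assume \<epsilon>: "0 < \<epsilon>"
    obtain d where d: "d > 0" "\<And>y. norm (y - (l t, t)) < d \<Longrightarrow> norm (H y - H (l t, t) - D (y - (l t, t))) \<le> \<epsilon> / C' * norm (y - (l t, t))"
      using e[of "\<epsilon> / C'"] \<epsilon> C' by auto
    show "\<exists>d>0. \<forall>y. norm (y - t) < d \<longrightarrow> norm (H (l y, y) - H (l t, t) - D (0, y - t)) \<le> \<epsilon> * norm (y - t)"
    proof (intro exI[of _ "min r (d / C')"] conjI allI impI)
      show "0 < min r (d / C')" using r d C' by simp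
      fix y assume y: "norm (y - t) < min r (d / C')"
      then have yU: "y \<in> U" using r by (auto simp: dist_norm norm_minus_commute)
      have "norm ((l y, y) - (l t, t)) \<le> norm (l y - l t) + norm (y - t)"
        using norm_Pair_le[of "l y - l t" "y - t"] by simp
      also have "\<dots> \<le> C * norm (y - t) + norm (y - t)" using calm[OF yU] by simp
      also have "\<dots> \<le> C' * norm (y - t)" using abs_ge_self[of C] mult_right_mono[of C "\<bar>C\<bar>" "norm (y - t)"]
        by (simp add: C'_def algebra_simps)
      finally have le: "norm ((l y, y) - (l t, t)) \<le> C' * norm (y - t)" .
      also have "\<dots> < d" using y C' by (simp add: field_simps)
      finally have "norm (H (l y, y) - H (l t, t) - D ((l y, y) - (l t, t))) \<le> \<epsilon> / C' * norm ((l y, y) - (l t, t))"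
        by (rule d(2))
      also have "\<dots> \<le> \<epsilon> / C' * (C' * norm (y - t))" using le \<epsilon> C' by (intro mult_left_mono) auto
      also have "D ((l y, y) - (l t, t)) = D (l y - l t, 0) + D (0, y - t)"
        using linear_add[OF bounded_linear.linear[OF bl], of "(l y - l t, 0)" "(0, y - t)"] by simp
      finally show "norm (H (l y, y) - H (l t, t) - D (0, y - t)) \<le> \<epsilon> * norm (y - t)"
        using D C' by simp
    qed
  qed
  from differential_zero_maxmin[OF U(2,1) this] max have "(\<lambda>h. D (0, h)) = (\<lambda>h. 0)" by blast
  then show ?thesis by (rule fun_cong)
qed

text \<open>Solves the adjoint equation for \<mu>: coercivity makes the weighted Gram map injective,
  hence surjective in finite dimension.\<close>

lemma positive_gram_surjective:
  fixes v :: "nat \<Rightarrow> 'v::euclidean_space"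
  assumes \<kappa>: "0 < \<kappa>" and curv: "\<And>u. \<kappa> * (norm u)\<^sup>2 \<le> avg n (\<lambda>i. (u \<bullet> v i)\<^sup>2)"
    and \<omega>: "\<And>i. i < n \<Longrightarrow> \<beta> \<le> \<omega> i" "0 < \<beta>"
  shows "\<exists>u. avg n (\<lambda>i. (\<omega> i * (u \<bullet> v i)) *\<^sub>R v i) = y"
proof -
  let ?f = "\<lambda>u. avg n (\<lambda>i. (\<omega> i * (u \<bullet> v i)) *\<^sub>R v i)"
  have lin: "linear ?f"
    by (rule linearI) (simp_all add: algebra_simps avg_add flip: avg_scaleR)
  have "u = 0" if "?f u = 0" for u
  proof -
    have "\<beta> * \<kappa> * norm u \<le> 0" using \<omega> by (intro weighted_gram_bound[OF curv _ _ that]) auto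
    then show ?thesis using \<kappa> \<omega>(2) by (simp add: mult_le_0_iff)
  qed
  then have "inj ?f" using linear_injective_0[OF lin] by blast
  then have "surj ?f" using linear_injective_imp_surjective[OF lin] by blast
  then obtain u where "y = ?f u" by (rule surjE)
  then show ?thesis by (intro exI[of _ u]) (rule sym)
qed

text \<open>The conditions on all of \<open>U\<close> are those of \<open>multiplier_exists\<close>,
  so that every parameter near \<open>t\<close> has a multiplier of norm below \<rho>;
  differentiation takes place at \<open>t\<close> alone.\<close>

locale stationary_point =
  fixes n :: nat and g :: "nat \<Rightarrow> 'p::euclidean_space \<Rightarrow> 'v::euclidean_space" and dg :: "nat \<Rightarrow> 'p \<Rightarrow> 'v"
    and t :: 'p and U :: "'p set" and \<kappa> \<rho> :: real
  assumes n: "0 < n" and \<kappa>: "0 < \<kappa>" and \<rho>: "0 < \<rho>" and U: "open U" "t \<in> U"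
    and der: "\<And>i. i < n \<Longrightarrow> (g i has_derivative dg i) (at t)"
    and curv: "\<And>u \<theta>. \<theta> \<in> U \<Longrightarrow> \<kappa> * (norm u)\<^sup>2 \<le> avg n (\<lambda>i. (u \<bullet> g i \<theta>)\<^sup>2)"
    and small: "\<And>i \<theta>. i < n \<Longrightarrow> \<theta> \<in> U \<Longrightarrow> \<rho> * norm (g i \<theta>) \<le> 1/2"
    and mean: "\<And>\<theta>. \<theta> \<in> U \<Longrightarrow> norm (avg n (\<lambda>i. g i \<theta>)) < \<kappa> * \<rho> / 8"
begin

text \<open>Multipliers are chosen point by point, with the value at \<open>t\<close> forced to be
  \<open>l0\<close>. Keeping \<open>l0\<close> fixed, the residual is differentiable at
  \<open>t\<close> and vanishes there, hence is O(|\<theta> - t|); \<open>multiplier_calm\<close>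
  transfers this to the multipliers. Calmness is what the envelope argument asks for, and it comes
  without an implicit function theorem.\<close>

lemma multiplier_path:
  assumes deriv: "\<And>x. \<bar>x\<bar> \<le> 1/2 \<Longrightarrow> (\<Phi> has_real_derivative \<phi> x) (at x)"
    and quad: "\<And>x. \<bar>x\<bar> \<le> 1/2 \<Longrightarrow> \<Phi> 0 + x + x\<^sup>2/8 \<le> \<Phi> x"
    and mono: "\<And>a b. \<bar>a\<bar> \<le> 1/2 \<Longrightarrow> \<bar>b\<bar> \<le> 1/2 \<Longrightarrow> (a - b)\<^sup>2 / 8 \<le> (\<phi> a - \<phi> b) * (a - b)"
    and deriv2: "\<And>x. \<bar>x\<bar> \<le> 1/2 \<Longrightarrow> (\<phi> has_real_derivative \<phi>' x) (at x)"
    and l0: "norm l0 < \<rho>" "avg n (\<lambda>i. \<phi> (l0 \<bullet> g i t) *\<^sub>R g i t) = 0"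
  obtains l C V where "open V" "t \<in> V" "V \<subseteq> U" "l t = l0"
    "\<And>\<theta>. \<theta> \<in> V \<Longrightarrow> norm (l \<theta>) < \<rho>" "\<And>\<theta>. \<theta> \<in> V \<Longrightarrow> avg n (\<lambda>i. \<phi> (l \<theta> \<bullet> g i \<theta>) *\<^sub>R g i \<theta>) = 0"
    "\<And>\<theta>. \<theta> \<in> V \<Longrightarrow> norm (l \<theta> - l t) \<le> C * norm (\<theta> - t)"
proof -
  have ex: "\<exists>l. norm l < \<rho> \<and> avg n (\<lambda>i. \<phi> (l \<bullet> g i \<theta>) *\<^sub>R g i \<theta>) = 0" if "\<theta> \<in> U" for \<theta>
    using multiplier_exists[OF n \<rho> curv[OF that] small[OF _ that] mean[OF that] deriv quad] by metis
  define l where "l \<theta> = (if \<theta> = t then l0 else (SOME l. norm l < \<rho> \<and> avg n (\<lambda>i. \<phi> (l \<bullet> g i \<theta>) *\<^sub>R g i \<theta>) = 0))" for \<theta>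
  have l: "norm (l \<theta>) < \<rho> \<and> avg n (\<lambda>i. \<phi> (l \<theta> \<bullet> g i \<theta>) *\<^sub>R g i \<theta>) = 0" if "\<theta> \<in> U" for \<theta>
    using someI_ex[OF ex[OF that]] l0 by (auto simp: l_def)
  define f where "f \<theta> = avg n (\<lambda>i. \<phi> (l0 \<bullet> g i \<theta>) *\<^sub>R g i \<theta>)" for \<theta>
  have "(f has_derivative (\<lambda>h. (1 / real n) *\<^sub>R (\<Sum>i<n. \<phi> (l0 \<bullet> g i t) *\<^sub>R dg i h + ((l0 \<bullet> dg i h) * \<phi>' (l0 \<bullet> g i t)) *\<^sub>R g i t))) (at t)"
    unfolding f_def avg_def
  proof (intro has_derivative_scaleR_right has_derivative_sum has_derivative_scaleR)
    fix i assume "i \<in> {..<n}"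
    then have i: "i < n" by simp
    show "(g i has_derivative dg i) (at t)" by (rule der[OF i])
    have "\<bar>l0 \<bullet> g i t\<bar> \<le> 1/2" using l0 by (intro inner_small[OF small[OF i U(2)]]) auto
    then show "((\<lambda>\<theta>. \<phi> (l0 \<bullet> g i \<theta>)) has_derivative (\<lambda>h. (l0 \<bullet> dg i h) * \<phi>' (l0 \<bullet> g i t))) (at t)"
      by (intro DERIV_compose_FDERIV deriv2 has_derivative_inner_right der i)
  qed
  then obtain C r where C: "0 \<le> C" "0 < r" "\<And>\<theta>. norm (\<theta> - t) < r \<Longrightarrow> norm (f \<theta> - f t) \<le> C * norm (\<theta> - t)"
    using has_derivative_at_calm by blast
  have ft: "f t = 0" using l0 by (simp add: f_def)
  show ?thesis
  proof
    show "open (U \<inter> ball t r)" "t \<in> U \<inter> ball t r" "U \<inter> ball t r \<subseteq> U" "l t = l0" using U C by (auto simp: l_def)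
    fix \<theta> assume \<theta>: "\<theta> \<in> U \<inter> ball t r"
    show "norm (l \<theta>) < \<rho>" "avg n (\<lambda>i. \<phi> (l \<theta> \<bullet> g i \<theta>) *\<^sub>R g i \<theta>) = 0" using l \<theta> by auto
    have "\<kappa> * norm (l \<theta> - l0) \<le> 8 * norm (f \<theta>)"
      unfolding f_def using l[of \<theta>] \<theta> l0 curv small
      by (intro multiplier_calm[where \<rho> = \<rho> and v = "\<lambda>i. g i \<theta>" and \<phi> = \<phi>] mono) auto
    also have "\<dots> \<le> 8 * (C * norm (\<theta> - t))" using C(3)[of \<theta>] \<theta> ft by (simp add: dist_norm norm_minus_commute)
    finally show "norm (l \<theta> - l t) \<le> (8 * C / \<kappa>) * norm (\<theta> - t)" using \<kappa> by (simp add: l_def field_simps)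
  qed
qed

lemma has_derivative_inner_pair:
  assumes "i < n"
  shows "((\<lambda>z. fst z \<bullet> g i (snd z)) has_derivative (\<lambda>z. l0 \<bullet> dg i (snd z) + fst z \<bullet> g i t)) (at (l0, t))"
proof -
  have "((\<lambda>z. g i (snd z)) has_derivative (\<lambda>z. dg i (snd z))) (at (l0, t))"
    by (rule has_derivative_compose[of snd snd, OF has_derivative_snd[OF has_derivative_ident]]) (simp add: der assms)
  from has_derivative_inner[OF has_derivative_fst[OF has_derivative_ident] this]
  show ?thesis by simp
qed

lemma dg_zero: "i < n \<Longrightarrow> dg i 0 = 0"
  by (rule linear_0[OF has_derivative_linear[OF der]])

text \<open>For EL the derivative of the dual objective in the multiplier is the multiplier equation
  itself, so the envelope argument applies directly, with no adjoint vector.\<close>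

lemma el_first_order:
  assumes l: "norm l0 < \<rho>" "avg n (\<lambda>i. (1 / (1 - l0 \<bullet> g i t)) *\<^sub>R g i t) = 0"
    and max: "\<And>\<theta> l. \<theta> \<in> U \<Longrightarrow> norm l < \<rho> \<Longrightarrow> avg n (\<lambda>i. (1 / (1 - l \<bullet> g i \<theta>)) *\<^sub>R g i \<theta>) = 0 \<Longrightarrow>
        - avg n (\<lambda>i. ln (1 - l \<bullet> g i \<theta>)) \<le> - avg n (\<lambda>i. ln (1 - l0 \<bullet> g i t))"
  shows "avg n (\<lambda>i. (l0 \<bullet> dg i h) / (1 - l0 \<bullet> g i t)) = 0"
proof -
  obtain l C V where V: "open V" "t \<in> V" "V \<subseteq> U" "l t = l0"
    "\<And>\<theta>. \<theta> \<in> V \<Longrightarrow> norm (l \<theta>) < \<rho>" "\<And>\<theta>. \<theta> \<in> V \<Longrightarrow> avg n (\<lambda>i. (1 / (1 - l \<theta> \<bullet> g i \<theta>)) *\<^sub>R g i \<theta>) = 0"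
    "\<And>\<theta>. \<theta> \<in> V \<Longrightarrow> norm (l \<theta> - l t) \<le> C * norm (\<theta> - t)"
    by (rule multiplier_path[OF DERIV_neg_ln neg_ln_ge_quadratic recip_strong_mono DERIV_recip l]) blast+
  define H where "H z = - avg n (\<lambda>i. ln (1 - fst z \<bullet> g i (snd z)))" for z
  define D where "D z = - ((1 / real n) *\<^sub>R (\<Sum>i<n. (0 - (l0 \<bullet> dg i (snd z) + fst z \<bullet> g i t)) * (1 / (1 - l0 \<bullet> g i t))))" for z
  have dH: "(H has_derivative D) (at (l t, t))"
    unfolding H_def D_def avg_def V(4)
  proof (intro has_derivative_minus has_derivative_scaleR_right has_derivative_sum)
    fix i assume "i \<in> {..<n}"
    then have i: "i < n" by simp
    have "((\<lambda>z. 1 - fst z \<bullet> g i (snd z)) has_derivative (\<lambda>z. 0 - (l0 \<bullet> dg i (snd z) + fst z \<bullet> g i t))) (at (l0, t))"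
      by (rule has_derivative_diff[OF has_derivative_const has_derivative_inner_pair[OF i]])
    moreover have "\<bar>l0 \<bullet> g i t\<bar> \<le> 1/2" using l by (intro inner_small[OF small[OF i U(2)]]) auto
    then have "(ln has_real_derivative 1 / (1 - l0 \<bullet> g i t)) (at (1 - fst (l0, t) \<bullet> g i (snd (l0, t))))"
      by (auto intro!: derivative_eq_intros)
    ultimately show "((\<lambda>z. ln (1 - fst z \<bullet> g i (snd z))) has_derivative
        (\<lambda>z. (0 - (l0 \<bullet> dg i (snd z) + fst z \<bullet> g i t)) * (1 / (1 - l0 \<bullet> g i t)))) (at (l0, t))"
      by (rule DERIV_compose_FDERIV[rotated])
  qed
  have D0: "D (u, 0) = 0" for u
  proof -
    have "D (u, 0) = u \<bullet> avg n (\<lambda>i. (1 / (1 - l0 \<bullet> g i t)) *\<^sub>R g i t)"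
      unfolding D_def avg_def by (simp add: dg_zero inner_sum_right sum_negf)
    then show ?thesis using l by simp
  qed
  have "H (l \<theta>, \<theta>) \<le> H (l t, t)" if "\<theta> \<in> V" for \<theta>
    unfolding H_def using max[of \<theta> "l \<theta>"] V(3,4) V(5)[OF that] V(6)[OF that] that by auto
  from profile_maximum_derivative_zero[of H D l t V C, OF dH D0 V(1,2,7) this]
  have "D (0, h) = 0" .
  then show ?thesis unfolding D_def avg_def by (simp add: sum_negf)
qed

text \<open>Subtracting \<open>\<mu> \<bullet> avg n (exp (l \<bullet> g) g)\<close> does not change the objective along the multiplier
  path, and the equation for \<open>\<mu>\<close> makes the new objective stationary in \<open>l\<close>.\<close>

lemma etel_first_order:
  assumes l: "norm l0 < \<rho>" "avg n (\<lambda>i. exp (l0 \<bullet> g i t) *\<^sub>R g i t) = 0"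
    and max: "\<And>\<theta> l. \<theta> \<in> U \<Longrightarrow> norm l < \<rho> \<Longrightarrow> avg n (\<lambda>i. exp (l \<bullet> g i \<theta>) *\<^sub>R g i \<theta>) = 0 \<Longrightarrow>
        l \<bullet> avg n (\<lambda>i. g i \<theta>) - ln (avg n (\<lambda>i. exp (l \<bullet> g i \<theta>))) \<le> l0 \<bullet> avg n (\<lambda>i. g i t) - ln (avg n (\<lambda>i. exp (l0 \<bullet> g i t)))"
    and \<mu>: "avg n (\<lambda>i. (exp (l0 \<bullet> g i t) * (\<mu> \<bullet> g i t)) *\<^sub>R g i t) = avg n (\<lambda>i. g i t)"
  shows "l0 \<bullet> avg n (\<lambda>i. dg i h) - avg n (\<lambda>i. exp (l0 \<bullet> g i t) * (l0 \<bullet> dg i h)) / avg n (\<lambda>i. exp (l0 \<bullet> g i t))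
            - avg n (\<lambda>i. exp (l0 \<bullet> g i t) * ((l0 \<bullet> dg i h) * (\<mu> \<bullet> g i t) + \<mu> \<bullet> dg i h)) = 0"
proof -
  obtain l C V where V: "open V" "t \<in> V" "V \<subseteq> U" "l t = l0"
    "\<And>\<theta>. \<theta> \<in> V \<Longrightarrow> norm (l \<theta>) < \<rho>" "\<And>\<theta>. \<theta> \<in> V \<Longrightarrow> avg n (\<lambda>i. exp (l \<theta> \<bullet> g i \<theta>) *\<^sub>R g i \<theta>) = 0"
    "\<And>\<theta>. \<theta> \<in> V \<Longrightarrow> norm (l \<theta> - l t) \<le> C * norm (\<theta> - t)"
    by (rule multiplier_path[OF DERIV_exp exp_ge_quadratic_8 exp_strong_mono DERIV_exp l]) blast+
  define P where "P i z = fst z \<bullet> g i (snd z)" for i and z :: "'v \<times> 'p"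
  define P' where "P' i z = l0 \<bullet> dg i (snd z) + fst z \<bullet> g i t" for i and z :: "'v \<times> 'p"
  define e where "e i = exp (l0 \<bullet> g i t)" for i
  define F where "F = avg n e"
  have F: "0 < F" unfolding F_def avg_real e_def using n by (intro mult_pos_pos sum_pos) auto
  define H where "H z = (1 / real n) *\<^sub>R (\<Sum>i<n. P i z) - ln ((1 / real n) *\<^sub>R (\<Sum>i<n. exp (P i z)))
     - (1 / real n) *\<^sub>R (\<Sum>i<n. exp (P i z) * (\<mu> \<bullet> g i (snd z)))" for z
  define D where "D z = (1 / real n) *\<^sub>R (\<Sum>i<n. P' i z) - (1 / real n) *\<^sub>R (\<Sum>i<n. P' i z * e i) * (1 / F)
     - (1 / real n) *\<^sub>R (\<Sum>i<n. e i * (\<mu> \<bullet> dg i (snd z)) + P' i z * e i * (\<mu> \<bullet> g i t))" for z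
  have Plt: "P i (l0, t) = l0 \<bullet> g i t" for i by (simp add: P_def)
  have dP: "(P i has_derivative P' i) (at (l0, t))" if "i < n" for i
    using has_derivative_inner_pair[OF that] unfolding P_def[abs_def] P'_def[abs_def] .
  have dE: "((\<lambda>z. exp (P i z)) has_derivative (\<lambda>z. P' i z * e i)) (at (l0, t))" if "i < n" for i
    by (rule DERIV_compose_FDERIV[OF _ dP[OF that]]) (simp add: Plt e_def)
  have dM: "((\<lambda>z. \<mu> \<bullet> g i (snd z)) has_derivative (\<lambda>z. \<mu> \<bullet> dg i (snd z))) (at (l0, t))" if "i < n" for i
    by (intro has_derivative_inner_right has_derivative_compose[of snd snd, OF has_derivative_snd[OF has_derivative_ident]]) (simp add: der that)
  have dEM: "((\<lambda>z. exp (P i z) * (\<mu> \<bullet> g i (snd z))) has_derivative (\<lambda>z. e i * (\<mu> \<bullet> dg i (snd z)) + P' i z * e i * (\<mu> \<bullet> g i t))) (at (l0, t))" if "i < n" for i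
    using has_derivative_mult[OF dE[OF that] dM[OF that]] by (simp add: Plt e_def)
  have dF: "((\<lambda>z. (1 / real n) *\<^sub>R (\<Sum>i<n. exp (P i z))) has_derivative (\<lambda>z. (1 / real n) *\<^sub>R (\<Sum>i<n. P' i z * e i))) (at (l0, t))"
    using dE by (intro has_derivative_scaleR_right has_derivative_sum) auto
  have dP1: "((\<lambda>z. (1 / real n) *\<^sub>R (\<Sum>i<n. P i z)) has_derivative (\<lambda>z. (1 / real n) *\<^sub>R (\<Sum>i<n. P' i z))) (at (l0, t))"
    using dP by (intro has_derivative_scaleR_right has_derivative_sum) auto
  have dEM1: "((\<lambda>z. (1 / real n) *\<^sub>R (\<Sum>i<n. exp (P i z) * (\<mu> \<bullet> g i (snd z)))) has_derivative
      (\<lambda>z. (1 / real n) *\<^sub>R (\<Sum>i<n. e i * (\<mu> \<bullet> dg i (snd z)) + P' i z * e i * (\<mu> \<bullet> g i t)))) (at (l0, t))"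
    using dEM by (intro has_derivative_scaleR_right has_derivative_sum) auto
  have "(1 / real n) *\<^sub>R (\<Sum>i<n. exp (P i (l0, t))) = F" by (simp add: Plt F_def e_def avg_def)
  then have "(ln has_real_derivative 1 / F) (at ((1 / real n) *\<^sub>R (\<Sum>i<n. exp (P i (l0, t)))))"
    using F by (auto intro!: derivative_eq_intros)
  from DERIV_compose_FDERIV[OF this dF]
  have dH: "(H has_derivative D) (at (l t, t))"
    unfolding H_def[abs_def] D_def[abs_def] V(4) by (intro has_derivative_diff dP1 dEM1)
  have D0: "D (u, 0) = 0" for u
  proof -
    have "D (u, 0) = avg n (\<lambda>i. u \<bullet> g i t) - avg n (\<lambda>i. (u \<bullet> g i t) * e i) * (1 / F) - avg n (\<lambda>i. (u \<bullet> g i t) * e i * (\<mu> \<bullet> g i t))"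
      unfolding D_def avg_def P'_def by (simp add: dg_zero)
    also have "\<dots> = u \<bullet> avg n (\<lambda>i. g i t) - (u \<bullet> avg n (\<lambda>i. e i *\<^sub>R g i t)) * (1 / F) - u \<bullet> avg n (\<lambda>i. (e i * (\<mu> \<bullet> g i t)) *\<^sub>R g i t)"
      by (simp add: avg_inner_right mult_ac)
    \<comment> \<open>The normaliser term vanishes by the multiplier equation, and the two others
      cancel by the equation for \<mu>.\<close>
    finally show ?thesis using l \<mu> by (simp add: e_def)
  qed
  have "H (l \<theta>, \<theta>) \<le> H (l t, t)" if "\<theta> \<in> V" for \<theta>
  proof -
    have *: "H (m, \<theta>) = m \<bullet> avg n (\<lambda>i. g i \<theta>) - ln (avg n (\<lambda>i. exp (m \<bullet> g i \<theta>)))"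
      if "avg n (\<lambda>i. exp (m \<bullet> g i \<theta>) *\<^sub>R g i \<theta>) = 0" for m \<theta>
    proof -
      have "H (m, \<theta>) = m \<bullet> avg n (\<lambda>i. g i \<theta>) - ln (avg n (\<lambda>i. exp (m \<bullet> g i \<theta>))) - \<mu> \<bullet> avg n (\<lambda>i. exp (m \<bullet> g i \<theta>) *\<^sub>R g i \<theta>)"
        unfolding H_def avg_inner_right by (simp add: avg_def P_def)
      then show ?thesis using that by simp
    qed
    show ?thesis
      using *[OF V(6)[OF that]] *[OF l(2)] max[of \<theta> "l \<theta>"] V(3,4) V(5)[OF that] V(6)[OF that] that by auto
  qed
  from profile_maximum_derivative_zero[of H D l t V C, OF dH D0 V(1,2,7) this]
  have "D (0, h) = 0" .
  moreover have "D (0, h) = l0 \<bullet> avg n (\<lambda>i. dg i h) - avg n (\<lambda>i. e i * (l0 \<bullet> dg i h)) / F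
            - avg n (\<lambda>i. e i * ((l0 \<bullet> dg i h) * (\<mu> \<bullet> g i t) + \<mu> \<bullet> dg i h))"
    unfolding D_def P'_def avg_inner_right by (simp add: avg_def algebra_simps)
  ultimately show ?thesis by (simp add: e_def[abs_def] F_def)
qed

end

section \<open>Well-behaved samples\<close>

text \<open>The deterministic interface to the random sample. The envelope \<open>q\<close> serves a
  ball around \<open>t0\<close> and carries four moments; \<open>u\<close> serves all of \<Theta>
  and carries two. Outside radius \<open>r\<close> the separation constant \<open>c\<close> excludes
  a small mean; inside it the rank bound takes over, for which 2 K r <= \<gamma> is
  required.\<close>

locale good_sample = sample_envelope n q p b e K
  for n :: nat and q p b e :: "nat \<Rightarrow> real" and K :: real +
  fixes g :: "'b \<Rightarrow> real^'p \<Rightarrow> real^'g" and x :: "nat \<Rightarrow> 'b"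
    and G :: "nat \<Rightarrow> real^'p \<Rightarrow> real^'p \<Rightarrow> real^'g" and u :: "nat \<Rightarrow> real"
    and \<Theta> :: "(real^'p) set" and t0 :: "real^'p" and R r c \<kappa> \<gamma> :: real
  assumes ball_sub: "cball t0 R \<subseteq> \<Theta>"
    and r: "r \<le> R" "2 * K * r \<le> \<gamma>" and R: "0 < R" and \<kappa>: "0 < \<kappa>" and \<gamma>: "0 < \<gamma>"
    and der: "\<And>i \<theta>. i < n \<Longrightarrow> \<theta> \<in> cball t0 R \<Longrightarrow> (g (x i) has_derivative G i \<theta>) (at \<theta>)"
    and g_le: "\<And>i \<theta>. i < n \<Longrightarrow> \<theta> \<in> cball t0 R \<Longrightarrow> norm (g (x i) \<theta>) \<le> q i"
    and G_le: "\<And>i \<theta> h. i < n \<Longrightarrow> \<theta> \<in> cball t0 R \<Longrightarrow> norm (G i \<theta> h) \<le> p i * norm h"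
    and G_lip: "\<And>i \<theta> \<theta>' h. i < n \<Longrightarrow> \<theta> \<in> cball t0 R \<Longrightarrow> \<theta>' \<in> cball t0 R \<Longrightarrow>
        norm (G i \<theta> h - G i \<theta>' h) \<le> b i * norm (\<theta> - \<theta>') * norm h"
    and curv0: "\<And>v. \<kappa> * (norm v)\<^sup>2 \<le> avg n (\<lambda>i. (v \<bullet> g (x i) t0)\<^sup>2)"
    and rank0: "\<And>h. \<gamma> * norm h \<le> norm (avg n (\<lambda>i. G i t0 h))"
    and mean0: "norm (avg n (\<lambda>i. g (x i) t0)) \<le> K * (1 / sqrt (real n))"
    and u_le: "\<And>i \<theta>. i < n \<Longrightarrow> \<theta> \<in> \<Theta> \<Longrightarrow> norm (g (x i) \<theta>) \<le> u i" and u2: "avg n (\<lambda>i. (u i)\<^sup>2) \<le> K"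
    and sep: "\<And>\<theta>. \<theta> \<in> \<Theta> \<Longrightarrow> r \<le> norm (\<theta> - t0) \<Longrightarrow> c \<le> norm (avg n (\<lambda>i. g (x i) \<theta>))"
begin

definition \<tau> :: real where "\<tau> = 1 / sqrt (real n)"

lemma \<tau>: "0 < \<tau>" "\<tau>\<^sup>2 * real n = 1" "\<tau>\<^sup>2 = 1 / real n"
  using n by (auto simp: \<tau>_def power_divide)

lemma mean0': "norm (avg n (\<lambda>i. g (x i) t0)) \<le> K * \<tau>"
  using mean0 by (simp add: \<tau>_def)

lemma t0_ball: "t0 \<in> cball t0 R" using R by simp

lemma in_ball: "\<theta> \<in> cball t0 R \<longleftrightarrow> norm (\<theta> - t0) \<le> R"
  by (simp add: dist_norm norm_minus_commute)

section \<open>Local behaviour of a good sample near the true parameter\<close>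

lemma g_diff_le:
  assumes "i < n" "\<theta> \<in> cball t0 R" "\<theta>' \<in> cball t0 R"
  shows "norm (g (x i) \<theta> - g (x i) \<theta>') \<le> p i * norm (\<theta> - \<theta>')"
proof (rule differentiable_bound[OF convex_cball[of t0 R] _ _ assms(2,3)])
  fix y assume y: "y \<in> cball t0 R"
  show "(g (x i) has_derivative G i y) (at y within cball t0 R)"
    by (rule has_derivative_at_withinI[OF der[OF assms(1) y]])
  show "onorm (G i y) \<le> p i" by (rule onorm_le) (rule G_le[OF assms(1) y])
qed

lemma g_linearization:
  assumes "i < n" "\<theta> \<in> cball t0 R" "\<theta>' \<in> cball t0 R"
  shows "norm (g (x i) \<theta> - g (x i) \<theta>' - G i \<theta>' (\<theta> - \<theta>')) \<le> b i * (norm (\<theta> - \<theta>'))\<^sup>2"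
proof -
  have seg: "closed_segment \<theta>' \<theta> \<subseteq> cball t0 R" using assms by (simp add: closed_segment_subset)
  have "norm (g (x i) \<theta> - g (x i) \<theta>' - G i \<theta>' (\<theta> - \<theta>')) \<le> norm (\<theta> - \<theta>') * (b i * norm (\<theta> - \<theta>'))"
  proof (rule differentiable_bound_linearization)
    show "\<theta>' \<in> closed_segment \<theta>' \<theta>" by simp
    show "\<theta>' + t *\<^sub>R (\<theta> - \<theta>') \<in> closed_segment \<theta>' \<theta>" if "t \<in> {0..1}" for t
      using that by (auto simp: closed_segment_def algebra_simps intro!: exI[of _ t])
    show "(g (x i) has_derivative G i y) (at y within closed_segment \<theta>' \<theta>)" if "y \<in> closed_segment \<theta>' \<theta>" for y
      by (rule has_derivative_at_withinI[OF der[OF assms(1)]]) (use seg that in blast)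
    show "onorm (G i y - G i \<theta>') \<le> b i * norm (\<theta> - \<theta>')" if "y \<in> closed_segment \<theta>' \<theta>" for y
    proof (rule onorm_le)
      fix h
      have "norm ((G i y - G i \<theta>') h) \<le> b i * norm (y - \<theta>') * norm h"
        using G_lip[OF assms(1) _ assms(3), of y h] seg that by (auto simp: fun_diff_def)
      also have "\<dots> \<le> b i * norm (\<theta> - \<theta>') * norm h"
        using segment_bound(1)[OF that] b0[OF assms(1)] by (intro mult_right_mono mult_left_mono) auto
      finally show "norm ((G i y - G i \<theta>') h) \<le> b i * norm (\<theta> - \<theta>') * norm h" .
    qed
  qed
  then show ?thesis by (simp add: power2_eq_square mult_ac)
qed

lemma avg_g_diff_le:
  assumes "\<theta> \<in> cball t0 R" "\<theta>' \<in> cball t0 R"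
  shows "norm (avg n (\<lambda>i. g (x i) \<theta> - g (x i) \<theta>')) \<le> norm (\<theta> - \<theta>') * K"
proof (rule norm_avg_e)
  fix i assume i: "i < n"
  show "norm (g (x i) \<theta> - g (x i) \<theta>') \<le> norm (\<theta> - \<theta>') * e i"
    using g_diff_le[OF i assms] mult_right_mono[OF monomials(5)[OF i], of "norm (\<theta> - \<theta>')"] by (simp add: mult_ac)
qed auto

lemma mean_near:
  assumes "\<theta> \<in> cball t0 R" "norm (\<theta> - t0) \<le> s * \<tau>"
  shows "norm (avg n (\<lambda>i. g (x i) \<theta>)) \<le> (K + K * s) * \<tau>"
proof -
  have "avg n (\<lambda>i. g (x i) \<theta>) = avg n (\<lambda>i. g (x i) t0) + avg n (\<lambda>i. g (x i) \<theta> - g (x i) t0)" by (simp add: avg_diff)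
  also have "norm \<dots> \<le> K * \<tau> + norm (\<theta> - t0) * K"
    by (intro order_trans[OF norm_triangle_ineq] add_mono mean0' avg_g_diff_le assms t0_ball)
  also have "\<dots> \<le> K * \<tau> + (s * \<tau>) * K" using assms K_ge_1 by (intro add_left_mono mult_right_mono) auto
  finally show ?thesis by (simp add: algebra_simps)
qed

lemma curv_near:
  assumes "\<theta> \<in> cball t0 R" "4 * K * norm (\<theta> - t0) \<le> \<kappa>"
  shows "\<kappa> / 2 * (norm v)\<^sup>2 \<le> avg n (\<lambda>i. (v \<bullet> g (x i) \<theta>)\<^sup>2)"
proof -
  let ?d = "\<lambda>i. (v \<bullet> g (x i) \<theta>)\<^sup>2 - (v \<bullet> g (x i) t0)\<^sup>2"
  have "norm (avg n ?d) \<le> (2 * norm (\<theta> - t0) * (norm v)\<^sup>2) * K"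
  proof (rule norm_avg_e)
    fix i assume i: "i < n"
    have "?d i = (v \<bullet> (g (x i) \<theta> - g (x i) t0)) * (v \<bullet> (g (x i) \<theta> + g (x i) t0))"
      by (simp add: inner_diff_right inner_add_right power2_eq_square algebra_simps)
    also have "\<bar>\<dots>\<bar> \<le> (norm v * (p i * norm (\<theta> - t0))) * (norm v * (q i + q i))"
      by (intro abs_mult_bound abs_inner_bound g_diff_le norm_triangle_le add_mono g_le i assms t0_ball order_refl)
    also have "\<dots> = (2 * norm (\<theta> - t0) * (norm v)\<^sup>2) * (p i * q i)" by (simp add: power2_eq_square)
    also have "\<dots> \<le> (2 * norm (\<theta> - t0) * (norm v)\<^sup>2) * e i" using monomials[OF i] by (intro mult_left_mono) auto
    finally show "norm (?d i) \<le> 2 * norm (\<theta> - t0) * (norm v)\<^sup>2 * e i" by simp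
  qed auto
  also have "\<dots> = (4 * K * norm (\<theta> - t0)) * (norm v)\<^sup>2 / 2" by simp
  also have "\<dots> \<le> \<kappa> * (norm v)\<^sup>2 / 2" using assms by (intro divide_right_mono mult_right_mono) auto
  finally have "- (\<kappa> * (norm v)\<^sup>2 / 2) \<le> avg n ?d" by simp
  then show ?thesis using curv0[of v] by (simp add: avg_diff)
qed

text \<open>A quantitative local inverse for the sample mean: linearise at \<theta>', then move the
  Jacobian to \<open>t0\<close>. Each replacement costs \<open>K\<close> times a distance, and the
  third assumption limits the total cost to half of the rank bound.\<close>

lemma mean_diff_ge:
  assumes "\<theta> \<in> cball t0 R" "\<theta>' \<in> cball t0 R" "K * (norm (\<theta>' - t0) + norm (\<theta> - \<theta>')) \<le> \<gamma> / 2"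
  shows "\<gamma> / 2 * norm (\<theta> - \<theta>') \<le> norm (avg n (\<lambda>i. g (x i) \<theta> - g (x i) \<theta>'))"
proof -
  let ?h = "\<theta> - \<theta>'"
  let ?a = "\<lambda>i. g (x i) \<theta> - g (x i) \<theta>' - G i \<theta>' ?h" and ?b = "\<lambda>i. G i \<theta>' ?h - G i t0 ?h"
  have "norm (avg n ?a) \<le> (norm ?h)\<^sup>2 * K"
  proof (rule norm_avg_e)
    fix i assume i: "i < n"
    show "norm (?a i) \<le> (norm ?h)\<^sup>2 * e i"
      using g_linearization[OF i assms(1,2)] mult_right_mono[OF monomials(9)[OF i], of "(norm ?h)\<^sup>2"] by (simp add: mult_ac)
  qed auto
  moreover have "norm (avg n ?b) \<le> (norm (\<theta>' - t0) * norm ?h) * K"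
  proof (rule norm_avg_e)
    fix i assume i: "i < n"
    show "norm (?b i) \<le> (norm (\<theta>' - t0) * norm ?h) * e i"
      using G_lip[OF i assms(2) t0_ball, of ?h] mult_right_mono[OF monomials(9)[OF i], of "norm (\<theta>' - t0) * norm ?h"]
      by (simp add: mult_ac)
  qed auto
  moreover have "avg n (\<lambda>i. G i t0 ?h) = avg n (\<lambda>i. g (x i) \<theta> - g (x i) \<theta>') - avg n ?a - avg n ?b"
    by (simp add: avg_diff)
  then have "norm (avg n (\<lambda>i. G i t0 ?h)) \<le> norm (avg n (\<lambda>i. g (x i) \<theta> - g (x i) \<theta>')) + norm (avg n ?a) + norm (avg n ?b)"
    by (simp only:) (intro order_trans[OF norm_triangle_ineq4] add_right_mono norm_triangle_ineq4)
  moreover have "(norm ?h)\<^sup>2 * K + (norm (\<theta>' - t0) * norm ?h) * K = (K * (norm (\<theta>' - t0) + norm ?h)) * norm ?h"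
    by (simp add: power2_eq_square algebra_simps)
  moreover have "\<dots> \<le> \<gamma> / 2 * norm ?h" using assms(3) by (intro mult_right_mono) auto
  moreover have "\<gamma> / 2 * norm ?h + \<gamma> / 2 * norm ?h = \<gamma> * norm ?h" by simp
  ultimately show ?thesis using rank0[of ?h] by linarith
qed

text \<open>The fourth moment gives q_i^4 <= n K, so \<tau> q_i is of order n^(-1/4) uniformly in i.
  Multipliers of order \<tau> therefore stay where |l . g_i| <= 1/2, the range of all scalar
  inequalities.\<close>

lemma scaled_q_le:
  assumes "0 \<le> \<alpha>" "16 * \<alpha> ^ 4 * K * \<tau>\<^sup>2 \<le> 1" "i < n"
  shows "\<alpha> * \<tau> * q i \<le> 1/2"
proof -
  have "q i ^ 4 \<le> e i" using monomials assms by auto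
  also have "\<dots> \<le> real n * avg n e" using e_ge_1 assms(3) by (intro member_le_avg) force+
  also have "\<dots> \<le> real n * K" using K by (intro mult_left_mono) auto
  finally have q: "q i ^ 4 \<le> real n * K" .
  have "(\<alpha> * \<tau> * q i) ^ 4 = \<alpha> ^ 4 * \<tau> ^ 4 * q i ^ 4" by (simp add: power_mult_distrib)
  also have "\<dots> \<le> \<alpha> ^ 4 * \<tau> ^ 4 * (real n * K)" using q by (intro mult_left_mono) auto
  also have "\<dots> = \<alpha> ^ 4 * K * \<tau>\<^sup>2 * (\<tau>\<^sup>2 * real n)" by (simp add: power2_eq_square power4_eq_xxxx)
  also have "\<dots> \<le> (1/2) ^ 4" using assms(2) \<tau>(2) by (simp add: power4_eq_xxxx)
  finally show ?thesis by (rule power_le_imp_le_base[where n = 3, simplified]) simp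
qed

section \<open>The root-n rate of each estimator\<close>

lemma etel_obj_t0_ge:
  assumes "16 * (9 * K / \<kappa>) ^ 4 * K * \<tau>\<^sup>2 \<le> 1"
  shows "ereal (- (9 * K\<^sup>2 / \<kappa>) * \<tau>\<^sup>2) \<le> etel_obj g x n t0"
proof -
  \<comment> \<open>\<open>multiplier_exists\<close> wants the mean, here at most K \<tau>, strictly
    below \<kappa> \<rho> / 8; the 9 in place of 8 provides the strictness.\<close>
  let ?\<rho> = "9 * K / \<kappa> * \<tau>"
  have K0: "0 < K" using K_ge_1 by simp
  obtain l where l: "norm l < ?\<rho>" "avg n (\<lambda>i. exp (l \<bullet> g (x i) t0) *\<^sub>R g (x i) t0) = 0"
  proof (rule multiplier_exists[OF n, of ?\<rho> \<kappa> "\<lambda>i. g (x i) t0" exp exp])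
    show "0 < ?\<rho>" using K0 \<kappa> \<tau> by simp
    show "\<kappa> * (norm v)\<^sup>2 \<le> avg n (\<lambda>i. (v \<bullet> g (x i) t0)\<^sup>2)" for v by (rule curv0)
    show "?\<rho> * norm (g (x i) t0) \<le> 1/2" if "i < n" for i
    proof -
      have "?\<rho> * norm (g (x i) t0) \<le> ?\<rho> * q i" using g_le[OF that t0_ball] K0 \<kappa> \<tau> by (intro mult_left_mono) auto
      also have "\<dots> \<le> 1/2" using assms K0 \<kappa> that by (intro scaled_q_le) auto
      finally show ?thesis .
    qed
    have "K * \<tau> < \<kappa> * ?\<rho> / 8" using K0 \<kappa> \<tau> by simp
    then show "norm (avg n (\<lambda>i. g (x i) t0)) < \<kappa> * ?\<rho> / 8" using mean0' by linarith
  qed (use exp_ge_quadratic_8 DERIV_exp in auto)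
  have "\<bar>l \<bullet> avg n (\<lambda>i. g (x i) t0)\<bar> \<le> ?\<rho> * (K * \<tau>)" using l mean0' by (intro abs_inner_bound) auto
  also have "\<dots> = (9 * K\<^sup>2 / \<kappa>) * \<tau>\<^sup>2" by (simp add: power2_eq_square)
  finally have "- (9 * K\<^sup>2 / \<kappa>) * \<tau>\<^sup>2 \<le> l \<bullet> avg n (\<lambda>i. g (x i) t0)" by simp
  also have "\<dots> \<le> l \<bullet> avg n (\<lambda>i. g (x i) t0) - ln (avg n (\<lambda>i. exp (l \<bullet> g (x i) t0)))"
    by (rule etel_dual_ge[OF n l(2)])
  finally show ?thesis unfolding etel_obj_eq[where g = g, OF n l(2)] by simp
qed

text \<open>Weak duality is tested with the vector of length s pointing against the sample mean. It
  yields -V \<tau>^2 <= -s m + 2 K s^2 with m the norm of the mean, so a large mean would push the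
  EL value too low. The bound holds on all of \<Theta>, with the envelope \<open>u\<close> and its
  second moment.\<close>

lemma mean_le_of_el_obj_ge:
  assumes \<theta>: "\<theta> \<in> \<Theta>" and V: "0 \<le> V" and el: "ereal (- V * \<tau>\<^sup>2) \<le> el_obj g x n \<theta>"
  shows "norm (avg n (\<lambda>i. g (x i) \<theta>)) \<le> (8 * K * V + 1) * \<tau>"
proof (cases "avg n (\<lambda>i. g (x i) \<theta>) = 0")
  case True
  then show ?thesis using V K_ge_1 \<tau> by simp
next
  case False
  define m where "m = norm (avg n (\<lambda>i. g (x i) \<theta>))"
  \<comment> \<open>The first bound keeps the quadratic term below half of the linear one. The
    second keeps |l . g_i| <= 1/2, since \<open>u2\<close> gives \<tau> u_i <= K.\<close>
  define s where "s = min (m / (4 * K)) (\<tau> / (2 * K))"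
  define l where "l = (- s / m) *\<^sub>R avg n (\<lambda>i. g (x i) \<theta>)"
  have m: "0 < m" using False by (simp add: m_def)
  have K1: "1 \<le> K" by (rule K_ge_1)
  have s: "0 < s" "s \<le> m / (4 * K)" "s \<le> \<tau> / (2 * K)" using m K1 \<tau> by (auto simp: s_def)
  have nl: "norm l = s" using m s by (simp add: l_def flip: m_def)
  have lg: "l \<bullet> avg n (\<lambda>i. g (x i) \<theta>) = - s * m"
    using m by (simp add: l_def flip: power2_norm_eq_inner m_def) (simp add: power2_eq_square)
  have small: "\<bar>l \<bullet> g (x i) \<theta>\<bar> \<le> 1/2" and sq: "(l \<bullet> g (x i) \<theta>)\<^sup>2 \<le> s\<^sup>2 * (u i)\<^sup>2" if "i < n" for i
  proof -
    have lu: "\<bar>l \<bullet> g (x i) \<theta>\<bar> \<le> s * u i" using nl u_le[OF that \<theta>] by (intro abs_inner_bound) auto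
    then show "(l \<bullet> g (x i) \<theta>)\<^sup>2 \<le> s\<^sup>2 * (u i)\<^sup>2" using power_mono[OF lu, of 2] by (simp add: power_mult_distrib)
    have u0: "0 \<le> u i" using u_le[OF that \<theta>] norm_ge_zero order_trans by blast
    have "(u i)\<^sup>2 \<le> real n * avg n (\<lambda>i. (u i)\<^sup>2)" using that by (intro member_le_avg) auto
    also have "\<dots> \<le> real n * K" using u2 by (intro mult_left_mono) auto
    also have "\<dots> \<le> real n * K\<^sup>2" using K1 by (intro mult_left_mono) (auto simp: power2_eq_square)
    finally have "\<tau>\<^sup>2 * (u i)\<^sup>2 \<le> \<tau>\<^sup>2 * (real n * K\<^sup>2)" by (intro mult_left_mono) auto
    also have "\<dots> = K\<^sup>2" using \<tau>(2) by (simp flip: mult.assoc)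
    finally have "(\<tau> * u i)\<^sup>2 \<le> K\<^sup>2" by (simp add: power_mult_distrib)
    then have "\<tau> * u i \<le> K" by (rule power2_le_imp_le) (use K1 in simp)
    then have "\<tau> / (2 * K) * u i \<le> 1/2" using K1 by (simp add: field_simps)
    moreover have "s * u i \<le> \<tau> / (2 * K) * u i" using s u0 by (intro mult_right_mono)
    ultimately show "\<bar>l \<bullet> g (x i) \<theta>\<bar> \<le> 1/2" using lu by linarith
  qed
  have "ereal (- V * \<tau>\<^sup>2) \<le> ereal (- avg n (\<lambda>i. ln (1 - l \<bullet> g (x i) \<theta>)))"
    using small by (intro order_trans[OF el] el_obj_le_dual n) force
  then have "- V * \<tau>\<^sup>2 \<le> avg n (\<lambda>i. - ln (1 - l \<bullet> g (x i) \<theta>))" by (simp add: avg_minus)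
  also have "\<dots> \<le> avg n (\<lambda>i. l \<bullet> g (x i) \<theta> + 2 * s\<^sup>2 * (u i)\<^sup>2)"
  proof (rule avg_mono)
    fix i assume i: "i < n"
    show "- ln (1 - l \<bullet> g (x i) \<theta>) \<le> l \<bullet> g (x i) \<theta> + 2 * s\<^sup>2 * (u i)\<^sup>2"
      using neg_ln_le_quadratic[OF small[OF i]] sq[OF i] by linarith
  qed
  also have "\<dots> = - s * m + 2 * s\<^sup>2 * avg n (\<lambda>i. (u i)\<^sup>2)"
    by (simp only: avg_add avg_mult_left lg flip: avg_inner_right)
  also have "\<dots> \<le> - s * m + 2 * s\<^sup>2 * K" using u2 by (intro add_left_mono mult_left_mono) auto
  also have "2 * s\<^sup>2 * K = s * (2 * K * s)" by (simp add: power2_eq_square)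
  also have "- s * m + s * (2 * K * s) \<le> - s * m + s * (m / 2)"
    using s K1 by (intro add_left_mono mult_left_mono) (auto simp: field_simps)
  finally have main: "s * m \<le> 2 * V * \<tau>\<^sup>2" by (simp add: mult_ac)
  show ?thesis
  proof (cases "m / (4 * K) \<le> \<tau> / (2 * K)")
    case True
    then have "s = m / (4 * K)" by (simp add: s_def)
    then have "m\<^sup>2 = 4 * K * (s * m)" using K1 by (simp add: power2_eq_square)
    also have "\<dots> \<le> 4 * K * (2 * V * \<tau>\<^sup>2)" using main K1 by (intro mult_left_mono) auto
    also have "\<dots> = (8 * K * V) * \<tau>\<^sup>2" by simp
    \<comment> \<open>From y <= (y + 1)^2 with y = 8KV; a square on the right lets the root be taken
      without a square root in the constant.\<close>
    also have "\<dots> \<le> (8 * K * V + 1)\<^sup>2 * \<tau>\<^sup>2"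
    proof (rule mult_right_mono)
      have "0 \<le> 8 * K * V" using K1 V by simp
      moreover have "(8 * K * V + 1)\<^sup>2 = (8 * K * V)\<^sup>2 + 2 * (8 * K * V) + 1" by (simp add: power2_sum)
      moreover have "0 \<le> (8 * K * V)\<^sup>2" by simp
      ultimately show "8 * K * V \<le> (8 * K * V + 1)\<^sup>2" by linarith
    qed simp
    also have "\<dots> = ((8 * K * V + 1) * \<tau>)\<^sup>2" by (simp add: power_mult_distrib)
    finally show ?thesis unfolding m_def[symmetric] using K1 V \<tau> by (intro power2_le_imp_le[of m]) auto
  next
    case False
    then have "s = \<tau> / (2 * K)" by (simp add: s_def)
    then have "\<tau> * m = 2 * K * (s * m)" using K1 by simp
    also have "\<dots> \<le> 2 * K * (2 * V * \<tau>\<^sup>2)" using main K1 by (intro mult_left_mono) auto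
    also have "\<dots> = \<tau> * (4 * K * V * \<tau>)" by (simp add: power2_eq_square)
    finally have "\<tau> * m \<le> \<tau> * (4 * K * V * \<tau>)" .
    then have "m \<le> 4 * K * V * \<tau>" using \<tau> by simp
    also have "\<dots> \<le> (8 * K * V + 1) * \<tau>" using K1 V \<tau> by (intro mult_right_mono) auto
    finally show ?thesis by (simp add: m_def)
  qed
qed

text \<open>Consistency comes first: a mean below \<open>c\<close> contradicts \<open>sep\<close>
  outside radius \<open>r\<close>. Inside, \<open>mean_diff_ge\<close> with base point
  \<open>t0\<close> turns the bound on the mean into one on the parameter.\<close>

lemma estimator_rate:
  assumes \<theta>: "\<theta> \<in> \<Theta>" and V: "0 \<le> V" and el: "ereal (- V * \<tau>\<^sup>2) \<le> el_obj g x n \<theta>"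
    and c: "(8 * K * V + 1) * \<tau> < c"
  shows "norm (\<theta> - t0) \<le> 2 * (8 * K * V + 1 + K) / \<gamma> * \<tau>"
proof -
  note m = mean_le_of_el_obj_ge[OF \<theta> V el]
  have rr: "norm (\<theta> - t0) < r" using sep[OF \<theta>] m c by force
  then have \<theta>R: "\<theta> \<in> cball t0 R" using r unfolding in_ball by simp
  have "2 * K * norm (\<theta> - t0) \<le> 2 * K * r" using rr K_ge_1 by (intro mult_left_mono) auto
  then have "\<gamma> / 2 * norm (\<theta> - t0) \<le> norm (avg n (\<lambda>i. g (x i) \<theta> - g (x i) t0))"
    using r by (intro mean_diff_ge \<theta>R t0_ball) auto
  also have "\<dots> \<le> (8 * K * V + 1) * \<tau> + K * \<tau>"
    unfolding avg_diff by (intro order_trans[OF norm_triangle_ineq4] add_mono m mean0')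
  finally show ?thesis using \<gamma> by (simp add: field_simps)
qed

section \<open>The distance between the two estimators of a good sample\<close>

lemma stationary_near:
  assumes s: "0 < s" "s * \<tau> \<le> R" "4 * K * s * \<tau> \<le> \<kappa>" and a: "a = 17 * (K + K * s) / \<kappa>" "16 * a ^ 4 * K * \<tau>\<^sup>2 \<le> 1"
    and t: "norm (t - t0) < s * \<tau>"
  shows "stationary_point n (\<lambda>i. g (x i)) (\<lambda>i. G i t) t (ball t0 (s * \<tau>)) (\<kappa> / 2) (a * \<tau>)"
proof
  have K1: "1 \<le> K" by (rule K_ge_1)
  have a0: "0 < a" unfolding a using K1 s \<kappa> by (simp add: add_pos_pos)
  have near: "norm (\<theta> - t0) \<le> s * \<tau>" "\<theta> \<in> cball t0 R" if "\<theta> \<in> ball t0 (s * \<tau>)" for \<theta>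
    using that s unfolding in_ball by (auto simp: dist_norm norm_minus_commute)
  show "0 < n" by (rule n)
  show "0 < \<kappa> / 2" using \<kappa> by simp
  show "0 < a * \<tau>" using a0 \<tau> by simp
  show "open (ball t0 (s * \<tau>))" by simp
  show tb: "t \<in> ball t0 (s * \<tau>)" using t by (simp add: dist_norm norm_minus_commute)
  show "(g (x i) has_derivative G i t) (at t)" if "i < n" for i
    by (rule der[OF that near(2)[OF tb]])
  show "\<kappa> / 2 * (norm u)\<^sup>2 \<le> avg n (\<lambda>i. (u \<bullet> g (x i) \<theta>)\<^sup>2)" if "\<theta> \<in> ball t0 (s * \<tau>)" for u \<theta>
  proof (rule curv_near[OF near(2)[OF that]])
    have "4 * K * norm (\<theta> - t0) \<le> 4 * K * (s * \<tau>)" using near(1)[OF that] K1 by (intro mult_left_mono) auto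
    then show "4 * K * norm (\<theta> - t0) \<le> \<kappa>" using s by simp
  qed
  show "a * \<tau> * norm (g (x i) \<theta>) \<le> 1/2" if "i < n" "\<theta> \<in> ball t0 (s * \<tau>)" for i \<theta>
  proof -
    have "a * \<tau> * norm (g (x i) \<theta>) \<le> a * \<tau> * q i"
      using g_le[OF that(1) near(2)[OF that(2)]] a0 \<tau> by (intro mult_left_mono) auto
    also have "\<dots> \<le> 1/2" using a a0 that by (intro scaled_q_le) auto
    finally show ?thesis .
  qed
  show "norm (avg n (\<lambda>i. g (x i) \<theta>)) < \<kappa> / 2 * (a * \<tau>) / 8" if "\<theta> \<in> ball t0 (s * \<tau>)" for \<theta>
  proof -
    have "0 < (K + K * s) * \<tau>" using K1 s \<tau> by (simp add: add_pos_pos)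
    \<comment> \<open>With curvature \<kappa>/2 the factor 16 would give equality in the mean
      condition; the 17 in \<open>a\<close> makes it strict.\<close>
    moreover have "\<kappa> / 2 * (a * \<tau>) / 8 = 17 / 16 * ((K + K * s) * \<tau>)" using \<kappa> unfolding a by simp
    ultimately show ?thesis using mean_near[OF near(2)[OF that] near(1)[OF that]] by linarith
  qed
qed

text \<open>Away from \<open>t0\<close> curvature and rank bound are halved, hence \<kappa>/2 and
  \<gamma>/2 in the constants. \<open>V\<close> bounds the objective from below, \<open>s\<close> is
  the rate of both estimators plus 1 so that they lie in an open ball, and \<open>a\<close> is the
  size of the multipliers, each in units of a power of \<tau>. All conditions in
  \<open>small\<close> hold once \<tau> is small.\<close>

lemma estimators_close:
  assumes V: "V = 9 * K\<^sup>2 / \<kappa>" and s: "s = 2 * (8 * K * V + 1 + K) / \<gamma> + 1" and a: "a = 17 * (K + K * s) / \<kappa>"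
    and D: "D = 48 * K / (\<kappa> / 2)" and c0: "c\<^sub>0 = \<kappa> / 2 * (\<gamma> / 2)\<^sup>2 / (512 * K\<^sup>2)"
    and D': "D' = 6 * K / (\<kappa> / 2)" and C: "C = (4 + 7 * D' + 12 * K + (3 + 4 * D') * K / (\<kappa> / 2)) * K"
    and small: "s * \<tau> \<le> R" "4 * K * s * \<tau> \<le> \<kappa>" "6 * K * s * \<tau> \<le> \<gamma>" "(8 * K * V + 1) * \<tau> < c"
      "a * \<tau> \<le> 1" "24 * K * a * \<tau> \<le> \<gamma>" "((6 + 8 * D) * K * a + 4 * D * K * s) * \<tau> \<le> c\<^sub>0 / 2"
      "16 * a ^ 4 * K * \<tau>\<^sup>2 \<le> 1"
    and maxE: "is_maximizer (etel_obj g x n) \<Theta> tE" and maxL: "is_maximizer (el_obj g x n) \<Theta> tL"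
  shows "norm (tE - tL) \<le> 2 * C * a ^ 3 / c\<^sub>0 * \<tau> ^ 3"
proof -
  have K1: "1 \<le> K" by (rule K_ge_1)
  have V0: "0 \<le> V" unfolding V using \<kappa> by simp
  have KV: "0 \<le> 8 * K * V" using K1 V0 by simp
  have s1: "1 < s" unfolding s using KV K1 \<gamma> by (simp add: add_pos_pos add_nonneg_pos)
  have s0: "0 < s" using s1 by simp
  have a0: "0 < a" unfolding a using K1 s0 \<kappa> by (simp add: add_pos_pos)
  have \<kappa>2: "0 < \<kappa> / 2" using \<kappa> by simp
  have C0: "0 \<le> C" unfolding C D' using K1 \<kappa> by (intro mult_nonneg_nonneg add_nonneg_nonneg divide_nonneg_nonneg) auto
  have c0_pos: "0 < c\<^sub>0" unfolding c0 using K1 \<kappa> \<gamma> by (intro divide_pos_pos mult_pos_pos) auto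
  have "9 * K / \<kappa> \<le> a" unfolding a using K1 s0 \<kappa> by (intro divide_right_mono) (simp_all add: add_increasing2)
  then have "16 * (9 * K / \<kappa>) ^ 4 * K * \<tau>\<^sup>2 \<le> 16 * a ^ 4 * K * \<tau>\<^sup>2"
    using K1 \<kappa> by (intro mult_right_mono mult_left_mono power_mono) auto
  then have "16 * (9 * K / \<kappa>) ^ 4 * K * \<tau>\<^sup>2 \<le> 1" using small(8) by linarith
  then have E0: "ereal (- V * \<tau>\<^sup>2) \<le> etel_obj g x n t0" unfolding V by (rule etel_obj_t0_ge)
  have t0: "t0 \<in> \<Theta>" using ball_sub t0_ball by auto
  have tE\<Theta>: "tE \<in> \<Theta>" and tL\<Theta>: "tL \<in> \<Theta>" using maxE maxL by (auto simp: is_maximizer_def)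
  have "etel_obj g x n t0 \<le> etel_obj g x n tE" using maxE t0 by (simp add: is_maximizer_def)
  also have "\<dots> \<le> el_obj g x n tE" by (rule etel_obj_le_el_obj[OF n])
  finally have elE: "ereal (- V * \<tau>\<^sup>2) \<le> el_obj g x n tE" using E0 order_trans by blast
  have "etel_obj g x n t0 \<le> el_obj g x n t0" by (rule etel_obj_le_el_obj[OF n])
  also have "\<dots> \<le> el_obj g x n tL" using maxL t0 by (simp add: is_maximizer_def)
  finally have elL: "ereal (- V * \<tau>\<^sup>2) \<le> el_obj g x n tL" using E0 order_trans by blast
  have "2 * (8 * K * V + 1 + K) / \<gamma> * \<tau> < s * \<tau>" unfolding s using \<tau> by (intro mult_strict_right_mono) auto
  then have tE: "norm (tE - t0) < s * \<tau>" and tL: "norm (tL - t0) < s * \<tau>"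
    using estimator_rate[OF tE\<Theta> V0 elE small(4)] estimator_rate[OF tL\<Theta> V0 elL small(4)] by linarith+
  interpret SE: stationary_point n "\<lambda>i. g (x i)" "\<lambda>i. G i tE" tE "ball t0 (s * \<tau>)" "\<kappa> / 2" "a * \<tau>"
    by (rule stationary_near[OF s0 small(1,2) a small(8) tE])
  interpret SL: stationary_point n "\<lambda>i. g (x i)" "\<lambda>i. G i tL" tL "ball t0 (s * \<tau>)" "\<kappa> / 2" "a * \<tau>"
    by (rule stationary_near[OF s0 small(1,2) a small(8) tL])
  have sub: "ball t0 (s * \<tau>) \<subseteq> cball t0 R" using small(1) by auto
  have tER: "tE \<in> cball t0 R" and tLR: "tL \<in> cball t0 R" using sub SE.U(2) SL.U(2) by auto
  have lt1: "l \<bullet> g (x i) \<theta> < 1" if "norm l < a * \<tau>" "i < n" "\<theta> \<in> ball t0 (s * \<tau>)" for l i \<theta>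
    using inner_small[OF SE.small[OF that(2,3)] less_imp_le[OF that(1)]] by linarith
  have exL: "\<exists>l. norm l < a * \<tau> \<and> avg n (\<lambda>i. (1 / (1 - l \<bullet> g (x i) \<theta>)) *\<^sub>R g (x i) \<theta>) = 0" if "\<theta> \<in> ball t0 (s * \<tau>)" for \<theta>
    by (rule multiplier_exists[OF n SE.\<rho> SE.curv[OF that] SE.small[OF _ that] SE.mean[OF that]
          DERIV_neg_ln neg_ln_ge_quadratic]) blast+
  obtain lE where lE: "norm lE < a * \<tau>" "avg n (\<lambda>i. exp (lE \<bullet> g (x i) tE) *\<^sub>R g (x i) tE) = 0"
    by (rule multiplier_exists[OF n SE.\<rho> SE.curv[OF SE.U(2)] SE.small[OF _ SE.U(2)] SE.mean[OF SE.U(2)]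
          DERIV_exp exp_ge_quadratic_8]) blast+
  obtain lL where lL: "norm lL < a * \<tau>" "avg n (\<lambda>i. (1 / (1 - lL \<bullet> g (x i) tL)) *\<^sub>R g (x i) tL) = 0" using exL[OF SL.U(2)] by blast
  \<comment> \<open>The EL multiplier at the ETEL estimator is the link: \<open>score_gap\<close>
    compares it with \<open>lE\<close> at the same parameter, and \<open>score_strong_mono\<close>
    with \<open>lL\<close> at the other one.\<close>
  obtain lM where lM: "norm lM < a * \<tau>" "avg n (\<lambda>i. (1 / (1 - lM \<bullet> g (x i) tE)) *\<^sub>R g (x i) tE) = 0" using exL[OF SE.U(2)] by blast
  obtain \<mu> where \<mu>: "avg n (\<lambda>i. (exp (lE \<bullet> g (x i) tE) * (\<mu> \<bullet> g (x i) tE)) *\<^sub>R g (x i) tE) = avg n (\<lambda>i. g (x i) tE)"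
  proof -
    have "1/2 \<le> exp (lE \<bullet> g (x i) tE)" if "i < n" for i
      using inner_small[OF SE.small[OF that SE.U(2)] less_imp_le[OF lE(1)]] by (rule exp_half_bounds)
    then show ?thesis
      using positive_gram_surjective[OF SE.\<kappa> SE.curv[OF SE.U(2)], of "1/2" "\<lambda>i. exp (lE \<bullet> g (x i) tE)"] that by auto
  qed
  \<comment> \<open>Both first-order conditions are used in this one direction. The score along
    \<open>h\<close> vanishes at \<open>tL\<close> and is O(\<tau>^3 |h|) at \<open>tE\<close>;
    monotonicity bounds the difference below by a multiple of |h|^2, and one factor |h|
    cancels.\<close>
  define h where "h = tE - tL"
  have focE: "lE \<bullet> avg n (\<lambda>i. G i tE h) - avg n (\<lambda>i. exp (lE \<bullet> g (x i) tE) * (lE \<bullet> G i tE h)) / avg n (\<lambda>i. exp (lE \<bullet> g (x i) tE))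
            - avg n (\<lambda>i. exp (lE \<bullet> g (x i) tE) * ((lE \<bullet> G i tE h) * (\<mu> \<bullet> g (x i) tE) + \<mu> \<bullet> G i tE h)) = 0"
  proof (rule SE.etel_first_order[OF lE _ \<mu>])
    fix \<theta> l assume \<theta>: "\<theta> \<in> ball t0 (s * \<tau>)" and l: "norm l < a * \<tau>" "avg n (\<lambda>i. exp (l \<bullet> g (x i) \<theta>) *\<^sub>R g (x i) \<theta>) = 0"
    have "etel_obj g x n \<theta> \<le> etel_obj g x n tE" using maxE sub ball_sub \<theta> unfolding is_maximizer_def by blast
    then show "l \<bullet> avg n (\<lambda>i. g (x i) \<theta>) - ln (avg n (\<lambda>i. exp (l \<bullet> g (x i) \<theta>)))
        \<le> lE \<bullet> avg n (\<lambda>i. g (x i) tE) - ln (avg n (\<lambda>i. exp (lE \<bullet> g (x i) tE)))"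
      unfolding etel_obj_eq[where g = g, OF n l(2)] etel_obj_eq[where g = g, OF n lE(2)] by simp
  qed
  have el_eq: "el_obj g x n \<theta> = ereal (- avg n (\<lambda>i. ln (1 - l \<bullet> g (x i) \<theta>)))"
    if "norm l < a * \<tau>" "avg n (\<lambda>i. (1 / (1 - l \<bullet> g (x i) \<theta>)) *\<^sub>R g (x i) \<theta>) = 0" "\<theta> \<in> ball t0 (s * \<tau>)" for l \<theta>
    by (rule el_obj_eq_dual[where g = g, OF n _ that(2)]) (rule lt1[OF that(1) _ that(3)])
  have focL: "avg n (\<lambda>i. (lL \<bullet> G i tL h) / (1 - lL \<bullet> g (x i) tL)) = 0"
  proof (rule SL.el_first_order[OF lL])
    fix \<theta> l assume \<theta>: "\<theta> \<in> ball t0 (s * \<tau>)" and l: "norm l < a * \<tau>" "avg n (\<lambda>i. (1 / (1 - l \<bullet> g (x i) \<theta>)) *\<^sub>R g (x i) \<theta>) = 0"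
    have "el_obj g x n \<theta> \<le> el_obj g x n tL" using maxL sub ball_sub \<theta> unfolding is_maximizer_def by blast
    then show "- avg n (\<lambda>i. ln (1 - l \<bullet> g (x i) \<theta>)) \<le> - avg n (\<lambda>i. ln (1 - lL \<bullet> g (x i) tL))"
      unfolding el_eq[OF l \<theta>] el_eq[OF lL SL.U(2)] by simp
  qed
  have \<rho>q: "a * \<tau> * q i \<le> 1/2" if "i < n" for i using a0 small(8) that by (intro scaled_q_le) auto
  have h2: "norm h \<le> 2 * (s * \<tau>)"
    using norm_triangle_ineq4[of "tE - t0" "tL - t0"] tE tL by (simp add: h_def)
  have "\<bar>avg n (\<lambda>i. (lM \<bullet> G i tE h) / (1 - lM \<bullet> g (x i) tE))\<bar> \<le> (4 + 7 * D' + 12 * K + (3 + 4 * D') * K / (\<kappa> / 2)) * K * (a * \<tau>) ^ 3 * norm h"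
    using lE lM a0 \<tau>(1) \<rho>q g_le[OF _ tER] G_le[OF _ tER] SE.curv[OF SE.U(2)]
    by (intro score_gap[OF \<kappa>2 _ _ _ _ _ _ _ _ _ _ \<mu> focE D']) auto
  then have gap: "\<bar>avg n (\<lambda>i. (lM \<bullet> G i tE h) / (1 - lM \<bullet> g (x i) tE))\<bar> \<le> C * (a * \<tau>) ^ 3 * norm h" unfolding C .
  have "c\<^sub>0 / 2 * (norm h)\<^sup>2 \<le> avg n (\<lambda>i. (lL \<bullet> G i tL h) / (1 - lL \<bullet> g (x i) tL)) - avg n (\<lambda>i. (lM \<bullet> G i tE h) / (1 - lM \<bullet> g (x i) tE))"
  proof (rule score_strong_mono[where v = "\<lambda>i. g (x i) tE" and v' = "\<lambda>i. g (x i) tL" and w = "\<lambda>i. G i tE h"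
        and w' = "\<lambda>i. G i tL h" and l = lM and l' = lL and H = "norm h" and D = D
        and \<gamma> = "\<gamma> / 2" and \<kappa> = "\<kappa> / 2" and \<rho> = "a * \<tau>"])
    show "D = 48 * K / (\<kappa> / 2)" "c\<^sub>0 = \<kappa> / 2 * (\<gamma> / 2)\<^sup>2 / (512 * K\<^sup>2)" by (fact D c0)+
    show "(norm (G i tE h - (g (x i) tE - g (x i) tL))) \<le> b i * (norm h)\<^sup>2" if "i < n" for i
    proof -
      \<comment> \<open>The Jacobian sits at \<open>tE\<close>, so the linearisation runs from
        \<open>tE\<close> to \<open>tL\<close>, in direction -h.\<close>
      have "G i tE (- h) = - G i tE h" by (rule linear_neg[OF has_derivative_linear[OF der[OF that tER]]])
      then show ?thesis using g_linearization[OF that tLR tER]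
        by (simp add: h_def norm_minus_commute) (simp add: algebra_simps)
    qed
    show "norm (g (x i) tE - g (x i) tL) \<le> p i * norm h" if "i < n" for i
      unfolding h_def by (rule g_diff_le[OF that tER tLR])
    show "norm (G i tE h - G i tL h) \<le> b i * (norm h)\<^sup>2" if "i < n" for i
      using G_lip[OF that tER tLR, of h] by (simp add: h_def power2_eq_square mult_ac)
    show "\<gamma> / 2 * norm h \<le> norm (avg n (\<lambda>i. g (x i) tE - g (x i) tL))"
      unfolding h_def
    proof (rule mean_diff_ge[OF tER tLR])
      have "K * (norm (tL - t0) + norm (tE - tL)) \<le> K * (3 * (s * \<tau>))"
        using tL h2 K1 unfolding h_def by (intro mult_left_mono) auto
      then show "K * (norm (tL - t0) + norm (tE - tL)) \<le> \<gamma> / 2" using small(3) by simp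
    qed
    have "0 \<le> D" unfolding D using K1 \<kappa> by simp
    then have "2 * D * K * norm h \<le> 2 * D * K * (2 * (s * \<tau>))" using h2 K1 by (intro mult_left_mono) auto
    then show "(6 + 8 * D) * K * (a * \<tau>) + 2 * D * K * norm h \<le> c\<^sub>0 / 2" using small(7) by (simp add: algebra_simps)
    show "12 * K * (a * \<tau>) \<le> \<gamma> / 2" using small(6) by simp
  qed (use \<kappa>2 SL.curv[OF SL.U(2)] a0 \<tau>(1) small(5) \<rho>q g_le[OF _ tER] g_le[OF _ tLR] G_le[OF _ tER] G_le[OF _ tLR] lM lL \<gamma> in auto)
  then have "c\<^sub>0 / 2 * (norm h)\<^sup>2 \<le> C * (a * \<tau>) ^ 3 * norm h" using gap focL by linarith
  then have "norm h * (c\<^sub>0 / 2 * norm h) \<le> norm h * (C * (a * \<tau>) ^ 3)" by (simp add: power2_eq_square mult_ac)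
  then have "c\<^sub>0 / 2 * norm h \<le> C * (a * \<tau>) ^ 3"
    using C0 a0 c0_pos \<tau>(1) by (cases "h = 0") auto
  then show ?thesis using c0_pos unfolding h_def by (simp add: field_simps power_mult_distrib)
qed

end

section \<open>Laws of large numbers and envelopes\<close>

text \<open>The properties in question involve maximisers and uncountable quantifiers, so their
  events need not be measurable; a measurable event inside is demanded instead. With \<epsilon> as a
  parameter, conjunction simply adds the error probabilities.\<close>

definition whp :: "'a measure \<Rightarrow> real \<Rightarrow> (nat \<Rightarrow> 'a \<Rightarrow> bool) \<Rightarrow> bool" where
  "whp M \<epsilon> Q \<longleftrightarrow> (\<forall>\<^sub>F n in sequentially. \<exists>A\<in>sets M. 1 - \<epsilon> \<le> measure M A \<and> (\<forall>\<omega>\<in>A. Q n \<omega>))"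

lemma whp_mono:
  assumes "whp M \<epsilon> Q" "\<epsilon> \<le> \<epsilon>'" "\<forall>\<^sub>F n in sequentially. \<forall>\<omega>. Q n \<omega> \<longrightarrow> Q' n \<omega>"
  shows "whp M \<epsilon>' Q'"
  using assms(1,3) unfolding whp_def
proof eventually_elim
  case (elim n)
  then obtain A where "A \<in> sets M" "1 - \<epsilon> \<le> measure M A" "\<forall>\<omega>\<in>A. Q n \<omega>" by auto
  then show ?case using elim(2) assms(2) by (intro bexI[of _ A]) auto
qed

lemma whp_imp:
  assumes "whp M \<epsilon> Q" "\<And>n \<omega>. Q n \<omega> \<Longrightarrow> Q' n \<omega>" "\<epsilon> = \<epsilon>'"
  shows "whp M \<epsilon>' Q'"
  by (rule whp_mono[OF assms(1)]) (use assms(2,3) in auto)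

context prob_space
begin

lemma whp_conj:
  assumes "whp M \<epsilon> Q" "whp M \<epsilon>' Q'"
  shows "whp M (\<epsilon> + \<epsilon>') (\<lambda>n \<omega>. Q n \<omega> \<and> Q' n \<omega>)"
  using assms unfolding whp_def
proof eventually_elim
  case (elim n)
  then obtain A B where A: "A \<in> sets M" "1 - \<epsilon> \<le> measure M A" "\<forall>\<omega>\<in>A. Q n \<omega>"
    and B: "B \<in> sets M" "1 - \<epsilon>' \<le> measure M B" "\<forall>\<omega>\<in>B. Q' n \<omega>" by auto
  have "measure M (A \<union> B) = measure M A + measure M (B - A)" using A B by (intro finite_measure_Union') auto
  moreover have "measure M (B - A) = measure M B - measure M (B \<inter> A)" using A B by (intro finite_measure_Diff') auto
  moreover have "measure M (A \<union> B) \<le> 1" by simp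
  ultimately have "1 - (\<epsilon> + \<epsilon>') \<le> measure M (B \<inter> A)" using A(2) B(2) by linarith
  then show ?case using A B by (intro bexI[of _ "B \<inter> A"]) auto
qed

lemma whp_compl:
  assumes "\<forall>\<^sub>F n in sequentially. {\<omega>\<in>space M. \<not> Q n \<omega>} \<in> sets M \<and> measure M {\<omega>\<in>space M. \<not> Q n \<omega>} \<le> \<epsilon>"
  shows "whp M \<epsilon> Q"
  using assms unfolding whp_def
proof eventually_elim
  case (elim n)
  then have "measure M (space M - {\<omega>\<in>space M. \<not> Q n \<omega>}) = 1 - measure M {\<omega>\<in>space M. \<not> Q n \<omega>}" by (intro prob_compl) auto
  then show ?case using elim by (intro bexI[of _ "space M - {\<omega>\<in>space M. \<not> Q n \<omega>}"]) auto
qed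

lemma whp_AE:
  assumes "AE \<omega> in M. Q \<omega>" "0 \<le> \<epsilon>"
  shows "whp M \<epsilon> (\<lambda>n. Q)"
proof -
  obtain N where N: "{\<omega>\<in>space M. \<not> Q \<omega>} \<subseteq> N" "emeasure M N = 0" "N \<in> sets M" using AE_E[OF assms(1)] .
  have "measure M (space M - N) = 1 - measure M N" using N by (intro prob_compl) auto
  then have "measure M (space M - N) = 1" using N(2) by (simp add: measure_def)
  then show ?thesis unfolding whp_def using N assms(2) by (intro always_eventually allI bexI[of _ "space M - N"]) auto
qed

lemma whp_ball_sum:
  assumes "finite I" "\<And>i. i \<in> I \<Longrightarrow> whp M (\<epsilon> i) (Q i)"
  shows "whp M (\<Sum>i\<in>I. \<epsilon> i) (\<lambda>n \<omega>. \<forall>i\<in>I. Q i n \<omega>)"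
  using assms
proof (induction I rule: finite_induct)
  case empty
  then show ?case using whp_AE[of "\<lambda>_. True" 0] by simp
next
  case (insert i I)
  have "whp M (\<epsilon> i + (\<Sum>i\<in>I. \<epsilon> i)) (\<lambda>n \<omega>. Q i n \<omega> \<and> (\<forall>i\<in>I. Q i n \<omega>))"
    using insert.prems by (intro whp_conj insert.IH) auto
  then show ?case using insert.hyps by simp
qed

lemma whp_finite:
  assumes "finite I" "\<And>i \<epsilon>. i \<in> I \<Longrightarrow> 0 < \<epsilon> \<Longrightarrow> whp M \<epsilon> (Q i)" "0 < \<epsilon>"
  shows "whp M \<epsilon> (\<lambda>n \<omega>. \<forall>i\<in>I. Q i n \<omega>)"
proof -
  \<comment> \<open>The extra 1 keeps the denominator positive when \<open>I\<close> is
    empty.\<close>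
  have "whp M (\<Sum>i\<in>I. \<epsilon> / (real (card I) + 1)) (\<lambda>n \<omega>. \<forall>i\<in>I. Q i n \<omega>)"
    using assms by (intro whp_ball_sum) auto
  then show ?thesis by (rule whp_mono) (use assms(3) in \<open>auto simp: field_simps\<close>)
qed

end

section \<open>Moment inequalities for averages of an i.i.d. sequence\<close>

locale iid_sample = prob_space M for M :: "'a measure" +
  fixes S :: "'b measure" and X :: "nat \<Rightarrow> 'a \<Rightarrow> 'b"
  assumes X_meas [measurable]: "\<And>i. X i \<in> measurable M S"
    and indep: "indep_vars (\<lambda>_. S) X UNIV"
    and dist: "\<And>i. distr M S (X i) = distr M S (X 0)"
begin

definition law :: "'b measure" where "law = distr M S (X 0)"

lemma sets_law [measurable_cong]: "sets law = sets S"
  by (simp add: law_def)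

lemma distr_X: "distr M S (X i) = law"
  unfolding law_def by (rule dist)

lemma borel_law: "borel_measurable law = (borel_measurable S :: ('b \<Rightarrow> 'v::topological_space) set)"
  by (rule measurable_cong_sets[OF sets_law refl])

lemma integrable_X:
  fixes f :: "'b \<Rightarrow> 'v::{banach, second_countable_topology}"
  assumes "integrable law f"
  shows "integrable M (\<lambda>\<omega>. f (X i \<omega>))" "(\<integral>\<omega>. f (X i \<omega>) \<partial>M) = integral\<^sup>L law f"
proof -
  have f: "f \<in> borel_measurable S" using borel_measurable_integrable[OF assms] by (simp add: borel_law)
  show "integrable M (\<lambda>\<omega>. f (X i \<omega>))"
    using integrable_distr[OF X_meas, of i f] assms by (simp add: distr_X)
  show "(\<integral>\<omega>. f (X i \<omega>) \<partial>M) = integral\<^sup>L law f"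
    using integral_distr[OF X_meas f, of i] by (simp add: distr_X)
qed

lemma AE_X:
  assumes "AE x in law. P x"
  shows "AE \<omega> in M. \<forall>i. P (X i \<omega>)"
proof -
  have "AE \<omega> in M. P (X i \<omega>)" for i
    by (rule AE_distrD[OF X_meas]) (unfold distr_X, rule assms)
  then show ?thesis by (simp add: AE_all_countable)
qed

lemma markov_avg:
  fixes f :: "'b \<Rightarrow> real"
  assumes f: "integrable law f" "\<And>x. 0 \<le> f x" and \<epsilon>: "0 < \<epsilon>" and K: "integral\<^sup>L law f / \<epsilon> \<le> K" "0 < K"
  shows "whp M \<epsilon> (\<lambda>n \<omega>. avg n (\<lambda>i. f (X i \<omega>)) \<le> K)"
proof (rule whp_compl, rule eventually_sequentiallyI[of 1], rule conjI)
  fix n :: nat assume n: "1 \<le> n"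
  let ?Y = "\<lambda>\<omega>. avg n (\<lambda>i. f (X i \<omega>))"
  have Y: "integrable M ?Y" unfolding avg_real using integrable_X(1)[OF f(1)] by auto
  then have [measurable]: "?Y \<in> borel_measurable M" by auto
  show "{\<omega> \<in> space M. \<not> ?Y \<omega> \<le> K} \<in> sets M" by measurable
  have EY: "(\<integral>\<omega>. ?Y \<omega> \<partial>M) = integral\<^sup>L law f"
    using n unfolding avg_real by (simp add: integrable_X[OF f(1)])
  have "measure M {\<omega>\<in>space M. \<not> ?Y \<omega> \<le> K} \<le> measure M {\<omega>\<in>space M. K \<le> ?Y \<omega>}"
    by (intro finite_measure_mono) auto
  also have "\<dots> \<le> integral\<^sup>L law f / K"
    unfolding EY[symmetric] using Y K f(2) by (intro integral_Markov_inequality_measure[of _ _ "{}"]) (auto intro!: avg_nonneg)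
  also have "\<dots> \<le> \<epsilon>" using K \<epsilon> by (simp add: field_simps)
  finally show "measure M {\<omega>\<in>space M. \<not> ?Y \<omega> \<le> K} \<le> \<epsilon>" .
qed

text \<open>After centring, products with distinct indices have mean zero by independence; of the
  n^2 terms of the expanded square only the n diagonal ones survive.\<close>

lemma second_moment_avg:
  fixes f :: "'b \<Rightarrow> real"
  assumes f: "integrable law f" and f2: "integrable law (\<lambda>x. (f x)\<^sup>2)" and n: "0 < n"
  defines "m \<equiv> integral\<^sup>L law f"
  shows "integrable M (\<lambda>\<omega>. (avg n (\<lambda>i. f (X i \<omega>)) - m)\<^sup>2)"
    and "(\<integral>\<omega>. (avg n (\<lambda>i. f (X i \<omega>)) - m)\<^sup>2 \<partial>M) = (\<integral>x. (f x - m)\<^sup>2 \<partial>law) / real n"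
proof -
  interpret L: prob_space law unfolding law_def by (rule prob_space_distr) simp
  define h where "h x = f x - m" for x
  have h: "integrable law h" unfolding h_def using f by simp
  have [measurable]: "h \<in> borel_measurable S" using borel_measurable_integrable[OF h] by (simp add: borel_law)
  have h2: "integrable law (\<lambda>x. (h x)\<^sup>2)" unfolding h_def power2_diff using f f2 by auto
  have Eh: "integral\<^sup>L law h = 0" unfolding h_def m_def using f by (simp add: L.prob_space)
  have prod: "integrable M (\<lambda>\<omega>. h (X i \<omega>) * h (X j \<omega>)) \<and>
      (\<integral>\<omega>. h (X i \<omega>) * h (X j \<omega>) \<partial>M) = (if i = j then (\<integral>x. (h x)\<^sup>2 \<partial>law) else 0)" for i j
  proof (cases "i = j")
    case True
    then show ?thesis using integrable_X[OF h2, of i] by (simp add: power2_eq_square)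
  next
    case False
    have "indep_vars (\<lambda>_. borel) (\<lambda>i \<omega>. h (X i \<omega>)) UNIV"
      by (rule indep_vars_compose2[OF indep]) simp
    then have ind: "indep_vars (\<lambda>_. borel) (\<lambda>i \<omega>. h (X i \<omega>)) {i, j}" by (rule indep_vars_subset) simp
    show ?thesis
      using indep_vars_lebesgue_integral[OF _ ind] indep_vars_integrable[OF _ ind] integrable_X[OF h] Eh False by simp
  qed
  have eq: "(avg n (\<lambda>i. f (X i \<omega>)) - m)\<^sup>2 = (1 / real n)\<^sup>2 * (\<Sum>i<n. \<Sum>j<n. h (X i \<omega>) * h (X j \<omega>))" for \<omega>
  proof -
    have "avg n (\<lambda>i. f (X i \<omega>)) - m = (1 / real n) * (\<Sum>i<n. h (X i \<omega>))"
      using n avg_diff[of n "\<lambda>i. f (X i \<omega>)" "\<lambda>i. m"] by (simp add: avg_const avg_real h_def)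
    then show ?thesis by (simp only: power_mult_distrib) (simp add: power2_eq_square sum_product)
  qed
  show "integrable M (\<lambda>\<omega>. (avg n (\<lambda>i. f (X i \<omega>)) - m)\<^sup>2)"
    unfolding eq using prod by (intro integrable_mult_right Bochner_Integration.integrable_sum) auto
  have "(\<integral>\<omega>. (avg n (\<lambda>i. f (X i \<omega>)) - m)\<^sup>2 \<partial>M) = (1 / real n)\<^sup>2 * (\<Sum>i<n. \<Sum>j<n. (if i = j then (\<integral>x. (h x)\<^sup>2 \<partial>law) else 0))"
    unfolding eq using prod by (simp add: Bochner_Integration.integral_sum)
  also have "\<dots> = (\<integral>x. (h x)\<^sup>2 \<partial>law) / real n"
    using n by (simp add: power2_eq_square)
  finally show "(\<integral>\<omega>. (avg n (\<lambda>i. f (X i \<omega>)) - m)\<^sup>2 \<partial>M) = (\<integral>x. (f x - m)\<^sup>2 \<partial>law) / real n"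
    by (simp add: h_def)
qed

lemma chebyshev_avg:
  fixes f :: "'b \<Rightarrow> real"
  assumes f: "integrable law f" and f2: "integrable law (\<lambda>x. (f x)\<^sup>2)" and n: "0 < n" and \<eta>: "0 < \<eta>"
  defines "m \<equiv> integral\<^sup>L law f"
  shows "{\<omega>\<in>space M. \<not> \<bar>avg n (\<lambda>i. f (X i \<omega>)) - m\<bar> \<le> \<eta>} \<in> sets M"
    and "measure M {\<omega>\<in>space M. \<not> \<bar>avg n (\<lambda>i. f (X i \<omega>)) - m\<bar> \<le> \<eta>} \<le> (\<integral>x. (f x - m)\<^sup>2 \<partial>law) / (real n * \<eta>\<^sup>2)"
proof -
  let ?Y = "\<lambda>\<omega>. avg n (\<lambda>i. f (X i \<omega>))"
  have "?Y \<in> borel_measurable M" unfolding avg_real using integrable_X(1)[OF f] by auto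
  note [measurable] = this
  show "{\<omega>\<in>space M. \<not> \<bar>?Y \<omega> - m\<bar> \<le> \<eta>} \<in> sets M" by measurable
  have "measure M {\<omega>\<in>space M. \<not> \<bar>?Y \<omega> - m\<bar> \<le> \<eta>} \<le> measure M {\<omega>\<in>space M. \<eta>\<^sup>2 \<le> (?Y \<omega> - m)\<^sup>2}"
  proof (intro finite_measure_mono subsetI)
    fix \<omega> assume "\<omega> \<in> {\<omega>\<in>space M. \<not> \<bar>?Y \<omega> - m\<bar> \<le> \<eta>}"
    then show "\<omega> \<in> {\<omega>\<in>space M. \<eta>\<^sup>2 \<le> (?Y \<omega> - m)\<^sup>2}"
      using power_mono[of \<eta> "\<bar>?Y \<omega> - m\<bar>" 2] \<eta> by auto
  qed measurable
  also have "\<dots> \<le> (\<integral>\<omega>. (?Y \<omega> - m)\<^sup>2 \<partial>M) / \<eta>\<^sup>2"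
    using \<eta> second_moment_avg(1)[OF f f2 n] unfolding m_def
    by (intro integral_Markov_inequality_measure[of _ _ "{}"]) auto
  also have "\<dots> = (\<integral>x. (f x - m)\<^sup>2 \<partial>law) / (real n * \<eta>\<^sup>2)"
    unfolding m_def second_moment_avg(2)[OF f f2 n] by simp
  finally show "measure M {\<omega>\<in>space M. \<not> \<bar>?Y \<omega> - m\<bar> \<le> \<eta>} \<le> (\<integral>x. (f x - m)\<^sup>2 \<partial>law) / (real n * \<eta>\<^sup>2)" .
qed

lemma lln_avg:
  fixes f :: "'b \<Rightarrow> real"
  assumes f: "integrable law f" and f2: "integrable law (\<lambda>x. (f x)\<^sup>2)" and \<eta>: "0 < \<eta>" and \<epsilon>: "0 < \<epsilon>"
  shows "whp M \<epsilon> (\<lambda>n \<omega>. \<bar>avg n (\<lambda>i. f (X i \<omega>)) - integral\<^sup>L law f\<bar> \<le> \<eta>)"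
proof (rule whp_compl)
  define v where "v = (\<integral>x. (f x - integral\<^sup>L law f)\<^sup>2 \<partial>law)"
  have v: "0 \<le> v" unfolding v_def by simp
  show "\<forall>\<^sub>F n in sequentially. {\<omega>\<in>space M. \<not> \<bar>avg n (\<lambda>i. f (X i \<omega>)) - integral\<^sup>L law f\<bar> \<le> \<eta>} \<in> sets M \<and>
      measure M {\<omega>\<in>space M. \<not> \<bar>avg n (\<lambda>i. f (X i \<omega>)) - integral\<^sup>L law f\<bar> \<le> \<eta>} \<le> \<epsilon>"
  proof (rule eventually_sequentiallyI[of "nat \<lceil>v / (\<epsilon> * \<eta>\<^sup>2)\<rceil> + 1"], rule conjI)
    fix n assume N: "nat \<lceil>v / (\<epsilon> * \<eta>\<^sup>2)\<rceil> + 1 \<le> n"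
    then have n: "0 < n" by simp
    show "{\<omega>\<in>space M. \<not> \<bar>avg n (\<lambda>i. f (X i \<omega>)) - integral\<^sup>L law f\<bar> \<le> \<eta>} \<in> sets M" by (rule chebyshev_avg(1)[OF f f2 n \<eta>])
    have "v / (\<epsilon> * \<eta>\<^sup>2) \<le> real n" using N by linarith
    then have "v / (real n * \<eta>\<^sup>2) \<le> \<epsilon>" using \<epsilon> \<eta> n by (simp add: field_simps)
    then show "measure M {\<omega>\<in>space M. \<not> \<bar>avg n (\<lambda>i. f (X i \<omega>)) - integral\<^sup>L law f\<bar> \<le> \<eta>} \<le> \<epsilon>"
      using chebyshev_avg(2)[OF f f2 n \<eta>] by (simp add: v_def)
  qed
qed

lemma root_n_avg:
  fixes f :: "'b \<Rightarrow> real"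
  assumes f: "integrable law f" and f2: "integrable law (\<lambda>x. (f x)\<^sup>2)" and \<epsilon>: "0 < \<epsilon>"
  obtains K where "whp M \<epsilon> (\<lambda>n \<omega>. \<bar>avg n (\<lambda>i. f (X i \<omega>)) - integral\<^sup>L law f\<bar> \<le> K * (1 / sqrt (real n)))"
proof -
  define v where "v = (\<integral>x. (f x - integral\<^sup>L law f)\<^sup>2 \<partial>law)"
  have v: "0 \<le> v" unfolding v_def by simp
  \<comment> \<open>Chebyshev asks for K^2 >= v/\<epsilon>. The added 1 ensures K >= 1, whence K^2
    >= K >= v/\<epsilon>.\<close>
  define K where "K = v / \<epsilon> + 1"
  have K: "1 \<le> K" using v \<epsilon> by (simp add: K_def)
  have "v \<le> \<epsilon> * K" using \<epsilon> by (simp add: K_def field_simps)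
  also have "\<dots> \<le> \<epsilon> * K\<^sup>2" using \<epsilon> K by (intro mult_left_mono) (auto simp: power2_eq_square)
  finally have vK: "v / K\<^sup>2 \<le> \<epsilon>" using K by (simp add: field_simps)
  have "whp M \<epsilon> (\<lambda>n \<omega>. \<bar>avg n (\<lambda>i. f (X i \<omega>)) - integral\<^sup>L law f\<bar> \<le> K * (1 / sqrt (real n)))"
  proof (rule whp_compl, rule eventually_sequentiallyI[of 1], rule conjI)
    fix n :: nat assume "1 \<le> n"
    then have n: "0 < n" by simp
    have \<eta>: "0 < K * (1 / sqrt (real n))" using K n by simp
    show "{\<omega>\<in>space M. \<not> \<bar>avg n (\<lambda>i. f (X i \<omega>)) - integral\<^sup>L law f\<bar> \<le> K * (1 / sqrt (real n))} \<in> sets M"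
      by (rule chebyshev_avg(1)[OF f f2 n \<eta>])
    have "real n * (K * (1 / sqrt (real n)))\<^sup>2 = K\<^sup>2" using n by (simp add: power_mult_distrib power_divide)
    then show "measure M {\<omega>\<in>space M. \<not> \<bar>avg n (\<lambda>i. f (X i \<omega>)) - integral\<^sup>L law f\<bar> \<le> K * (1 / sqrt (real n))} \<le> \<epsilon>"
      using chebyshev_avg(2)[OF f f2 n \<eta>] vK by (simp add: v_def)
  qed
  then show ?thesis by (rule that)
qed

end

section \<open>Frobenius norms and outer products\<close>

lemma norm_matrix_vector_le: "norm (A *v h) \<le> norm A * norm h" for A :: "real^'p^'g"
proof -
  have "norm (A *v h) \<le> L2_set (\<lambda>i. norm (A $ i) * norm h) UNIV"
    unfolding norm_vec_def[of "A *v h"]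
    by (intro L2_set_mono) (auto simp: matrix_vector_mul_component Cauchy_Schwarz_ineq2)
  also have "\<dots> = norm A * norm h" by (simp add: norm_vec_def[of A] flip: L2_set_left_distrib)
  finally show ?thesis .
qed

lemma norm_matrix_le_sum: "norm A \<le> (\<Sum>i\<in>UNIV. \<Sum>j\<in>UNIV. \<bar>A $ i $ j\<bar>)" for A :: "real^'p^'g"
proof -
  have "norm A \<le> (\<Sum>i\<in>UNIV. norm (A $ i))" unfolding norm_vec_def[of A] by (rule L2_set_le_sum) simp
  also have "\<dots> \<le> (\<Sum>i\<in>UNIV. \<Sum>j\<in>UNIV. \<bar>A $ i $ j\<bar>)" by (intro sum_mono norm_le_l1_cart)
  finally show ?thesis .
qed

lemma abs_entry_le_norm: "\<bar>A $ i $ j\<bar> \<le> norm A" for A :: "real^'p^'g"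
  by (rule order_trans[OF component_le_norm_cart Finite_Cartesian_Product.norm_nth_le])

lemma linear_matrix_vector_left: "linear (\<lambda>A :: real^'p^'g. A *v h)"
  by (rule linearI) (simp_all add: matrix_vector_mult_add_rdistrib scaleR_matrix_vector_assoc)

lemma avg_matrix_vector: "avg n A *v h = avg n (\<lambda>i. A i *v h)" for A :: "nat \<Rightarrow> real^'p^'g"
  unfolding avg_def linear_cmul[OF linear_matrix_vector_left] linear_sum[OF linear_matrix_vector_left] ..

lemma outer_mult: "outer y *v v = (y \<bullet> v) *\<^sub>R y"
  by (simp add: vec_eq_iff outer_def matrix_vector_mult_def inner_vec_def sum_distrib_left mult_ac)

lemma norm_outer: "norm (outer y) = (norm y)\<^sup>2"
proof -
  have "outer y $ i = y $ i *\<^sub>R y" for i by (simp add: outer_def vec_eq_iff)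
  then have "norm (outer y) = L2_set (\<lambda>i. norm (y $ i) * norm y) UNIV" by (simp add: norm_vec_def[of "outer y"])
  also have "\<dots> = norm y * norm y" by (simp add: norm_vec_def[of y] flip: L2_set_left_distrib)
  finally show ?thesis by (simp add: power2_eq_square)
qed

section \<open>Measurable envelopes and oscillation bounds\<close>

lemma dense_le:
  fixes f :: "'p::metric_space \<Rightarrow> real"
  assumes "continuous_on T f" "C \<subseteq> T" "T \<subseteq> closure C" "\<And>c. c \<in> C \<Longrightarrow> f c \<le> a" "\<theta> \<in> T"
  shows "f \<theta> \<le> a"
proof -
  obtain x where x: "\<And>n. x n \<in> C" "x \<longlonglongrightarrow> \<theta>" using assms(3,5) closure_sequential[of \<theta> C] by auto
  have "(\<lambda>n. f (x n)) \<longlonglongrightarrow> f \<theta>"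
    using assms(1,2,5) x unfolding continuous_on_sequentially by (auto simp: comp_def)
  then show ?thesis by (rule LIMSEQ_le_const2) (use assms(4) x in auto)
qed

text \<open>The supremum over \<open>T\<close> may fail to be measurable. Over a countable dense
  subset it is measurable with no larger integral, and by continuity it still dominates all of
  \<open>T\<close> almost everywhere.\<close>

lemma measurable_envelope:
  fixes f :: "'b \<Rightarrow> 'p::euclidean_space \<Rightarrow> real"
  assumes [measurable]: "\<And>\<theta>. (\<lambda>x. f x \<theta>) \<in> borel_measurable D" and cont: "AE x in D. continuous_on T (f x)"
    and nonneg: "\<And>x \<theta>. 0 \<le> f x \<theta>" and fin: "(\<integral>\<^sup>+ x. (SUP \<theta>\<in>T. ennreal (f x \<theta>)) \<partial>D) < \<infinity>"
  obtains Q where "integrable D Q" "\<And>x. 0 \<le> Q x" "AE x in D. \<forall>\<theta>\<in>T. f x \<theta> \<le> Q x"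
proof -
  obtain C where C: "countable C" "C \<subseteq> T" "T \<subseteq> closure C" using separable by blast
  define s where "s x = (SUP \<theta>\<in>C. ennreal (f x \<theta>))" for x
  have [measurable]: "s \<in> borel_measurable D" unfolding s_def using C(1) by measurable
  have "(\<integral>\<^sup>+ x. s x \<partial>D) \<le> (\<integral>\<^sup>+ x. (SUP \<theta>\<in>T. ennreal (f x \<theta>)) \<partial>D)"
    unfolding s_def using C(2) by (intro nn_integral_mono SUP_subset_mono) auto
  then have s: "(\<integral>\<^sup>+ x. s x \<partial>D) < \<infinity>" using fin by (rule le_less_trans)
  then have s_fin: "AE x in D. s x \<noteq> \<infinity>" by (intro nn_integral_PInf_AE) auto
  show ?thesis
  proof
    \<comment> \<open>\<open>enn2real\<close> sends infinity to 0; by \<open>s_fin\<close> this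
      happens only on a null set.\<close>
    show "integrable D (\<lambda>x. enn2real (s x))"
    proof (rule integrableI_nonneg)
      have "(\<integral>\<^sup>+ x. ennreal (enn2real (s x)) \<partial>D) \<le> (\<integral>\<^sup>+ x. s x \<partial>D)"
        by (intro nn_integral_mono) (simp add: ennreal_enn2real_if)
      then show "(\<integral>\<^sup>+ x. ennreal (enn2real (s x)) \<partial>D) < \<infinity>" using s by (rule le_less_trans)
    qed auto
    show "0 \<le> enn2real (s x)" for x by simp
    show "AE x in D. \<forall>\<theta>\<in>T. f x \<theta> \<le> enn2real (s x)"
      using cont s_fin
    proof eventually_elim
      case (elim x)
      have "f x c \<le> enn2real (s x)" if "c \<in> C" for c
      proof -
        have "ennreal (f x c) \<le> s x" unfolding s_def using that by (intro SUP_upper)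
        also have "\<dots> = ennreal (enn2real (s x))" using elim(2) by (simp add: ennreal_enn2real_if)
        finally show ?thesis by simp
      qed
      then show ?case using dense_le[OF elim(1) C(2,3)] by blast
    qed
  qed
qed

text \<open>The oscillation of g(x, .) on shrinking balls around \<open>t\<close> tends to 0 by
  continuity and is dominated by 2 u, so its integral tends to 0. As before, suprema are taken over
  a countable dense set.\<close>

lemma integrable_oscillation:
  fixes g :: "'b \<Rightarrow> 'p::euclidean_space \<Rightarrow> 'v::euclidean_space"
  assumes g[measurable]: "\<And>\<theta>. (\<lambda>x. g x \<theta>) \<in> borel_measurable D" and cont: "AE x in D. continuous_on \<Theta> (g x)"
    and u: "integrable D u" "AE x in D. \<forall>\<theta>\<in>\<Theta>. norm (g x \<theta>) \<le> u x" "\<And>x. 0 \<le> u x" and t: "t \<in> \<Theta>" and \<eta>: "0 < \<eta>"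
  obtains \<delta> h where "0 < \<delta>" "h \<in> borel_measurable D" "\<And>x. 0 \<le> h x" "integral\<^sup>L D h \<le> \<eta>" "AE x in D. h x \<le> 2 * u x"
    "AE x in D. \<forall>\<theta>\<in>\<Theta> \<inter> ball t \<delta>. norm (g x \<theta> - g x t) \<le> h x"
proof -
  obtain C where C: "countable C" "C \<subseteq> \<Theta>" "\<Theta> \<subseteq> closure C" using separable by blast
  have [measurable]: "u \<in> borel_measurable D" using u by auto
  define d where "d k = 1 / (real k + 1)" for k
  have d: "0 < d k" for k by (simp add: d_def)
  define s where "s k x = (SUP \<theta>\<in>C \<inter> ball t (d k). ennreal (norm (g x \<theta> - g x t)))" for k x
  have sm[measurable]: "s k \<in> borel_measurable D" for k unfolding s_def[abs_def]
    by (intro borel_measurable_SUP countable_Int1 C(1)) measurable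
  have s_le: "AE x in D. s k x \<le> ennreal (2 * u x)" for k
    using u(2)
  proof eventually_elim
    case (elim x)
    show ?case unfolding s_def
    proof (rule SUP_least, rule ennreal_leI)
      fix \<theta> assume "\<theta> \<in> C \<inter> ball t (d k)"
      then have "norm (g x \<theta>) \<le> u x" "norm (g x t) \<le> u x" using elim t C(2) by auto
      then show "norm (g x \<theta> - g x t) \<le> 2 * u x"
        using norm_triangle_ineq4[of "g x \<theta>" "g x t"] by linarith
    qed
  qed
  have "(\<lambda>k. \<integral>\<^sup>+x. s k x \<partial>D) \<longlonglongrightarrow> (\<integral>\<^sup>+x. 0 \<partial>D)"
  proof (rule nn_integral_dominated_convergence[where w = "\<lambda>x. ennreal (2 * u x)"])
    show "(\<integral>\<^sup>+ x. ennreal (2 * u x) \<partial>D) < \<infinity>"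
      using integrableD(2)[of D "\<lambda>x. 2 * u x"] u by (simp add: top.not_eq_extremum)
    show "AE x in D. (\<lambda>k. s k x) \<longlonglongrightarrow> 0"
      using cont
    proof eventually_elim
      case (elim x)
      show ?case
      proof (rule order_tendstoI)
        fix a :: ennreal assume a: "0 < a"
        obtain e where e: "0 < e" "ennreal e < a"
        proof (cases a)
          case (real r)
          then show ?thesis using that[of "r / 2"] a by (auto simp: ennreal_less_iff)
        next
          case top
          then show ?thesis using that[of 1] by simp
        qed
        obtain \<delta> where \<delta>: "0 < \<delta>" "\<And>\<theta>. \<theta> \<in> \<Theta> \<Longrightarrow> dist \<theta> t < \<delta> \<Longrightarrow> dist (g x \<theta>) (g x t) < e"
          using elim t e(1) unfolding continuous_on_iff by blast
        have "(\<lambda>k. d k) \<longlonglongrightarrow> 0" unfolding d_def using LIMSEQ_inverse_real_of_nat by (simp add: inverse_eq_divide add.commute)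
        then have "\<forall>\<^sub>F k in sequentially. d k < \<delta>" using \<delta>(1) by (rule order_tendstoD)
        then show "\<forall>\<^sub>F k in sequentially. s k x < a"
        proof eventually_elim
          case (elim k)
          have "s k x \<le> ennreal e" unfolding s_def
          proof (rule SUP_least, rule ennreal_leI)
            fix \<theta> assume "\<theta> \<in> C \<inter> ball t (d k)"
            then show "norm (g x \<theta> - g x t) \<le> e"
              using \<delta>(2)[of \<theta>] elim C(2) by (force simp: dist_norm norm_minus_commute)
          qed
          then show ?case using e(2) by simp
        qed
      qed simp
    qed
  qed (use s_le in auto)
  then have "\<forall>\<^sub>F k in sequentially. (\<integral>\<^sup>+x. s k x \<partial>D) < ennreal \<eta>"
    using \<eta> by (intro order_tendstoD) auto
  then obtain k where k: "(\<integral>\<^sup>+x. s k x \<partial>D) < ennreal \<eta>" by (auto dest: eventually_happens)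
  define h where "h x = enn2real (s k x)" for x
  have s_fin: "AE x in D. s k x = ennreal (h x)"
    using s_le[of k] by eventually_elim (simp add: h_def ennreal_enn2real_if neq_top_trans[OF ennreal_neq_top])
  show ?thesis
  proof
    show "0 < d k" by (rule d)
    show hm: "h \<in> borel_measurable D" unfolding h_def by measurable
    show "0 \<le> h x" for x by (simp add: h_def)
    have "(\<integral>\<^sup>+x. ennreal (h x) \<partial>D) \<le> ennreal \<eta>"
      using k nn_integral_cong_AE[OF s_fin] by simp
    then show "integral\<^sup>L D h \<le> \<eta>"
      using \<eta> hm by (subst integral_eq_nn_integral) (auto simp: h_def intro: enn2real_leI)
    show "AE x in D. h x \<le> 2 * u x"
      using s_le[of k] by eventually_elim (use u(3) in \<open>auto simp: h_def intro!: enn2real_leI\<close>)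
    show "AE x in D. \<forall>\<theta>\<in>\<Theta> \<inter> ball t (d k). norm (g x \<theta> - g x t) \<le> h x"
      using cont s_fin
    proof eventually_elim
      case (elim x)
      have c: "continuous_on (\<Theta> \<inter> ball t (d k)) (\<lambda>\<theta>. norm (g x \<theta> - g x t))"
        using elim(1) by (intro continuous_intros) (auto intro: continuous_on_subset)
      \<comment> \<open>Density survives the intersection because the ball is open.\<close>
      have cl: "\<Theta> \<inter> ball t (d k) \<subseteq> closure (C \<inter> ball t (d k))"
        using open_Int_closure_subset[of "ball t (d k)" C] C(3) by (auto simp: Int_commute)
      have "norm (g x \<theta> - g x t) \<le> h x" if "\<theta> \<in> C \<inter> ball t (d k)" for \<theta>
      proof -
        have "ennreal (norm (g x \<theta> - g x t)) \<le> s k x" unfolding s_def using that by (intro SUP_upper)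
        also note elim(2)
        finally show ?thesis using ennreal_le_iff[of "h x"] by (simp add: h_def)
      qed
      then show ?case using dense_le[OF c _ cl] C(2) by blast
    qed
  qed
qed

context iid_sample
begin

lemma prob_space_law: "prob_space law"
  unfolding law_def by (rule prob_space_distr) simp

text \<open>Project on the unit vector \<open>v\<close> along the mean at \<open>t\<close>, of norm
  \<open>a\<close>. With high probability the projected average at \<open>t\<close> is at least
  3a/4, and the averaged oscillation costs at most a/4 in expectation plus a/4 in deviation; a/4 is
  left on the whole ball.\<close>

lemma local_separation:
  fixes g :: "'b \<Rightarrow> 'p::euclidean_space \<Rightarrow> 'v::euclidean_space"
  assumes g[measurable]: "\<And>\<theta>. (\<lambda>x. g x \<theta>) \<in> borel_measurable S" and cont: "AE x in law. continuous_on \<Theta> (g x)"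
    and um[measurable]: "u \<in> borel_measurable S" and u2: "integrable law (\<lambda>x. (u x)\<^sup>2)"
    and u: "AE x in law. \<forall>\<theta>\<in>\<Theta>. norm (g x \<theta>) \<le> u x" "\<And>x. 0 \<le> u x"
    and t: "t \<in> \<Theta>" "integral\<^sup>L law (\<lambda>x. g x t) \<noteq> 0"
  shows "\<exists>\<delta>>0. \<exists>c>0. \<forall>\<epsilon>>0. whp M \<epsilon> (\<lambda>n \<omega>. \<forall>\<theta>\<in>\<Theta> \<inter> ball t \<delta>. c \<le> norm (avg n (\<lambda>i. g (X i \<omega>) \<theta>)))"
proof -
  interpret L: prob_space law by (rule prob_space_law)
  define m where "m = integral\<^sup>L law (\<lambda>x. g x t)"
  define v where "v = sgn m"
  define a where "a = norm m"
  have a: "0 < a" using t(2) by (simp add: a_def m_def)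
  have nv: "norm v = 1" using t(2) by (simp add: v_def m_def norm_sgn)
  have vm: "v \<bullet> m = a"
    using a by (simp add: v_def a_def sgn_div_norm power2_norm_eq_inner[symmetric] power2_eq_square)
  have u1: "integrable law u" by (rule L.square_integrable_imp_integrable[OF _ u2]) (simp add: borel_law)
  have gl: "(\<lambda>x. g x \<theta>) \<in> borel_measurable law" for \<theta> by (simp add: borel_law)
  have a4: "0 < a / 4" using a by simp
  obtain \<delta> h where h: "0 < \<delta>" "h \<in> borel_measurable law" "\<And>x. 0 \<le> h x" "integral\<^sup>L law h \<le> a / 4" "AE x in law. h x \<le> 2 * u x"
    "AE x in law. \<forall>\<theta>\<in>\<Theta> \<inter> ball t \<delta>. norm (g x \<theta> - g x t) \<le> h x"
    by (rule integrable_oscillation[of g law \<Theta> u t "a / 4", OF gl cont u1 u t(1) a4]) blast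
  have [measurable]: "h \<in> borel_measurable S" using h(2) by (simp add: borel_law)
  have h2: "integrable law (\<lambda>x. (h x)\<^sup>2)"
  proof (rule Bochner_Integration.integrable_bound)
    show "integrable law (\<lambda>x. 4 * (u x)\<^sup>2)" using u2 by simp
    show "AE x in law. norm ((h x)\<^sup>2) \<le> norm (4 * (u x)\<^sup>2)"
      using h(5)
    proof eventually_elim
      case (elim x)
      show ?case using power_mono[OF elim h(3), of 2] by (simp add: power_mult_distrib)
    qed
  qed measurable
  have h1: "integrable law h" using h(2) h2 by (rule L.square_integrable_imp_integrable)
  have g_le: "AE x in law. norm (g x t) \<le> u x" using u(1) by eventually_elim (rule bspec[OF _ t(1)])
  have g1: "integrable law (\<lambda>x. g x t)"
  proof (rule Bochner_Integration.integrable_bound[OF u1])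
    show "AE x in law. norm (g x t) \<le> norm (u x)"
      using g_le by eventually_elim (simp add: u(2))
  qed measurable
  have gv2: "integrable law (\<lambda>x. (v \<bullet> g x t)\<^sup>2)"
  proof (rule Bochner_Integration.integrable_bound[OF u2])
    show "AE x in law. norm ((v \<bullet> g x t)\<^sup>2) \<le> norm ((u x)\<^sup>2)"
      using g_le
    proof eventually_elim
      case (elim x)
      have "\<bar>v \<bullet> g x t\<bar> \<le> 1 * u x" using nv elim by (intro abs_inner_bound) auto
      then show ?case using power_mono[of "\<bar>v \<bullet> g x t\<bar>" "u x" 2] by simp
    qed
  qed measurable
  have gv1: "integrable law (\<lambda>x. v \<bullet> g x t)" and Egv: "(\<integral>x. v \<bullet> g x t \<partial>law) = a"
    using g1 vm by (auto simp: m_def)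
  show ?thesis
  proof (intro exI conjI allI impI)
    show "0 < \<delta>" "0 < a / 4" using h a by auto
    fix \<epsilon> :: real assume \<epsilon>: "0 < \<epsilon>"
    have "whp M (\<epsilon> / 3 + (\<epsilon> / 3 + \<epsilon> / 3)) (\<lambda>n \<omega>. \<bar>avg n (\<lambda>i. v \<bullet> g (X i \<omega>) t) - a\<bar> \<le> a / 4 \<and>
       (\<bar>avg n (\<lambda>i. h (X i \<omega>)) - integral\<^sup>L law h\<bar> \<le> a / 4 \<and> (\<forall>i. \<forall>\<theta>\<in>\<Theta> \<inter> ball t \<delta>. norm (g (X i \<omega>) \<theta> - g (X i \<omega>) t) \<le> h (X i \<omega>))))"
      using lln_avg[OF gv1 gv2, of "a / 4" "\<epsilon> / 3"] \<epsilon> a unfolding Egv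
      by (intro whp_conj lln_avg[OF h1 h2] whp_AE AE_X h(6)) auto
    then show "whp M \<epsilon> (\<lambda>n \<omega>. \<forall>\<theta>\<in>\<Theta> \<inter> ball t \<delta>. a / 4 \<le> norm (avg n (\<lambda>i. g (X i \<omega>) \<theta>)))"
    proof (rule whp_imp, intro ballI, elim conjE)
      fix n \<omega> \<theta>
      assume 1: "\<bar>avg n (\<lambda>i. v \<bullet> g (X i \<omega>) t) - a\<bar> \<le> a / 4"
        and 2: "\<bar>avg n (\<lambda>i. h (X i \<omega>)) - integral\<^sup>L law h\<bar> \<le> a / 4"
        and 3: "\<forall>i. \<forall>\<theta>\<in>\<Theta> \<inter> ball t \<delta>. norm (g (X i \<omega>) \<theta> - g (X i \<omega>) t) \<le> h (X i \<omega>)" and \<theta>: "\<theta> \<in> \<Theta> \<inter> ball t \<delta>"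
      have "avg n (\<lambda>i. v \<bullet> g (X i \<omega>) t) - avg n (\<lambda>i. h (X i \<omega>)) \<le> avg n (\<lambda>i. v \<bullet> g (X i \<omega>) \<theta>)"
        unfolding avg_diff[symmetric]
      proof (rule avg_mono)
        fix i
        have "\<bar>v \<bullet> (g (X i \<omega>) \<theta> - g (X i \<omega>) t)\<bar> \<le> 1 * h (X i \<omega>)" using nv 3 \<theta> by (intro abs_inner_bound) auto
        then show "v \<bullet> g (X i \<omega>) t - h (X i \<omega>) \<le> v \<bullet> g (X i \<omega>) \<theta>" by (simp add: inner_diff_right)
      qed
      also have "\<dots> \<le> norm (avg n (\<lambda>i. g (X i \<omega>) \<theta>))"
        using norm_cauchy_schwarz[of v "avg n (\<lambda>i. g (X i \<omega>) \<theta>)"] nv by (simp add: avg_inner_right)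
      finally show "a / 4 \<le> norm (avg n (\<lambda>i. g (X i \<omega>) \<theta>))" using 1 2 h(4) by linarith
    qed simp
  qed
qed

text \<open>Identification makes the mean nonzero at each point of the compact set of parameters at
  distance at least \<open>r\<close>; finitely many of the balls from
  \<open>local_separation\<close> cover it. The constant does not depend on \<epsilon>.\<close>

lemma separation:
  fixes g :: "'b \<Rightarrow> 'p::euclidean_space \<Rightarrow> 'v::euclidean_space"
  assumes g: "\<And>\<theta>. (\<lambda>x. g x \<theta>) \<in> borel_measurable S" and cont: "AE x in law. continuous_on \<Theta> (g x)"
    and u: "u \<in> borel_measurable S" "integrable law (\<lambda>x. (u x)\<^sup>2)"
      "AE x in law. \<forall>\<theta>\<in>\<Theta>. norm (g x \<theta>) \<le> u x" "\<And>x. 0 \<le> u x"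
    and \<Theta>: "compact \<Theta>" and ident: "\<And>\<theta>. \<theta> \<in> \<Theta> \<Longrightarrow> integral\<^sup>L law (\<lambda>x. g x \<theta>) = 0 \<Longrightarrow> \<theta> = t0" and r: "0 < r"
  obtains c where "0 < c" "\<And>\<epsilon>. 0 < \<epsilon> \<Longrightarrow> whp M \<epsilon> (\<lambda>n \<omega>. \<forall>\<theta>\<in>\<Theta>. r \<le> norm (\<theta> - t0) \<longrightarrow> c \<le> norm (avg n (\<lambda>i. g (X i \<omega>) \<theta>)))"
proof -
  define T where "T = \<Theta> - ball t0 r"
  have T: "compact T" unfolding T_def by (intro compact_diff \<Theta>) simp
  have "\<forall>t\<in>T. \<exists>\<delta>>0. \<exists>c>0. \<forall>\<epsilon>>0. whp M \<epsilon> (\<lambda>n \<omega>. \<forall>\<theta>\<in>\<Theta> \<inter> ball t \<delta>. c \<le> norm (avg n (\<lambda>i. g (X i \<omega>) \<theta>)))"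
    using r ident by (intro ballI local_separation[OF g cont u]) (auto simp: T_def)
  from bchoice[OF this] obtain \<delta> where \<delta>': "\<forall>t\<in>T. 0 < \<delta> t \<and> (\<exists>c>0. \<forall>\<epsilon>>0. whp M \<epsilon> (\<lambda>n \<omega>. \<forall>\<theta>\<in>\<Theta> \<inter> ball t (\<delta> t). c \<le> norm (avg n (\<lambda>i. g (X i \<omega>) \<theta>))))" ..
  then have \<delta>: "\<And>t. t \<in> T \<Longrightarrow> 0 < \<delta> t"
    and "\<forall>t\<in>T. \<exists>c>0. \<forall>\<epsilon>>0. whp M \<epsilon> (\<lambda>n \<omega>. \<forall>\<theta>\<in>\<Theta> \<inter> ball t (\<delta> t). c \<le> norm (avg n (\<lambda>i. g (X i \<omega>) \<theta>)))" by simp_all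
  from bchoice[OF this(2)] obtain c where c':
    "\<forall>t\<in>T. 0 < c t \<and> (\<forall>\<epsilon>>0. whp M \<epsilon> (\<lambda>n \<omega>. \<forall>\<theta>\<in>\<Theta> \<inter> ball t (\<delta> t). c t \<le> norm (avg n (\<lambda>i. g (X i \<omega>) \<theta>))))" ..
  then have c: "\<And>t. t \<in> T \<Longrightarrow> 0 < c t"
    and w: "\<And>t \<epsilon>. t \<in> T \<Longrightarrow> 0 < \<epsilon> \<Longrightarrow> whp M \<epsilon> (\<lambda>n \<omega>. \<forall>\<theta>\<in>\<Theta> \<inter> ball t (\<delta> t). c t \<le> norm (avg n (\<lambda>i. g (X i \<omega>) \<theta>)))"
    by simp_all
  have "T \<subseteq> (\<Union>t\<in>T. ball t (\<delta> t))" using \<delta> by force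
  then obtain T' where T': "T' \<subseteq> T" "finite T'" "T \<subseteq> (\<Union>t\<in>T'. ball t (\<delta> t))"
    using compactE_image[OF T, of T "\<lambda>t. ball t (\<delta> t)"] by auto
  \<comment> \<open>The element 1 makes the minimum meaningful when the cover is empty.\<close>
  define c' where "c' = Min (insert 1 (c ` T'))"
  have c': "0 < c'" "\<And>t. t \<in> T' \<Longrightarrow> c' \<le> c t" unfolding c'_def using T' c by auto
  show ?thesis
  proof (rule that[OF c'(1)])
    fix \<epsilon> :: real assume "0 < \<epsilon>"
    then have "whp M \<epsilon> (\<lambda>n \<omega>. \<forall>t\<in>T'. \<forall>\<theta>\<in>\<Theta> \<inter> ball t (\<delta> t). c t \<le> norm (avg n (\<lambda>i. g (X i \<omega>) \<theta>)))"
      by (intro whp_finite[OF T'(2)]) (use T'(1) w in blast)+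
    then show "whp M \<epsilon> (\<lambda>n \<omega>. \<forall>\<theta>\<in>\<Theta>. r \<le> norm (\<theta> - t0) \<longrightarrow> c' \<le> norm (avg n (\<lambda>i. g (X i \<omega>) \<theta>)))"
    proof (rule whp_imp, intro ballI impI)
      fix n \<omega> \<theta>
      assume A: "\<forall>t\<in>T'. \<forall>\<theta>\<in>\<Theta> \<inter> ball t (\<delta> t). c t \<le> norm (avg n (\<lambda>i. g (X i \<omega>) \<theta>))" and \<theta>: "\<theta> \<in> \<Theta>" "r \<le> norm (\<theta> - t0)"
      then have "\<theta> \<in> T" by (simp add: T_def dist_norm norm_minus_commute)
      then obtain t where "t \<in> T'" "\<theta> \<in> ball t (\<delta> t)" using T' by auto
      then show "c' \<le> norm (avg n (\<lambda>i. g (X i \<omega>) \<theta>))" using A \<theta> c'(2)[of t] by force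
    qed simp
  qed
qed

section \<open>Sample Jacobian and Gram matrix\<close>

lemma lln_matrix:
  fixes A :: "'b \<Rightarrow> real^'p^'g"
  assumes A[measurable]: "A \<in> borel_measurable S" and A2: "integrable law (\<lambda>x. (norm (A x))\<^sup>2)"
    and \<eta>: "0 < \<eta>" and \<epsilon>: "0 < \<epsilon>"
  shows "whp M \<epsilon> (\<lambda>n \<omega>. norm (avg n (\<lambda>i. A (X i \<omega>)) - integral\<^sup>L law A) \<le> \<eta>)"
proof -
  interpret L: prob_space law by (rule prob_space_law)
  have "integrable law (\<lambda>x. norm (A x))"
    by (rule L.square_integrable_imp_integrable[OF _ A2]) measurable
  then have A1: "integrable law A" by (simp add: integrable_norm_iff borel_law)
  have bl: "bounded_linear (\<lambda>A :: real^'p^'g. A $ j $ k)" for j k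
    by (rule bounded_linear_compose[OF bounded_linear_vec_nth bounded_linear_vec_nth])
  note e_int = integrable_bounded_linear[OF bl A1] and e_eq = integral_bounded_linear[OF bl A1]
  have [measurable]: "(\<lambda>x. A x $ j $ k) \<in> borel_measurable S" for j k
    by (rule measurable_compose[OF A borel_measurable_continuous_onI]) (intro continuous_intros)
  have e2_int: "integrable law (\<lambda>x. (A x $ j $ k)\<^sup>2)" for j k
  proof (rule Bochner_Integration.integrable_bound[OF A2])
    show "AE x in law. norm ((A x $ j $ k)\<^sup>2) \<le> norm ((norm (A x))\<^sup>2)"
      using power_mono[OF abs_entry_le_norm abs_ge_zero, where n = 2] by (intro always_eventually allI) simp
  qed measurable
  define N where "N = real (CARD('g) * CARD('p))"
  have N: "0 < \<eta> / N" using \<eta> by (simp add: N_def)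
  let ?B = "integral\<^sup>L law A"
  have "whp M \<epsilon> (\<lambda>n \<omega>. \<forall>z\<in>UNIV. \<bar>avg n (\<lambda>i. A (X i \<omega>) $ fst z $ snd z) - ?B $ fst z $ snd z\<bar> \<le> \<eta> / N)"
    using lln_avg[OF e_int e2_int N] unfolding e_eq by (intro whp_finite \<epsilon>) auto
  then show ?thesis
  proof (rule whp_imp)
    fix n \<omega>
    assume *: "\<forall>z\<in>UNIV. \<bar>avg n (\<lambda>i. A (X i \<omega>) $ fst z $ snd z) - ?B $ fst z $ snd z\<bar> \<le> \<eta> / N"
    let ?A = "avg n (\<lambda>i. A (X i \<omega>))"
    have "norm (?A - ?B) \<le> (\<Sum>j\<in>UNIV. \<Sum>k\<in>UNIV. \<bar>(?A - ?B) $ j $ k\<bar>)" by (rule norm_matrix_le_sum)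
    also have "\<dots> \<le> (\<Sum>j\<in>(UNIV::'g set). \<Sum>k\<in>(UNIV::'p set). \<eta> / N)"
    proof (intro sum_mono)
      fix j :: 'g and k :: 'p
      show "\<bar>(?A - ?B) $ j $ k\<bar> \<le> \<eta> / N" using bspec[OF *, of "(j, k)"] by (simp add: avg_def)
    qed
    also have "\<dots> = \<eta>" by (simp add: N_def)
    finally show "norm (?A - ?B) \<le> \<eta>" .
  qed simp
qed

text \<open>Full column rank bounds the population Jacobian below by some a > 0; a perturbation of
  Frobenius norm at most a/2 leaves half of this.\<close>

lemma jacobian_bounded_below:
  fixes A :: "'b \<Rightarrow> real^'p^'g"
  assumes A: "A \<in> borel_measurable S" "integrable law (\<lambda>x. (norm (A x))\<^sup>2)"
    and rank: "rank (integral\<^sup>L law A) = CARD('p)"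
  obtains \<gamma> where "0 < \<gamma>" "\<And>\<epsilon>. 0 < \<epsilon> \<Longrightarrow> whp M \<epsilon> (\<lambda>n \<omega>. \<forall>h. \<gamma> * norm h \<le> norm (avg n (\<lambda>i. A (X i \<omega>) *v h)))"
proof -
  let ?B = "integral\<^sup>L law A"
  have "inj ((*v) ?B)" using rank by (simp add: full_rank_injective)
  then obtain a where a: "0 < a" "\<And>h. a * norm h \<le> norm (?B *v h)"
    using linear_inj_bounded_below_pos[OF matrix_vector_mul_linear] by blast
  show ?thesis
  proof
    show a2: "0 < a / 2" using a by simp
    fix \<epsilon> :: real assume \<epsilon>: "0 < \<epsilon>"
    from lln_matrix[OF A a2 \<epsilon>]
    show "whp M \<epsilon> (\<lambda>n \<omega>. \<forall>h. a / 2 * norm h \<le> norm (avg n (\<lambda>i. A (X i \<omega>) *v h)))"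
    proof (rule whp_imp, intro allI)
      fix n \<omega> and h :: "real^'p"
      let ?A = "avg n (\<lambda>i. A (X i \<omega>))"
      assume "norm (?A - ?B) \<le> a / 2"
      then have "norm ((?A - ?B) *v h) \<le> a / 2 * norm h"
        by (intro order_trans[OF norm_matrix_vector_le] mult_right_mono) auto
      moreover have "norm (?B *v h) \<le> norm (?A *v h) + norm ((?A - ?B) *v h)"
        using norm_triangle_ineq4[of "?A *v h" "(?A - ?B) *v h"] by (simp add: matrix_vector_mult_diff_rdistrib)
      ultimately show "a / 2 * norm h \<le> norm (avg n (\<lambda>i. A (X i \<omega>) *v h))"
        using a(2)[of h] by (simp add: avg_matrix_vector)
    qed simp
  qed
qed

text \<open>The quadratic form of \<Omega> attains a positive minimum on the unit sphere. The law of
  large numbers is applied to \<open>outer (f x)\<close>, whose squared norm is the fourth power of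
  the norm of \<open>f x\<close>.\<close>

lemma gram_bounded_below:
  fixes f :: "'b \<Rightarrow> real^'g"
  assumes f[measurable]: "f \<in> borel_measurable S" and f4: "integrable law (\<lambda>x. norm (f x) ^ 4)"
    and int: "integrable law (\<lambda>x. outer (f x))" and inv: "invertible (integral\<^sup>L law (\<lambda>x. outer (f x)))"
  obtains \<kappa> where "0 < \<kappa>" "\<And>\<epsilon>. 0 < \<epsilon> \<Longrightarrow> whp M \<epsilon> (\<lambda>n \<omega>. \<forall>v. \<kappa> * (norm v)\<^sup>2 \<le> avg n (\<lambda>i. (v \<bullet> f (X i \<omega>))\<^sup>2))"
proof -
  define \<Omega> where "\<Omega> = integral\<^sup>L law (\<lambda>x. outer (f x))"
  define F where "F v = v \<bullet> (\<Omega> *v v)" for v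
  have bl: "bounded_linear (\<lambda>A :: real^'g^'g. A *v v)" for v
    by (rule linear_conv_bounded_linear[THEN iffD1, OF linear_matrix_vector_left])
  have \<Omega>v: "\<Omega> *v v = (\<integral>x. (f x \<bullet> v) *\<^sub>R f x \<partial>law)" and \<Omega>v_int: "integrable law (\<lambda>x. (f x \<bullet> v) *\<^sub>R f x)" for v
    using integral_bounded_linear[OF bl int] integrable_bounded_linear[OF bl int] by (simp_all add: \<Omega>_def outer_mult)
  have F_eq: "F v = (\<integral>x. (v \<bullet> f x)\<^sup>2 \<partial>law)" and F_int: "integrable law (\<lambda>x. (v \<bullet> f x)\<^sup>2)" for v
    using integral_inner_right[OF \<Omega>v_int, of v v] integrable_inner_right[OF \<Omega>v_int, of v v]
    by (simp_all add: F_def \<Omega>v power2_eq_square inner_commute)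
  have F_pos: "0 < F v" if "v \<noteq> 0" for v
  proof -
    \<comment> \<open>Positive definiteness from invertibility: if the form vanishes at v then v . f
      = 0 almost everywhere, hence \<Omega> v = 0.\<close>
    have "F v \<noteq> 0"
    proof
      assume "F v = 0"
      then have "AE x in law. (v \<bullet> f x)\<^sup>2 = 0"
        using F_int[of v] unfolding F_eq by (subst (asm) integral_nonneg_eq_0_iff_AE) auto
      then have "AE x in law. (f x \<bullet> v) *\<^sub>R f x = 0" by eventually_elim (simp add: inner_commute)
      then have "\<Omega> *v v = 0" unfolding \<Omega>v by (rule integral_eq_zero_AE)
      then show False using inv that matrix_left_invertible_ker[of \<Omega>] unfolding \<Omega>_def invertible_def by blast
    qed
    moreover have "0 \<le> F v" unfolding F_eq by simp
    ultimately show ?thesis by simp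
  qed
  have "continuous_on (sphere 0 1) F" unfolding F_def by (intro continuous_intros)
  moreover have "sphere (0 :: real^'g) 1 \<noteq> {}" by simp
  ultimately obtain v0 where v0: "v0 \<in> sphere 0 1" "\<And>v. v \<in> sphere 0 1 \<Longrightarrow> F v0 \<le> F v"
    using continuous_attains_inf[of "sphere 0 1" F] compact_sphere by metis
  define a where "a = F v0"
  have a: "0 < a" unfolding a_def using v0(1) by (intro F_pos) auto
  have F_ge: "a * (norm v)\<^sup>2 \<le> F v" for v
  proof (cases "v = 0")
    case False
    have "a \<le> F (v /\<^sub>R norm v)" unfolding a_def using False by (intro v0(2)) simp
    also have "\<dots> = F v / (norm v)\<^sup>2"
      unfolding F_def by (simp add: matrix_vector_mult_scaleR power2_eq_square divide_simps)
    finally show ?thesis using False by (simp add: field_simps)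
  qed (simp add: F_def)
  have [measurable]: "(\<lambda>x. outer (f x)) \<in> borel_measurable S"
    using borel_measurable_integrable[OF int] by (simp add: borel_law)
  have o2: "integrable law (\<lambda>x. (norm (outer (f x)))\<^sup>2)"
    using f4 by (simp add: norm_outer flip: power_mult)
  show ?thesis
  proof
    show a2: "0 < a / 2" using a by simp
    fix \<epsilon> :: real assume \<epsilon>: "0 < \<epsilon>"
    from lln_matrix[OF _ o2 a2 \<epsilon>, folded \<Omega>_def]
    have "whp M \<epsilon> (\<lambda>n \<omega>. norm (avg n (\<lambda>i. outer (f (X i \<omega>))) - \<Omega>) \<le> a / 2)" by simp
    then show "whp M \<epsilon> (\<lambda>n \<omega>. \<forall>v. a / 2 * (norm v)\<^sup>2 \<le> avg n (\<lambda>i. (v \<bullet> f (X i \<omega>))\<^sup>2))"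
    proof (rule whp_imp, intro allI)
      fix n \<omega> and v :: "real^'g"
      let ?A = "avg n (\<lambda>i. outer (f (X i \<omega>)))"
      assume "norm (?A - \<Omega>) \<le> a / 2"
      then have "norm ((?A - \<Omega>) *v v) \<le> a / 2 * norm v"
        by (intro order_trans[OF norm_matrix_vector_le] mult_right_mono) auto
      then have "\<bar>v \<bullet> ((?A - \<Omega>) *v v)\<bar> \<le> norm v * (a / 2 * norm v)" by (intro abs_inner_bound) auto
      moreover have "v \<bullet> ((?A - \<Omega>) *v v) = avg n (\<lambda>i. (v \<bullet> f (X i \<omega>))\<^sup>2) - F v"
        by (simp add: F_def matrix_vector_mult_diff_rdistrib inner_diff_right avg_matrix_vector avg_inner_right
            outer_mult power2_eq_square inner_commute)
      moreover have "norm v * (a / 2 * norm v) + a / 2 * (norm v)\<^sup>2 = a * (norm v)\<^sup>2" by (simp add: power2_eq_square)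
      ultimately show "a / 2 * (norm v)\<^sup>2 \<le> avg n (\<lambda>i. (v \<bullet> f (X i \<omega>))\<^sup>2)"
        using F_ge[of v] by linarith
    qed simp
  qed
qed

end

section \<open>The rate of the difference\<close>

text \<open>The order of quantifiers is the point: \<open>C\<close> and the threshold for n come
  from the five constants alone, before any sample is given, so they serve every good outcome at
  once.\<close>

lemma good_sample_rate:
  fixes K \<kappa> \<gamma> R c :: real
  assumes pos: "0 < K" "0 < \<kappa>" "0 < \<gamma>" "0 < R" "0 < c"
  shows "\<exists>C. \<forall>\<^sub>F n in sequentially. \<forall>q p b e (g :: 'b \<Rightarrow> real^'p \<Rightarrow> real^'g) x G u \<Theta> t0 r tE tL.
    good_sample n q p b e K g x G u \<Theta> t0 R r c \<kappa> \<gamma> \<longrightarrow> is_maximizer (etel_obj g x n) \<Theta> tE \<longrightarrow>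
    is_maximizer (el_obj g x n) \<Theta> tL \<longrightarrow> norm (tE - tL) \<le> C * (1 / sqrt (real n)) ^ 3"
    (is "\<exists>C. eventually (?P C) sequentially")
proof -
  define V where "V = 9 * K\<^sup>2 / \<kappa>"
  define s where "s = 2 * (8 * K * V + 1 + K) / \<gamma> + 1"
  define a where "a = 17 * (K + K * s) / \<kappa>"
  define D where "D = 48 * K / (\<kappa> / 2)"
  define c\<^sub>0 where "c\<^sub>0 = \<kappa> / 2 * (\<gamma> / 2)\<^sup>2 / (512 * K\<^sup>2)"
  define D' where "D' = 6 * K / (\<kappa> / 2)"
  define C where "C = (4 + 7 * D' + 12 * K + (3 + 4 * D') * K / (\<kappa> / 2)) * K"
  define \<tau> where "\<tau> n = 1 / sqrt (real n)" for n
  have c0: "0 < c\<^sub>0 / 2" unfolding c\<^sub>0_def using pos by simp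
  have "filterlim (\<lambda>n. sqrt (real n)) at_top sequentially"
    by (rule filterlim_compose[OF sqrt_at_top filterlim_real_sequentially])
  then have lim: "\<tau> \<longlonglongrightarrow> 0"
    unfolding \<tau>_def[abs_def] by (intro tendsto_divide_0[OF tendsto_const] filterlim_at_top_imp_at_infinity)
  have ev: "\<forall>\<^sub>F n in sequentially. A * \<tau> n < B" if "0 < B" for A B
    by (rule order_tendstoD(2)[OF tendsto_mult_right_zero[OF lim] that])
  have ev2: "\<forall>\<^sub>F n in sequentially. A * (\<tau> n)\<^sup>2 < 1" for A
    by (rule order_tendstoD(2)[OF tendsto_mult_right_zero]) (use tendsto_power[OF lim, of 2] in auto)
  show ?thesis
  proof (intro exI[of _ "2 * C * a ^ 3 / c\<^sub>0"])
    show "eventually (?P (2 * C * a ^ 3 / c\<^sub>0)) sequentially"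
      using ev[OF \<open>0 < R\<close>, of s] ev[OF \<open>0 < \<kappa>\<close>, of "4 * K * s"] ev[OF \<open>0 < \<gamma>\<close>, of "6 * K * s"]
        ev[OF \<open>0 < c\<close>, of "8 * K * V + 1"] ev[of 1 a, simplified] ev[OF \<open>0 < \<gamma>\<close>, of "24 * K * a"]
        ev[OF c0, of "(6 + 8 * D) * K * a + 4 * D * K * s"] ev2[of "16 * a ^ 4 * K"]
    proof eventually_elim
      case (elim n)
      show ?case
      proof (intro allI impI)
        fix q p b e x G u \<Theta> t0 r tE tL and g :: "'b \<Rightarrow> real^'p \<Rightarrow> real^'g"
        assume gs: "good_sample n q p b e K g x G u \<Theta> t0 R r c \<kappa> \<gamma>"
          and max: "is_maximizer (etel_obj g x n) \<Theta> tE" "is_maximizer (el_obj g x n) \<Theta> tL"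
        have \<tau>: "good_sample.\<tau> n = \<tau> n" by (simp add: good_sample.\<tau>_def[OF gs] \<tau>_def)
        show "norm (tE - tL) \<le> 2 * C * a ^ 3 / c\<^sub>0 * (1 / sqrt (real n)) ^ 3"
          using good_sample.estimators_close[OF gs V_def s_def a_def D_def c\<^sub>0_def D'_def C_def, unfolded \<tau>,
              OF less_imp_le[OF elim(1)] less_imp_le[OF elim(2)] less_imp_le[OF elim(3)] elim(4) less_imp_le[OF elim(5)]
                less_imp_le[OF elim(6)] less_imp_le[OF elim(7)] less_imp_le[OF elim(8)] max]
          by (simp add: \<tau>_def)
      qed
    qed
  qed
qed

lemma (in iid_sample) root_n_avg_vec:
  fixes f :: "'b \<Rightarrow> real^'g"
  assumes f[measurable]: "f \<in> borel_measurable S" and f2: "integrable law (\<lambda>x. (norm (f x))\<^sup>2)"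
    and mean: "integral\<^sup>L law f = 0" and \<epsilon>: "0 < \<epsilon>"
  obtains K where "whp M \<epsilon> (\<lambda>n \<omega>. norm (avg n (\<lambda>i. f (X i \<omega>))) \<le> K * (1 / sqrt (real n)))"
proof -
  interpret L: prob_space law by (rule prob_space_law)
  have "integrable law (\<lambda>x. norm (f x))"
    by (rule L.square_integrable_imp_integrable[OF _ f2]) measurable
  then have f1: "integrable law f" by (simp add: integrable_norm_iff borel_law)
  have e1: "integrable law (\<lambda>x. f x $ j)" and Ee: "(\<integral>x. f x $ j \<partial>law) = 0" for j
    using integrable_bounded_linear[OF bounded_linear_vec_nth f1] integral_bounded_linear[OF bounded_linear_vec_nth f1, of j] mean by auto
  have [measurable]: "(\<lambda>x. f x $ j) \<in> borel_measurable S" for j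
    by (rule measurable_compose[OF f borel_measurable_continuous_onI]) (intro continuous_intros)
  have e2: "integrable law (\<lambda>x. (f x $ j)\<^sup>2)" for j
  proof (rule Bochner_Integration.integrable_bound[OF f2])
    show "AE x in law. norm ((f x $ j)\<^sup>2) \<le> norm ((norm (f x))\<^sup>2)"
      using power_mono[OF component_le_norm_cart abs_ge_zero, where n = 2] by (intro always_eventually allI) simp
  qed measurable
  have N: "0 < \<epsilon> / real CARD('g)" using \<epsilon> by simp
  have "\<forall>j. \<exists>K. whp M (\<epsilon> / real CARD('g)) (\<lambda>n \<omega>. \<bar>avg n (\<lambda>i. f (X i \<omega>) $ j)\<bar> \<le> K * (1 / sqrt (real n)))"
    using root_n_avg[OF e1 e2 N] unfolding Ee diff_zero by blast
  then obtain K where K: "\<And>j. whp M (\<epsilon> / real CARD('g)) (\<lambda>n \<omega>. \<bar>avg n (\<lambda>i. f (X i \<omega>) $ j)\<bar> \<le> K j * (1 / sqrt (real n)))"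
    using choice[of "\<lambda>j K. whp M (\<epsilon> / real CARD('g)) (\<lambda>n \<omega>. \<bar>avg n (\<lambda>i. f (X i \<omega>) $ j)\<bar> \<le> K * (1 / sqrt (real n)))"] by blast
  have "whp M (\<Sum>j\<in>(UNIV::'g set). \<epsilon> / real CARD('g)) (\<lambda>n \<omega>. \<forall>j\<in>UNIV. \<bar>avg n (\<lambda>i. f (X i \<omega>) $ j)\<bar> \<le> K j * (1 / sqrt (real n)))"
    by (rule whp_ball_sum[OF finite K])
  then have "whp M \<epsilon> (\<lambda>n \<omega>. norm (avg n (\<lambda>i. f (X i \<omega>))) \<le> (\<Sum>j\<in>UNIV. K j) * (1 / sqrt (real n)))"
  proof (rule whp_imp)
    fix n \<omega> assume *: "\<forall>j\<in>UNIV. \<bar>avg n (\<lambda>i. f (X i \<omega>) $ j)\<bar> \<le> K j * (1 / sqrt (real n))"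
    have "norm (avg n (\<lambda>i. f (X i \<omega>))) \<le> (\<Sum>j\<in>UNIV. \<bar>avg n (\<lambda>i. f (X i \<omega>)) $ j\<bar>)" by (rule norm_le_l1_cart)
    also have "\<dots> = (\<Sum>j\<in>UNIV. \<bar>avg n (\<lambda>i. f (X i \<omega>) $ j)\<bar>)" by (simp add: avg_def)
    also have "\<dots> \<le> (\<Sum>j\<in>UNIV. K j * (1 / sqrt (real n)))" using * by (intro sum_mono) auto
    finally show "norm (avg n (\<lambda>i. f (X i \<omega>))) \<le> (\<Sum>j\<in>UNIV. K j) * (1 / sqrt (real n))" by (simp only: sum_distrib_right)
  qed simp
  then show ?thesis by (rule that)
qed

text \<open>Converts the envelope of order 2 + \<delta> into one for the square, which is where
  \<open>u\<close> gets its second moment.\<close>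

lemma square_le_one_plus_powr: "y\<^sup>2 \<le> 1 + y powr (2 + \<delta>)" if "0 \<le> y" "0 < \<delta>" for y \<delta> :: real
proof (cases "y \<le> 1")
  case True
  have "y\<^sup>2 \<le> 1" using True that by (simp add: power_le_one)
  moreover have "0 \<le> y powr (2 + \<delta>)" by simp
  ultimately show ?thesis by linarith
next
  case False
  then have "y\<^sup>2 = y powr 2" by simp
  also have "\<dots> \<le> y powr (2 + \<delta>)" using False that by (intro powr_mono) auto
  finally show ?thesis by simp
qed

theorem theorem5:
  fixes M :: "'a measure" and S :: "'b measure"
    and X :: "nat \<Rightarrow> 'a \<Rightarrow> 'b"
    and g :: "'b \<Rightarrow> real^'p \<Rightarrow> real^'g"
    and G :: "'b \<Rightarrow> real^'p \<Rightarrow> real^'p^'g"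
    and b :: "'b \<Rightarrow> real"
    and \<Theta> \<N> :: "(real^'p) set" and \<theta>0 :: "real^'p" and \<delta> :: real
    and tE tL :: "nat \<Rightarrow> 'a \<Rightarrow> real^'p"
  defines "D \<equiv> distr M S (X 0)"
  assumes P: "prob_space M"
    and X_meas: "\<And>i. X i \<in> measurable M S"
    and iid_indep: "prob_space.indep_vars M (\<lambda>_. S) X UNIV"
    and iid_dist: "\<And>i. distr M S (X i) = distr M S (X 0)"
    and g_meas: "\<And>\<theta>. (\<lambda>x. g x \<theta>) \<in> borel_measurable S"
    and G_meas: "\<And>\<theta>. (\<lambda>x. G x \<theta>) \<in> borel_measurable S"
    and Theta_compact: "compact \<Theta>"
    and theta0_int: "\<theta>0 \<in> interior \<Theta>"
    and moment0: "integral\<^sup>L D (\<lambda>x. g x \<theta>0) = 0"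
    and ident: "\<And>\<theta>. \<theta> \<in> \<Theta> \<Longrightarrow> integral\<^sup>L D (\<lambda>x. g x \<theta>) = 0 \<Longrightarrow> \<theta> = \<theta>0"
    and g_cont: "AE x in D. continuous_on \<Theta> (g x)"
    and delta_pos: "\<delta> > 0"
    and g_mom: "(\<integral>\<^sup>+ x. (SUP \<theta>\<in>\<Theta>. ennreal (norm (g x \<theta>) powr (2 + \<delta>))) \<partial>D) < \<infinity>"
    and G_mom: "(\<integral>\<^sup>+ x. (SUP \<theta>\<in>\<N>. ennreal (norm (G x \<theta>))) \<partial>D) < \<infinity>"
    and Omega_fin: "integrable D (\<lambda>x. outer (g x \<theta>0))"
    and Omega_nonsing: "invertible (integral\<^sup>L D (\<lambda>x. outer (g x \<theta>0)))"
    and G_rank: "rank (integral\<^sup>L D (\<lambda>x. G x \<theta>0)) = CARD('p)"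
    and N_open: "open \<N>" and theta0_N: "\<theta>0 \<in> \<N>"
    and g_C1: "AE x in D. (\<forall>\<theta>\<in>\<N>. (g x has_derivative (\<lambda>h. G x \<theta> *v h)) (at \<theta>))
                          \<and> continuous_on \<N> (G x)"
    and g_mom4: "(\<integral>\<^sup>+ x. (SUP \<theta>\<in>\<N>. ennreal (norm (g x \<theta>) ^ 4)) \<partial>D) < \<infinity>"
    and G_mom2: "(\<integral>\<^sup>+ x. (SUP \<theta>\<in>\<N>. ennreal (norm (G x \<theta>) ^ 2)) \<partial>D) < \<infinity>"
    and G_lip: "AE x in D. \<forall>\<theta>\<in>\<N>. \<forall>\<theta>'\<in>\<N>. norm (G x \<theta> - G x \<theta>') \<le> b x * norm (\<theta> - \<theta>')"
    and b_int: "integrable D b"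
    and tE_meas: "\<And>n. tE n \<in> borel_measurable M"
    and tL_meas: "\<And>n. tL n \<in> borel_measurable M"
    and estimators: "\<And>\<epsilon>. \<epsilon> > 0 \<Longrightarrow> \<forall>\<^sub>F n in sequentially. \<exists>A\<in>sets M. measure M A \<ge> 1 - \<epsilon> \<and>
          (\<forall>\<omega>\<in>A. is_maximizer (etel_obj g (\<lambda>i. X i \<omega>) n) \<Theta> (tE n \<omega>)
                 \<and> is_maximizer (el_obj g (\<lambda>i. X i \<omega>) n) \<Theta> (tL n \<omega>))"
  shows "bigOp M (\<lambda>n \<omega>. norm (tE n \<omega> - tL n \<omega>)) (\<lambda>n. real n powr (-3/2))"
proof -
  interpret iid_sample M S X
    using P X_meas iid_indep iid_dist by (intro iid_sample.intro iid_sample_axioms.intro)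
  have D: "D = law" by (simp add: D_def law_def)
  interpret L: prob_space law by (rule prob_space_law)
  note [measurable] = g_meas G_meas

  obtain R where R: "0 < R" "cball \<theta>0 R \<subseteq> interior \<Theta> \<inter> \<N>"
    using open_contains_cball[of "interior \<Theta> \<inter> \<N>"] N_open theta0_N theta0_int by blast
  \<comment> \<open>A closed ball is convex, as the mean value estimates require, and lies in both
    \<Theta> and \<N>, so global continuity and local smoothness hold on it together.\<close>
  define B where "B = cball \<theta>0 R"
  have B\<N>: "B \<subseteq> \<N>" and B\<Theta>: "B \<subseteq> \<Theta>" and \<theta>0B: "\<theta>0 \<in> B"
    using R interior_subset[of \<Theta>] by (auto simp: B_def)

  obtain Qu where Qu: "integrable law Qu" "\<And>x. 0 \<le> Qu x" "AE x in law. \<forall>\<theta>\<in>\<Theta>. norm (g x \<theta>) powr (2 + \<delta>) \<le> Qu x"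
  proof (rule measurable_envelope[of "\<lambda>x \<theta>. norm (g x \<theta>) powr (2 + \<delta>)" law \<Theta>])
    show "AE x in law. continuous_on \<Theta> (\<lambda>\<theta>. norm (g x \<theta>) powr (2 + \<delta>))"
      using g_cont unfolding D
      by eventually_elim (rule continuous_on_powr'[OF continuous_on_norm continuous_on_const], use delta_pos in auto)
  qed (use g_mom in \<open>auto simp: D\<close>)
  obtain Q where Q: "integrable law Q" "\<And>x. 0 \<le> Q x" "AE x in law. \<forall>\<theta>\<in>B. norm (g x \<theta>) ^ 4 \<le> Q x"
  proof (rule measurable_envelope[of "\<lambda>x \<theta>. norm (g x \<theta>) ^ 4" law B])
    show "AE x in law. continuous_on B (\<lambda>\<theta>. norm (g x \<theta>) ^ 4)"
      using g_cont unfolding D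
      by eventually_elim (auto intro!: continuous_intros intro: continuous_on_subset[OF _ B\<Theta>])
    have "(\<integral>\<^sup>+ x. (SUP \<theta>\<in>B. ennreal (norm (g x \<theta>) ^ 4)) \<partial>law) \<le> (\<integral>\<^sup>+ x. (SUP \<theta>\<in>\<N>. ennreal (norm (g x \<theta>) ^ 4)) \<partial>law)"
      using B\<N> by (intro nn_integral_mono SUP_subset_mono) auto
    then show "(\<integral>\<^sup>+ x. (SUP \<theta>\<in>B. ennreal (norm (g x \<theta>) ^ 4)) \<partial>law) < \<infinity>" using g_mom4 unfolding D by (rule le_less_trans)
  qed auto
  obtain PG where PG: "integrable law PG" "\<And>x. 0 \<le> PG x" "AE x in law. \<forall>\<theta>\<in>B. norm (G x \<theta>) ^ 2 \<le> PG x"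
  proof (rule measurable_envelope[of "\<lambda>x \<theta>. norm (G x \<theta>) ^ 2" law B])
    show "AE x in law. continuous_on B (\<lambda>\<theta>. norm (G x \<theta>) ^ 2)"
      using g_C1 unfolding D
      by eventually_elim (auto intro!: continuous_intros intro: continuous_on_subset[OF _ B\<N>])
    have "(\<integral>\<^sup>+ x. (SUP \<theta>\<in>B. ennreal (norm (G x \<theta>) ^ 2)) \<partial>law) \<le> (\<integral>\<^sup>+ x. (SUP \<theta>\<in>\<N>. ennreal (norm (G x \<theta>) ^ 2)) \<partial>law)"
      using B\<N> by (intro nn_integral_mono SUP_subset_mono) auto
    then show "(\<integral>\<^sup>+ x. (SUP \<theta>\<in>B. ennreal (norm (G x \<theta>) ^ 2)) \<partial>law) < \<infinity>" using G_mom2 unfolding D by (rule le_less_trans)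
  qed auto

  \<comment> \<open>Roots of the integrable envelopes: the square of \<open>u\<close>, the fourth
    power of \<open>q\<close> and the square of \<open>p\<close> are integrable again.
    \<open>e\<close> is the common envelope, with |b| in place of \<open>b\<close> because
    nonnegativity is required for every observation.\<close>
  define u where "u x = sqrt (1 + Qu x)" for x
  define q where "q x = sqrt (sqrt (Q x))" for x
  define p where "p x = sqrt (PG x)" for x
  define e where "e x = 1 + Q x + PG x + \<bar>b x\<bar>" for x
  have Qu_m [measurable]: "Qu \<in> borel_measurable S" using borel_measurable_integrable[OF Qu(1)] by (simp add: borel_law)
  have um: "u \<in> borel_measurable S" unfolding u_def[abs_def] by measurable
  have u2: "(u x)\<^sup>2 = 1 + Qu x" "0 \<le> u x" for x using Qu(2)[of x] by (auto simp: u_def)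
  have q4: "q x ^ 4 = Q x" "0 \<le> q x" for x
  proof -
    have "q x ^ 4 = ((q x)\<^sup>2)\<^sup>2" by (simp flip: power_mult)
    then show "q x ^ 4 = Q x" using Q(2)[of x] by (simp add: q_def)
  qed (simp add: q_def Q(2))
  have p2: "(p x)\<^sup>2 = PG x" "0 \<le> p x" for x using PG(2)[of x] by (auto simp: p_def)
  have e0: "0 \<le> e x" for x using Q(2)[of x] PG(2)[of x] by (simp add: e_def)
  have u2_int: "integrable law (\<lambda>x. (u x)\<^sup>2)" unfolding u2 using Qu(1) by simp
  have e_int: "integrable law e" unfolding e_def using Q(1) PG(1) b_int by (auto simp: D)
  have u_env: "AE x in law. \<forall>\<theta>\<in>\<Theta>. norm (g x \<theta>) \<le> u x"
    using Qu(3)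
  proof eventually_elim
    case (elim x)
    show ?case
    proof
      fix \<theta> assume "\<theta> \<in> \<Theta>"
      then have "(norm (g x \<theta>))\<^sup>2 \<le> (u x)\<^sup>2"
        using square_le_one_plus_powr[of "norm (g x \<theta>)" \<delta>] elim delta_pos unfolding u2 by force
      then show "norm (g x \<theta>) \<le> u x" by (rule power2_le_imp_le) (rule u2)
    qed
  qed
  have g4_int: "integrable law (\<lambda>x. norm (g x \<theta>0) ^ 4)"
    by (rule Bochner_Integration.integrable_bound[OF Q(1)])
       (use Q(3) in \<open>measurable, eventually_elim, use \<theta>0B in fastforce\<close>)
  have g2_int: "integrable law (\<lambda>x. (norm (g x \<theta>0))\<^sup>2)"
    by (rule L.square_integrable_imp_integrable) (measurable, use g4_int in \<open>simp flip: power_mult\<close>)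
  have G2_int: "integrable law (\<lambda>x. (norm (G x \<theta>0))\<^sup>2)"
    by (rule Bochner_Integration.integrable_bound[OF PG(1)])
       (use PG(3) in \<open>measurable, eventually_elim, use \<theta>0B in fastforce\<close>)

  obtain \<kappa> where \<kappa>: "0 < \<kappa>" "\<And>\<epsilon>. 0 < \<epsilon> \<Longrightarrow> whp M \<epsilon> (\<lambda>n \<omega>. \<forall>v. \<kappa> * (norm v)\<^sup>2 \<le> avg n (\<lambda>i. (v \<bullet> g (X i \<omega>) \<theta>0)\<^sup>2))"
    using gram_bounded_below[OF g_meas g4_int Omega_fin[unfolded D] Omega_nonsing[unfolded D]] by blast
  obtain \<gamma> where \<gamma>: "0 < \<gamma>" "\<And>\<epsilon>. 0 < \<epsilon> \<Longrightarrow> whp M \<epsilon> (\<lambda>n \<omega>. \<forall>h. \<gamma> * norm h \<le> norm (avg n (\<lambda>i. G (X i \<omega>) \<theta>0 *v h)))"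
    using jacobian_bounded_below[OF G_meas G2_int G_rank[unfolded D]] by blast

  \<comment> \<open>The facts that hold for almost every observation; \<open>AE_X\<close> makes them
    hold for all observations simultaneously, almost surely.\<close>
  define reg where "reg x \<longleftrightarrow> (\<forall>\<theta>\<in>B. (g x has_derivative (\<lambda>h. G x \<theta> *v h)) (at \<theta>)) \<and> (\<forall>\<theta>\<in>B. norm (g x \<theta>) \<le> q x)
     \<and> (\<forall>\<theta>\<in>B. norm (G x \<theta>) \<le> p x) \<and> (\<forall>\<theta>\<in>B. \<forall>\<theta>'\<in>B. norm (G x \<theta> - G x \<theta>') \<le> \<bar>b x\<bar> * norm (\<theta> - \<theta>'))
     \<and> (\<forall>\<theta>\<in>\<Theta>. norm (g x \<theta>) \<le> u x)" for x
  have reg: "AE x in law. reg x"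
    using g_C1[unfolded D] Q(3) PG(3) G_lip[unfolded D] u_env
  proof eventually_elim
    case (elim x)
    have "norm (g x \<theta>) \<le> q x" if "\<theta> \<in> B" for \<theta>
    proof (rule power_le_imp_le_base[where n = 3, simplified])
      show "norm (g x \<theta>) ^ 4 \<le> q x ^ 4" using elim(2) that by (simp add: q4)
    qed (rule q4)
    moreover have "norm (G x \<theta>) \<le> p x" if "\<theta> \<in> B" for \<theta>
      by (rule power2_le_imp_le[OF _ p2(2)]) (use elim(3) that in \<open>simp add: p2\<close>)
    moreover have "norm (G x \<theta> - G x \<theta>') \<le> \<bar>b x\<bar> * norm (\<theta> - \<theta>')" if "\<theta> \<in> B" "\<theta>' \<in> B" for \<theta> \<theta>'
    proof -
      have "norm (G x \<theta> - G x \<theta>') \<le> b x * norm (\<theta> - \<theta>')" using elim(4) that B\<N> by blast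
      also have "\<dots> \<le> \<bar>b x\<bar> * norm (\<theta> - \<theta>')" by (intro mult_right_mono) auto
      finally show ?thesis .
    qed
    ultimately show ?case unfolding reg_def using elim(1,5) B\<N> by blast
  qed

  show ?thesis
    unfolding bigOp_def
  proof (intro allI impI)
    fix \<epsilon> :: real assume \<epsilon>: "0 < \<epsilon>"
    \<comment> \<open>Eight events with error \<eta> each add up to \<epsilon>/2, which leaves room
      for the strict inequality at the end.\<close>
    define \<eta> where "\<eta> = \<epsilon> / 16"
    have \<eta>: "0 < \<eta>" using \<epsilon> by (simp add: \<eta>_def)
    obtain K3 where K3: "whp M \<eta> (\<lambda>n \<omega>. norm (avg n (\<lambda>i. g (X i \<omega>) \<theta>0)) \<le> K3 * (1 / sqrt (real n)))"
      using root_n_avg_vec[OF g_meas g2_int moment0[unfolded D] \<eta>] by blast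
    \<comment> \<open>The constants are fixed in a forced order. \<open>\<kappa>\<close> and
      \<open>\<gamma>\<close> do not depend on \<epsilon>; \<open>K\<close> depends on \<epsilon>,
      the radius \<open>r\<close> on \<open>K\<close> and \<open>\<gamma>\<close>, the separation
      constant \<open>c\<close> on \<open>r\<close>, and \<open>C\<close> on all of them.\<close>
    define K where "K = Max {1, integral\<^sup>L law e / \<eta>, integral\<^sup>L law (\<lambda>x. (u x)\<^sup>2) / \<eta>, K3}"
    have K: "1 \<le> K" "integral\<^sup>L law e / \<eta> \<le> K" "integral\<^sup>L law (\<lambda>x. (u x)\<^sup>2) / \<eta> \<le> K" "K3 \<le> K"
      by (auto simp: K_def)
    have K0: "0 < K" using K by simp
    define r where "r = min R (\<gamma> / (2 * K))"
    have r: "0 < r" "r \<le> R" "2 * K * r \<le> \<gamma>"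
    proof -
      show "0 < r" "r \<le> R" using R \<gamma> K by (auto simp: r_def)
      have "2 * K * r \<le> 2 * K * (\<gamma> / (2 * K))" using K by (intro mult_left_mono) (auto simp: r_def)
      then show "2 * K * r \<le> \<gamma>" using K by simp
    qed
    obtain c where c: "0 < c" "\<And>\<epsilon>. 0 < \<epsilon> \<Longrightarrow> whp M \<epsilon> (\<lambda>n \<omega>. \<forall>\<theta>\<in>\<Theta>. r \<le> norm (\<theta> - \<theta>0) \<longrightarrow> c \<le> norm (avg n (\<lambda>i. g (X i \<omega>) \<theta>)))"
      using separation[OF g_meas g_cont[unfolded D] um u2_int u_env u2(2) Theta_compact ident[unfolded D] r(1)] by blast
    obtain C where C: "\<forall>\<^sub>F n in sequentially. \<forall>q p b e (g :: 'b \<Rightarrow> real^'p \<Rightarrow> real^'g) x G u \<Theta> t0 r tE tL.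
      good_sample n q p b e K g x G u \<Theta> t0 R r c \<kappa> \<gamma> \<longrightarrow> is_maximizer (etel_obj g x n) \<Theta> tE \<longrightarrow>
      is_maximizer (el_obj g x n) \<Theta> tL \<longrightarrow> norm (tE - tL) \<le> C * (1 / sqrt (real n)) ^ 3"
      using good_sample_rate[OF K0 \<kappa>(1) \<gamma>(1) R(1) c(1)] by blast
    define good where "good n \<omega> \<longleftrightarrow>
        (is_maximizer (etel_obj g (\<lambda>i. X i \<omega>) n) \<Theta> (tE n \<omega>) \<and> is_maximizer (el_obj g (\<lambda>i. X i \<omega>) n) \<Theta> (tL n \<omega>)) \<and>
        (\<forall>i. reg (X i \<omega>)) \<and> avg n (\<lambda>i. e (X i \<omega>)) \<le> K \<and> avg n (\<lambda>i. (u (X i \<omega>))\<^sup>2) \<le> K \<and>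
        norm (avg n (\<lambda>i. g (X i \<omega>) \<theta>0)) \<le> K3 * (1 / sqrt (real n)) \<and>
        (\<forall>v. \<kappa> * (norm v)\<^sup>2 \<le> avg n (\<lambda>i. (v \<bullet> g (X i \<omega>) \<theta>0)\<^sup>2)) \<and>
        (\<forall>h. \<gamma> * norm h \<le> norm (avg n (\<lambda>i. G (X i \<omega>) \<theta>0 *v h))) \<and>
        (\<forall>\<theta>\<in>\<Theta>. r \<le> norm (\<theta> - \<theta>0) \<longrightarrow> c \<le> norm (avg n (\<lambda>i. g (X i \<omega>) \<theta>)))" for n \<omega>
    have est: "whp M \<eta> (\<lambda>n \<omega>. is_maximizer (etel_obj g (\<lambda>i. X i \<omega>) n) \<Theta> (tE n \<omega>) \<and> is_maximizer (el_obj g (\<lambda>i. X i \<omega>) n) \<Theta> (tL n \<omega>))"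
      unfolding whp_def using estimators[OF \<eta>] .
    have "whp M (\<eta> + (\<eta> + (\<eta> + (\<eta> + (\<eta> + (\<eta> + (\<eta> + \<eta>))))))) good"
      unfolding good_def[abs_def] using e0 K K0 \<eta> u2(2)
      by (intro whp_conj est whp_AE[OF AE_X[OF reg]] markov_avg[OF e_int] markov_avg[OF u2_int] K3 \<kappa>(2) \<gamma>(2) c(2)) auto
    then have whp_good: "whp M (\<epsilon> / 2) good" by (simp add: \<eta>_def)

    have close: "\<forall>\<^sub>F n in sequentially. \<forall>\<omega>. good n \<omega> \<longrightarrow> norm (tE n \<omega> - tL n \<omega>) \<le> C * real n powr (-3/2)"
      using C eventually_gt_at_top[of 0]
    proof eventually_elim
      case (elim n)
      show ?case
      proof (intro allI impI)
        fix \<omega> assume good: "good n \<omega>"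
        have regi: "reg (X i \<omega>)" for i using good by (simp add: good_def)
        have "good_sample n (\<lambda>i. q (X i \<omega>)) (\<lambda>i. p (X i \<omega>)) (\<lambda>i. \<bar>b (X i \<omega>)\<bar>) (\<lambda>i. e (X i \<omega>)) K g (\<lambda>i. X i \<omega>)
            (\<lambda>i \<theta> h. G (X i \<omega>) \<theta> *v h) (\<lambda>i. u (X i \<omega>)) \<Theta> \<theta>0 R r c \<kappa> \<gamma>"
        proof (intro good_sample.intro sample_envelope.intro good_sample_axioms.intro)
          show "0 < n" by (rule elim(2))
          show "avg n (\<lambda>i. e (X i \<omega>)) \<le> K" "avg n (\<lambda>i. (u (X i \<omega>))\<^sup>2) \<le> K" using good by (auto simp: good_def)
          show "0 \<le> q (X i \<omega>)" "0 \<le> p (X i \<omega>)" "0 \<le> \<bar>b (X i \<omega>)\<bar>" for i by (auto simp: q4 p2)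
          show "1 + q (X i \<omega>) ^ 4 + (p (X i \<omega>))\<^sup>2 + \<bar>b (X i \<omega>)\<bar> \<le> e (X i \<omega>)" for i by (simp add: q4 p2 e_def)
          show "cball \<theta>0 R \<subseteq> \<Theta>" using B\<Theta> by (simp add: B_def)
          show "r \<le> R" "2 * K * r \<le> \<gamma>" "0 < R" "0 < \<kappa>" "0 < \<gamma>" using r R \<kappa> \<gamma> by auto
          show "(g (X i \<omega>) has_derivative (\<lambda>h. G (X i \<omega>) \<theta> *v h)) (at \<theta>)" if "\<theta> \<in> cball \<theta>0 R" for i \<theta>
            using regi[of i] that by (auto simp: reg_def B_def)
          show "norm (g (X i \<omega>) \<theta>) \<le> q (X i \<omega>)" if "\<theta> \<in> cball \<theta>0 R" for i \<theta>
            using regi[of i] that by (auto simp: reg_def B_def)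
          show "norm (G (X i \<omega>) \<theta> *v h) \<le> p (X i \<omega>) * norm h" if "\<theta> \<in> cball \<theta>0 R" for i \<theta> h
          proof -
            have "norm (G (X i \<omega>) \<theta>) \<le> p (X i \<omega>)" using regi[of i] that by (auto simp: reg_def B_def)
            then show ?thesis by (intro order_trans[OF norm_matrix_vector_le] mult_right_mono) auto
          qed
          show "norm (G (X i \<omega>) \<theta> *v h - G (X i \<omega>) \<theta>' *v h) \<le> \<bar>b (X i \<omega>)\<bar> * norm (\<theta> - \<theta>') * norm h"
            if "\<theta> \<in> cball \<theta>0 R" "\<theta>' \<in> cball \<theta>0 R" for i \<theta> \<theta>' h
          proof -
            have "norm (G (X i \<omega>) \<theta> - G (X i \<omega>) \<theta>') \<le> \<bar>b (X i \<omega>)\<bar> * norm (\<theta> - \<theta>')"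
              using regi[of i] that unfolding reg_def B_def by blast
            then show ?thesis unfolding matrix_vector_mult_diff_rdistrib[symmetric]
              by (intro order_trans[OF norm_matrix_vector_le] mult_right_mono) auto
          qed
          show "\<kappa> * (norm v)\<^sup>2 \<le> avg n (\<lambda>i. (v \<bullet> g (X i \<omega>) \<theta>0)\<^sup>2)" for v using good by (simp add: good_def)
          show "\<gamma> * norm h \<le> norm (avg n (\<lambda>i. G (X i \<omega>) \<theta>0 *v h))" for h using good by (simp add: good_def)
          have "K3 * (1 / sqrt (real n)) \<le> K * (1 / sqrt (real n))" using K by (intro mult_right_mono) auto
          then show "norm (avg n (\<lambda>i. g (X i \<omega>) \<theta>0)) \<le> K * (1 / sqrt (real n))" using good unfolding good_def by linarith
          show "norm (g (X i \<omega>) \<theta>) \<le> u (X i \<omega>)" if "\<theta> \<in> \<Theta>" for i \<theta>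
            using regi[of i] that by (auto simp: reg_def)
          show "c \<le> norm (avg n (\<lambda>i. g (X i \<omega>) \<theta>))" if "\<theta> \<in> \<Theta>" "r \<le> norm (\<theta> - \<theta>0)" for \<theta>
            using good that by (simp add: good_def)
        qed
        moreover have "is_maximizer (etel_obj g (\<lambda>i. X i \<omega>) n) \<Theta> (tE n \<omega>)" "is_maximizer (el_obj g (\<lambda>i. X i \<omega>) n) \<Theta> (tL n \<omega>)"
          using good by (auto simp: good_def)
        ultimately have "norm (tE n \<omega> - tL n \<omega>) \<le> C * (1 / sqrt (real n)) ^ 3" using elim(1) by blast
        moreover have "(1 / sqrt (real n)) ^ 3 = real n powr (-3/2)"
        proof -
          have "1 / sqrt (real n) = real n powr (- 1/2)" using elim(2) by (simp add: powr_minus_divide powr_half_sqrt)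
          then show ?thesis using elim(2) by (simp add: powr_power)
        qed
        ultimately show "norm (tE n \<omega> - tL n \<omega>) \<le> C * real n powr (-3/2)" by simp
      qed
    qed
    from whp_mono[OF whp_good order_refl close]
    obtain N where N: "\<And>n. N \<le> n \<Longrightarrow> \<exists>A\<in>sets M. 1 - \<epsilon> / 2 \<le> measure M A \<and> (\<forall>\<omega>\<in>A. norm (tE n \<omega> - tL n \<omega>) \<le> C * real n powr (-3/2))"
      unfolding whp_def eventually_sequentially by blast
    have "measure M {\<omega>\<in>space M. \<bar>norm (tE n \<omega> - tL n \<omega>)\<bar> > C * real n powr (-3/2)} < \<epsilon>" if "N \<le> n" for n
    proof -
      obtain A where A: "A \<in> sets M" "1 - \<epsilon> / 2 \<le> measure M A" "\<forall>\<omega>\<in>A. norm (tE n \<omega> - tL n \<omega>) \<le> C * real n powr (-3/2)"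
        using N[OF \<open>N \<le> n\<close>] by blast
      have "measure M {\<omega>\<in>space M. \<bar>norm (tE n \<omega> - tL n \<omega>)\<bar> > C * real n powr (-3/2)} \<le> measure M (space M - A)"
        using A by (intro finite_measure_mono) force+
      also have "\<dots> = 1 - measure M A" by (rule prob_compl[OF A(1)])
      finally show ?thesis using A(2) \<epsilon> by linarith
    qed
    then show "\<exists>C N. \<forall>n\<ge>N. measure M {\<omega>\<in>space M. \<bar>norm (tE n \<omega> - tL n \<omega>)\<bar> > C * real n powr (-3/2)} < \<epsilon>" by blast
  qed
qed

end
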